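(* For every $\theta\in[0,\pi/2]$ and all positive integers $g$ and $k$, there exists a collection $\mathcal{C}$ of circles in the plane whose $\theta$-graph $G_\theta(\mathcal{C})$ has girth at least $g$ and chromatic number at least $k$.
   Context: Two intersecting circles $C_1,C_2$ intersect at angle $\theta$ if at any intersection point of $C_1$ and $C_2$, the (smaller) angle between the tangent line to $C_1$ and the tangent line to $C_2$ equals $\theta$; in particular, intersecting at angle $0$ means being tangent. For $\theta\in[0,\pi/2]$, the $\theta$-graph $G_\theta(\mathcal{C})$ of a collection of circles $\mathcal{C}$ is the graph with vertex set $\mathcal{C}$ whose edges are the pairs of circles in $\mathcal{C}$ that intersect at angle $\theta$. The girth of a graph is the minimum length of a cycle in it. *)

theory Defs
  imports "HOL-Analysis.Analysis" "HOL-Library.Extended_Nat"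
begin

definition is_circle :: "(real^2) set \<Rightarrow> bool" where
  "is_circle C \<longleftrightarrow> (\<exists>c r. r > 0 \<and> C = sphere c r)"

definition is_line :: "(real^2) set \<Rightarrow> bool" where
  "is_line L \<longleftrightarrow> affine L \<and> aff_dim L = 1"

text \<open>The tangent line to a circle at one of its points is the unique line that meets the circle
  in that point only; see \<open>tangent_line_sphere\<close> below.\<close>

definition tangent_line :: "(real^2) set \<Rightarrow> real^2 \<Rightarrow> (real^2) set" where
  "tangent_line C p = (THE L. is_line L \<and> L \<inter> C = {p})"

definition vec_angle :: "real^2 \<Rightarrow> real^2 \<Rightarrow> real" where
  "vec_angle u v = arccos (u \<bullet> v / (norm u * norm v))"

text \<open>Over all choices of direction vectors of two lines, \<open>vec_angle\<close> takes (at most) two values,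
  \<open>\<alpha>\<close> and \<open>pi - \<alpha>\<close>; the angle between the lines is the smaller one.\<close>

definition line_angle :: "(real^2) set \<Rightarrow> (real^2) set \<Rightarrow> real" where
  "line_angle L M = Min {vec_angle (x' - x) (y' - y) | x x' y y'.
     x \<in> L \<and> x' \<in> L \<and> x \<noteq> x' \<and> y \<in> M \<and> y' \<in> M \<and> y \<noteq> y'}"

definition intersect_at_angle :: "real \<Rightarrow> (real^2) set \<Rightarrow> (real^2) set \<Rightarrow> bool" where
  "intersect_at_angle \<theta> C D \<longleftrightarrow>
     C \<inter> D \<noteq> {} \<and> (\<forall>p\<in>C \<inter> D. line_angle (tangent_line C p) (tangent_line D p) = \<theta>)"

text \<open>A graph is a pair of a vertex set and a set of edges, where edges are two-element sets of
  vertices.\<close>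

type_synonym 'a graph = "'a set \<times> 'a set set"

text \<open>A cycle is given by the list of its pairwise distinct vertices, the last one being joined to
  the first; its length is the length of the list.\<close>

definition is_cycle :: "'a graph \<Rightarrow> 'a list \<Rightarrow> bool" where
  "is_cycle G vs \<longleftrightarrow> 3 \<le> length vs \<and> distinct vs \<and> set vs \<subseteq> fst G \<and>
     (\<forall>i<length vs. {vs ! i, vs ! (Suc i mod length vs)} \<in> snd G)"

text \<open>The girth of an acyclic graph is \<open>\<infinity>\<close>, the infimum of the empty set.\<close>

definition girth :: "'a graph \<Rightarrow> enat" where
  "girth G = (INF vs\<in>{vs. is_cycle G vs}. enat (length vs))"

definition proper_colouring :: "'a graph \<Rightarrow> nat \<Rightarrow> ('a \<Rightarrow> nat) \<Rightarrow> bool" where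
  "proper_colouring G n f \<longleftrightarrow>
     f ` fst G \<subseteq> {..<n} \<and> (\<forall>u v. {u, v} \<in> snd G \<longrightarrow> f u \<noteq> f v)"

text \<open>The chromatic number is \<open>\<infinity>\<close> if no finite number of colours suffices.\<close>

definition chromatic_number :: "'a graph \<Rightarrow> enat" where
  "chromatic_number G = (INF n\<in>{n. \<exists>f. proper_colouring G n f}. enat n)"

definition theta_graph :: "real \<Rightarrow> (real^2) set set \<Rightarrow> (real^2) set graph" where
  "theta_graph \<theta> \<C> =
     (\<C>, {{C, D} | C D. C \<in> \<C> \<and> D \<in> \<C> \<and> C \<noteq> D \<and> intersect_at_angle \<theta> C D})"

lemma sum_sq_vec2: "norm (v::real^2) = sqrt ((v$1)^2 + (v$2)^2)"
  by (simp add: norm_vec_def L2_set_def sum_2)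

lemma inner_vec2: "(u::real^2) \<bullet> v = u$1 * v$1 + u$2 * v$2"
  by (simp add: inner_vec_def sum_2)

lemma is_line_iff: "is_line L \<longleftrightarrow> (\<exists>p v. v \<noteq> 0 \<and> L = range (\<lambda>t. p + t *\<^sub>R v))"
proof
  assume L: "is_line L"
  then have "\<exists>a b. a \<in> L \<and> b \<in> L \<and> a \<noteq> b"
  proof -
    have "L \<noteq> {}" using L by (auto simp: is_line_def)
    then obtain a where a: "a \<in> L" by auto
    have "L \<noteq> {a}" using L by (auto simp: is_line_def)
    with a show ?thesis by blast
  qed
  then obtain a b where ab: "a \<in> L" "b \<in> L" "a \<noteq> b" by blast
  have sub: "affine hull {a, b} \<subseteq> L"
    using L ab by (intro hull_minimal) (auto simp: is_line_def)
  have "aff_dim (affine hull {a, b}) = aff_dim L"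
    using L ab by (simp add: is_line_def aff_dim_2)
  then have "affine hull {a, b} = L"
    using sub L by (intro affine_dim_equal) (auto simp: is_line_def)
  moreover have "affine hull {a, b} = range (\<lambda>t. a + t *\<^sub>R (b - a))"
  proof (intro set_eqI iffI)
    fix x assume "x \<in> affine hull {a, b}"
    then obtain u v where "x = u *\<^sub>R a + v *\<^sub>R b" "u + v = 1" by (auto simp: affine_hull_2)
    moreover from this have "u = 1 - v" by simp
    ultimately have "x = a + v *\<^sub>R (b - a)" by (simp add: algebra_simps)
    then show "x \<in> range (\<lambda>t. a + t *\<^sub>R (b - a))" by blast
  next
    fix x assume "x \<in> range (\<lambda>t. a + t *\<^sub>R (b - a))"
    then obtain t where "x = a + t *\<^sub>R (b - a)" by blast
    then have "x = (1 - t) *\<^sub>R a + t *\<^sub>R b" by (simp add: algebra_simps)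
    then show "x \<in> affine hull {a, b}" unfolding affine_hull_2 
      by (intro CollectI exI[of _ "1 - t"] exI[of _ t]) auto
  qed
  ultimately show "\<exists>p v. v \<noteq> 0 \<and> L = range (\<lambda>t. p + t *\<^sub>R v)"
    using ab by (intro exI[of _ a] exI[of _ "b - a"]) auto
next
  assume "\<exists>p v. v \<noteq> 0 \<and> L = range (\<lambda>t. p + t *\<^sub>R v)"
  then obtain p v where v: "v \<noteq> 0" and L: "L = range (\<lambda>t. p + t *\<^sub>R v)" by blast
  have "L = affine hull {p, p + v}"
  proof (intro set_eqI iffI)
    fix x assume "x \<in> L"
    then obtain t where "x = (1 - t) *\<^sub>R p + t *\<^sub>R (p + v)" by (auto simp: L algebra_simps)
    then show "x \<in> affine hull {p, p + v}" unfolding affine_hull_2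
      by (intro CollectI exI[of _ "1 - t"] exI[of _ t]) auto
  next
    fix x assume "x \<in> affine hull {p, p + v}"
    then obtain s t where "x = s *\<^sub>R p + t *\<^sub>R (p + v)" "s + t = 1" by (auto simp: affine_hull_2)
    moreover from this have "s = 1 - t" by simp
    ultimately have "x = p + t *\<^sub>R v" by (simp add: algebra_simps)
    then show "x \<in> L" by (auto simp: L)
  qed
  then show "is_line L" using v by (simp add: is_line_def aff_dim_2)
qed

definition rot90 :: "real^2 \<Rightarrow> real^2" where
  "rot90 v = vector [- v$2, v$1]"

lemma rot90_nth [simp]: "rot90 v $ 1 = - v$2" "rot90 v $ 2 = v$1"
  by (auto simp: rot90_def)

lemma rot90_props: "rot90 v \<bullet> v = 0" "rot90 u \<bullet> rot90 v = u \<bullet> v" "norm (rot90 v) = norm v"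
  by (auto simp: inner_vec2 sum_sq_vec2 add.commute)

lemma orthogonal_vec2: "v \<noteq> 0 \<Longrightarrow> (x::real^2) \<bullet> v = 0 \<longleftrightarrow> (\<exists>t. x = t *\<^sub>R rot90 v)"
proof
  assume v: "v \<noteq> 0" and "x \<bullet> v = 0"
  then have eq: "x$1 * v$1 + x$2 * v$2 = 0" by (simp add: inner_vec2)
  let ?n = "(v$1)^2 + (v$2)^2"
  have n: "?n \<noteq> 0" using v by (auto simp: vec_eq_iff forall_2 sum_power2_eq_zero_iff)
  have "x$1 * ?n = (x$2 * v$1 - x$1 * v$2) * (- v$2)"
       "x$2 * ?n = (x$2 * v$1 - x$1 * v$2) * v$1" 
    using eq by algebra+
  then have "x = ((x$2 * v$1 - x$1 * v$2) / ?n) *\<^sub>R rot90 v"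
    using n by (simp add: vec_eq_iff forall_2 field_simps)
  then show "\<exists>t. x = t *\<^sub>R rot90 v" by blast
qed (auto simp: rot90_props)

theorem tangent_line_sphere:
  assumes r: "r > 0" and p: "p \<in> sphere c r"
  shows "tangent_line (sphere c r) p = {x. (x - p) \<bullet> (p - c) = 0}"
    and "tangent_line (sphere c r) p = range (\<lambda>t. p + t *\<^sub>R rot90 (p - c))"
proof -
  let ?T = "{x. (x - p) \<bullet> (p - c) = 0}"
  have pc: "p - c \<noteq> 0" using r p by auto
  have T: "?T = range (\<lambda>t. p + t *\<^sub>R rot90 (p - c))"
  proof (intro set_eqI)
    fix x
    have "x \<in> ?T \<longleftrightarrow> (\<exists>t. x - p = t *\<^sub>R rot90 (p - c))"
      using orthogonal_vec2[OF pc] by simp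
    also have "\<dots> \<longleftrightarrow> x \<in> range (\<lambda>t. p + t *\<^sub>R rot90 (p - c))"
      by (simp add: image_iff diff_eq_eq add.commute)
    finally show "x \<in> ?T \<longleftrightarrow> x \<in> range (\<lambda>t. p + t *\<^sub>R rot90 (p - c))" .
  qed
  have rot: "rot90 (p - c) \<noteq> 0" using pc by (metis norm_eq_zero rot90_props(3))
  have on: "x \<in> sphere c r \<longleftrightarrow> (x - p) \<bullet> (x - p) + 2 * ((x - p) \<bullet> (p - c)) = 0" for x
  proof -
    have "x \<in> sphere c r \<longleftrightarrow> (x - c) \<bullet> (x - c) = (p - c) \<bullet> (p - c)"
      using r p by (auto simp: dist_norm norm_minus_commute[of c] norm_eq_sqrt_inner
          inner_diff_left inner_diff_right inner_commute)
    moreover have "(x - c) \<bullet> (x - c) = (x - p) \<bullet> (x - p) + 2 * ((x - p) \<bullet> (p - c)) + (p - c) \<bullet> (p - c)"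
      by (simp add: algebra_simps inner_commute)
    ultimately show ?thesis by simp
  qed
  have "tangent_line (sphere c r) p = ?T"
    unfolding tangent_line_def
  proof (rule the_equality)
    show "is_line ?T \<and> ?T \<inter> sphere c r = {p}"
    proof
      show "is_line ?T" using rot T unfolding is_line_iff by blast
      show "?T \<inter> sphere c r = {p}" unfolding set_eq_iff Int_iff on by auto
    qed
  next
    fix L assume L: "is_line L \<and> L \<inter> sphere c r = {p}"
    then obtain q v where v: "v \<noteq> 0" and Lq: "L = range (\<lambda>t. q + t *\<^sub>R v)"
      by (auto simp: is_line_iff)
    from L Lq obtain s where s: "p = q + s *\<^sub>R v" by blast
    have inL: "p + t *\<^sub>R v \<in> L" for t
      unfolding Lq s by (intro image_eqI[of _ _ "s + t"]) (auto simp: algebra_simps)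
    define t where "t = - 2 * (v \<bullet> (p - c)) / (v \<bullet> v)"
    have vv: "v \<bullet> v \<noteq> 0" using v by simp
    have "p + t *\<^sub>R v \<in> sphere c r"
      unfolding on using vv by (simp add: t_def)
    with inL L have "p + t *\<^sub>R v = p" by blast
    then have ort: "v \<bullet> (p - c) = 0" using v vv by (simp add: t_def)
    then obtain a where a: "v = a *\<^sub>R rot90 (p - c)" using orthogonal_vec2[OF pc] by blast
    with v have a0: "a \<noteq> 0" by auto
    have "L \<subseteq> ?T" using ort by (auto simp: Lq s simp flip: scaleR_diff_left)
    moreover have "?T \<subseteq> L"
    proof
      fix x assume "x \<in> ?T"
      then obtain b where "x = p + b *\<^sub>R rot90 (p - c)" using T by blast
      then have "x = p + (b / a) *\<^sub>R v" using a a0 by simp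
      then show "x \<in> L" using inL by simp
    qed
    ultimately show "L = ?T" by blast
  qed
  then show "tangent_line (sphere c r) p = ?T"
    "tangent_line (sphere c r) p = range (\<lambda>t. p + t *\<^sub>R rot90 (p - c))" using T by auto
qed

lemma line_angle_range:
  assumes u: "u \<noteq> 0" and v: "v \<noteq> 0"
  shows "line_angle (range (\<lambda>t. p + t *\<^sub>R u)) (range (\<lambda>t. q + t *\<^sub>R v)) =
    arccos (\<bar>u \<bullet> v\<bar> / (norm u * norm v))"
proof -
  let ?L = "range (\<lambda>t. p + t *\<^sub>R u)" and ?M = "range (\<lambda>t. q + t *\<^sub>R v)"
  let ?A = "{vec_angle (x' - x) (y' - y) | x x' y y'.
     x \<in> ?L \<and> x' \<in> ?L \<and> x \<noteq> x' \<and> y \<in> ?M \<and> y' \<in> ?M \<and> y \<noteq> y'}"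
  let ?c = "u \<bullet> v / (norm u * norm v)"
  have ang: "vec_angle (s *\<^sub>R u) (t *\<^sub>R v) = arccos (sgn (s * t) * ?c)" for s t
    by (simp add: vec_angle_def sgn_mult) 
      (simp add: sgn_if field_simps abs_if)
  have A: "?A = {arccos ?c, arccos (- ?c)}" (is "_ = ?B")
  proof (intro subset_antisym subsetI)
    fix \<alpha> assume "\<alpha> \<in> ?A"
    then obtain s s' t t' where st: "\<alpha> = vec_angle ((s' - s) *\<^sub>R u) ((t' - t) *\<^sub>R v)" "s \<noteq> s'" "t \<noteq> t'"
      by (auto simp: scaleR_diff_left)
    then show "\<alpha> \<in> ?B" unfolding st(1) ang by (auto simp: sgn_if)
  next
    have "vec_angle (s *\<^sub>R u) (t *\<^sub>R v) \<in> ?A" if "s \<noteq> 0" "t \<noteq> 0" for s t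
      using that u v
      by (intro CollectI exI[of _ p] exI[of _ "p + s *\<^sub>R u"] exI[of _ q] exI[of _ "q + t *\<^sub>R v"])
         (auto simp: image_iff intro: exI[of _ 0])
    from this[of 1 1] this[of 1 "-1"] have "arccos ?c \<in> ?A" "arccos (- ?c) \<in> ?A"
      unfolding ang by simp_all
    then show "\<alpha> \<in> ?A" if "\<alpha> \<in> ?B" for \<alpha> using that by blast
  qed
  have c: "\<bar>?c\<bar> \<le> 1"
    using Cauchy_Schwarz_ineq2[of u v] u v by (simp add: abs_mult divide_le_eq_1)
  have "line_angle ?L ?M = min (arccos ?c) (arccos (- ?c))"
    unfolding line_angle_def A by simp
  also have "\<dots> = arccos \<bar>?c\<bar>"
    using c arccos_le_mono[of ?c "- ?c"] by (auto simp: min_def abs_if)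
  finally show ?thesis by (simp add: abs_mult)
qed

theorem intersect_at_angle_sphere:
  assumes r: "r > 0" "s > 0" and \<theta>: "0 \<le> \<theta>" "\<theta> \<le> pi / 2"
  shows "intersect_at_angle \<theta> (sphere c r) (sphere d s) \<longleftrightarrow>
    sphere c r \<inter> sphere d s \<noteq> {} \<and>
    (\<forall>p \<in> sphere c r \<inter> sphere d s. \<bar>(p - c) \<bullet> (p - d)\<bar> = r * s * cos \<theta>)"
proof -
  have "line_angle (tangent_line (sphere c r) p) (tangent_line (sphere d s) p) = \<theta> \<longleftrightarrow>
      \<bar>(p - c) \<bullet> (p - d)\<bar> = r * s * cos \<theta>" if p: "p \<in> sphere c r" "p \<in> sphere d s" for p
  proof -
    have n: "norm (p - c) = r" "norm (p - d) = s" 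
      using p by (auto simp: dist_norm norm_minus_commute)
    with r have nz: "rot90 (p - c) \<noteq> 0" "rot90 (p - d) \<noteq> 0"
      by (metis norm_zero order_less_irrefl rot90_props(3))+
    let ?c = "\<bar>(p - c) \<bullet> (p - d)\<bar> / (r * s)"
    have "line_angle (tangent_line (sphere c r) p) (tangent_line (sphere d s) p) = arccos ?c"
      using line_angle_range[OF nz] tangent_line_sphere(2) r p n by (simp add: rot90_props)
    moreover have "0 \<le> ?c" "?c \<le> 1"
      using Cauchy_Schwarz_ineq2[of "p - c" "p - d"] r n by (auto simp: divide_le_eq_1)
    then have "arccos ?c = \<theta> \<longleftrightarrow> ?c = cos \<theta>"
      using \<theta> arccos_cos[of \<theta>] cos_arccos[of ?c] by auto
    ultimately show ?thesis using r by (simp add: field_simps)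
  qed
  then show ?thesis unfolding intersect_at_angle_def by auto
qed

end

theory Submission
  imports Defs "HOL-Computational_Algebra.Polynomial"
begin

text \<open>A Tutte-style construction, by induction on the chromatic number. Given a family \<open>C\<close> of circles that
  is not \<open>k\<close>-colourable, fix a direction; every \<open>v \<in> C\<close> makes the angle \<open>\<theta>\<close> with a line of that direction
  at some height \<open>\<tau> v\<close>, and homotheties act on \<open>C\<close> and on the heights simultaneously. If \<open>Xs\<close> is a finite
  set of heights every \<open>(k + 1)\<close>-colouring of which makes some homothetic copy of \<open>\<tau> ` C\<close> monochromatic,
  then the lines at the heights \<open>Xs\<close>, together with one copy of \<open>C\<close> for each such homothetic copy, are
  not \<open>(k + 1)\<close>-colourable. Copies are kept apart by translations along the lines, and a final inversion
  turns the lines into circles. For \<open>\<theta> = 0\<close> parallel lines would become tangent; there one uses internal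
  tangency of circles with signed radii, which is invariant under adding a constant to all radii, and
  concentric circles in place of the lines.

  Short cycles are avoided by a sparse version of Gallai's theorem on the line, in which the homothetic
  copies form a hypergraph of large girth. It follows from the Hales-Jewett theorem by partite
  amalgamation, carried out in the plane with the parts as columns.\<close>

section \<open>The Hales-Jewett theorem\<close>

text \<open>Every hypothesis that guards against short cycles is a count: fewer incidences than
  copies plus points, fewer edges than vertices. Such bounds add up. The counts inside the copies,
  together with the count of the structure in which each copy is contracted to one point, give the
  count of the whole; the amalgamation and the attaching of copies are both this sum.

  The obstacle is that a circle in general makes the prescribed angle with two lines of the given
  direction, and touches two circles of a concentric family. A vertex attached at one height
  therefore threatens to acquire a second, uncontrolled neighbour. This is the origin of the
  parameter set \<open>B\<close>: the points of the copies at \<open>B\<close> have to miss the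
  whole point set, and this must survive every amalgamation and the final projection.

  Most accidental coincidences (shared points, adjacent copies, concentric images) are excluded by
  the choice of a parameter outside a finite set, usually the roots of finitely many nonzero
  polynomials.\<close>

definition words :: "'a set \<Rightarrow> nat \<Rightarrow> 'a list set" where
  "words A n = {w. set w \<subseteq> A \<and> length w = n}"

text \<open>\<open>None\<close> marks the moving coordinates, \<open>Some s\<close> a frozen one.
  Evaluation outside the alphabet is meaningful and occurs below, at bad parameters and at
  0.\<close>

definition line_at :: "'a option list \<Rightarrow> 'a \<Rightarrow> 'a list" where
  "line_at \<tau> t = map (\<lambda>p. case p of None \<Rightarrow> t | Some s \<Rightarrow> s) \<tau>"

definition comb_lines :: "'a set \<Rightarrow> nat \<Rightarrow> 'a option list set" where
  "comb_lines A n = {\<tau>. length \<tau> = n \<and> None \<in> set \<tau> \<and> set \<tau> \<subseteq> insert None (Some ` A)}"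

lemma line_at_append: "line_at (\<sigma> @ \<tau>) t = line_at \<sigma> t @ line_at \<tau> t"
  by (simp add: line_at_def)

lemma line_at_Some [simp]: "line_at (map Some w) t = w"
  by (simp add: line_at_def map_idI)

lemma line_at_in_words: "\<tau> \<in> comb_lines A n \<Longrightarrow> t \<in> A \<Longrightarrow> line_at \<tau> t \<in> words A n"
  unfolding line_at_def comb_lines_def words_def by (auto split: option.splits)

lemma finite_words: "finite A \<Longrightarrow> finite (words A n)"
  unfolding words_def by (rule finite_lists_length_eq)

text \<open>\<open>k\<close> stays arbitrary in the induction on the alphabet: the step uses the
  smaller alphabet with one colour for each colouring of a whole block of words.\<close>

theorem Hales_Jewett:
  assumes "finite A"
  shows "\<exists>n. \<forall>c. (\<forall>w\<in>words A n. c w < (k::nat)) \<longrightarrow>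
           (\<exists>\<tau>\<in>comb_lines A n. \<forall>s\<in>A. \<forall>t\<in>A. c (line_at \<tau> s) = c (line_at \<tau> t))"
  using assms
proof (induction A arbitrary: k rule: finite_induct)
  case empty
  have "[None] \<in> comb_lines {} 1" by (simp add: comb_lines_def)
  then show ?case by blast
next
  case (insert t0 T)
  let ?A = "insert t0 T"
  let ?mono = "\<lambda>n c. \<exists>\<tau>\<in>comb_lines ?A n. \<forall>s\<in>?A. \<forall>t\<in>?A. c (line_at \<tau> s) = c (line_at \<tau> t)"
  \<comment> \<open>Colour focusing: \<open>r\<close> lines, monochromatic off \<open>t0\<close> in distinct colours, that share
    their point at \<open>t0\<close>.\<close>
  let ?focus = "\<lambda>r n c. \<exists>w\<in>words ?A n. \<exists>Cs \<subseteq> {..<k}. card Cs = r \<and>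
     (\<forall>col\<in>Cs. \<exists>\<tau>\<in>comb_lines ?A n. line_at \<tau> t0 = w \<and> (\<forall>t\<in>T. c (line_at \<tau> t) = col))"
  have focus_mono: "?mono n c"
    if "w \<in> words ?A n" "\<tau> \<in> comb_lines ?A n" "line_at \<tau> t0 = w" "\<forall>t\<in>T. c (line_at \<tau> t) = c w" for w n \<tau> and c :: "'a list \<Rightarrow> nat"
    using that by (intro bexI[of _ \<tau>]) auto
  have foc: "\<exists>n. \<forall>c. (\<forall>w\<in>words ?A n. c w < k) \<longrightarrow> ?mono n c \<or> ?focus r n c" for r
  proof (induction r)
    case 0
    have "[] \<in> words ?A 0" by (simp add: words_def)
    then show ?case by (intro exI[of _ 0] allI impI disjI2 bexI[of _ "[]"] exI[of _ "{}"]) auto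
  next
    case (Suc r)
    then obtain n where n: "\<And>c. (\<forall>w\<in>words ?A n. c w < k) \<Longrightarrow> ?mono n c \<or> ?focus r n c" by blast
    \<comment> \<open>A prefix \<open>y\<close> of length \<open>m\<close> has as its colour the
      entire colouring that sends \<open>x\<close> to \<open>c (y @ x)\<close>; \<open>enc\<close>
      numbers these colourings.\<close>
    define Fs where "Fs = words ?A n \<rightarrow>\<^sub>E {..<k}"
    have finF: "finite Fs" unfolding Fs_def
      using insert.hyps(1) by (intro finite_PiE finite_words) auto
    then obtain enc :: "('a list \<Rightarrow> nat) \<Rightarrow> nat" and K where enc: "inj_on enc Fs" "enc ` Fs = {i. i < K}"
      using finite_imp_inj_to_nat_seg[OF finF] by metis
    from insert.IH[of K] obtain m where m: "\<And>c. (\<forall>w\<in>words T m. c w < K) \<Longrightarrow>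
       (\<exists>\<tau>\<in>comb_lines T m. \<forall>s\<in>T. \<forall>t\<in>T. c (line_at \<tau> s) = c (line_at \<tau> t))" by blast
    show ?case
    proof (intro exI[of _ "m + n"] allI impI)
      fix c assume c: "\<forall>w\<in>words ?A (m + n). c w < k"
      let ?f = "\<lambda>y. restrict (\<lambda>x. c (y @ x)) (words ?A n)"
      have cyx: "c (y @ x) < k" if "y \<in> words ?A m" "x \<in> words ?A n" for x y
        using c that by (auto simp: words_def)
      have fF: "?f y \<in> Fs" if "y \<in> words ?A m" for y
        using cyx[OF that] by (auto simp: Fs_def)
      have TA: "words T m \<subseteq> words ?A m" by (auto simp: words_def)
      have "\<forall>w\<in>words T m. enc (?f w) < K" using fF TA enc(2) by blast
      from m[OF this] obtain \<tau> where \<tau>: "\<tau> \<in> comb_lines T m"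
        and eq: "\<And>s t. s \<in> T \<Longrightarrow> t \<in> T \<Longrightarrow> enc (?f (line_at \<tau> s)) = enc (?f (line_at \<tau> t))" by blast
      have \<tau>A: "\<tau> \<in> comb_lines ?A m" using \<tau> by (auto simp: comb_lines_def)
      have eq': "c (line_at \<tau> s @ x) = c (line_at \<tau> t @ x)" if "s \<in> T" "t \<in> T" "x \<in> words ?A n" for s t x
      proof -
        have "?f (line_at \<tau> s) = ?f (line_at \<tau> t)"
          using eq[OF that(1,2)] enc(1) fF line_at_in_words[OF \<tau>A] that by (auto dest: inj_onD)
        from fun_cong[OF this, of x] that show ?thesis by simp
      qed
      \<comment> \<open>If \<open>T\<close> is empty, \<open>t0\<close> can stand in: all conditions
        over \<open>T\<close> are then vacuous.\<close>
      define s0 where "s0 = (if T = {} then t0 else SOME s. s \<in> T)"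
      have s0A: "s0 \<in> ?A" unfolding s0_def by (auto intro: someI2_ex)
      have s0T: "s0 \<in> T" if "t \<in> T" for t unfolding s0_def using that by (auto intro: someI2_ex)
      define c' where "c' x = c (line_at \<tau> s0 @ x)" for x
      have c'k: "c' x < k" if "x \<in> words ?A n" for x
        using cyx[OF line_at_in_words[OF \<tau>A s0A] that] by (simp add: c'_def)
      have c'eq: "c (line_at \<tau> t @ x) = c' x" if "t \<in> T" "x \<in> words ?A n" for t x
        unfolding c'_def using eq' s0T that by blast
      have lift: "?mono (m + n) c" if "?mono n c'"
      proof -
        from that obtain \<sigma> where \<sigma>: "\<sigma> \<in> comb_lines ?A n" "\<forall>s\<in>?A. \<forall>t\<in>?A. c' (line_at \<sigma> s) = c' (line_at \<sigma> t)" by blast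
        have "line_at \<tau> s0 \<in> words ?A m" using \<tau>A s0A by (rule line_at_in_words)
        then have "map Some (line_at \<tau> s0) @ \<sigma> \<in> comb_lines ?A (m + n)"
          using \<sigma>(1) by (auto simp: comb_lines_def words_def)
        moreover have "c (line_at (map Some (line_at \<tau> s0) @ \<sigma>) s) = c (line_at (map Some (line_at \<tau> s0) @ \<sigma>) t)"
          if "s \<in> ?A" "t \<in> ?A" for s t
        proof -
          have "c' (line_at \<sigma> s) = c' (line_at \<sigma> t)" using \<sigma>(2) that by blast
          then show ?thesis by (simp add: line_at_append c'_def)
        qed
        ultimately show ?thesis by blast
      qed
      show "?mono (m + n) c \<or> ?focus (Suc r) (m + n) c"
      proof (cases "?mono n c'")
        case False
        with n[of c'] c'k have "?focus r n c'" by blast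
        then obtain w Cs where w: "w \<in> words ?A n" and Cs: "Cs \<subseteq> {..<k}" "card Cs = r"
          and lines: "\<forall>col\<in>Cs. \<exists>\<tau>\<in>comb_lines ?A n. line_at \<tau> t0 = w \<and> (\<forall>t\<in>T. c' (line_at \<tau> t) = col)" by blast
        \<comment> \<open>If \<open>c' w\<close> were a focused colour, the line of that colour
          would be monochromatic at \<open>t0\<close> as well.\<close>
        have notin: "c' w \<notin> Cs" using focus_mono[OF w, of _ c'] lines False by blast
        have "?focus (Suc r) (m + n) c"
        \<comment> \<open>The old lines move along with \<open>\<tau>\<close> and focus at
          \<open>line_at \<tau> t0 @ w\<close>; moving \<open>\<tau>\<close> alone before the fixed
          word \<open>w\<close> adds a line of the new colour \<open>c' w\<close>.\<close>
        proof (intro bexI[of _ "line_at \<tau> t0 @ w"] exI[of _ "insert (c' w) Cs"] conjI ballI)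
          show "line_at \<tau> t0 @ w \<in> words ?A (m + n)"
            using line_at_in_words[OF \<tau>A, of t0] w by (auto simp: words_def)
          show "insert (c' w) Cs \<subseteq> {..<k}" using Cs c'k[OF w] by auto
          show "card (insert (c' w) Cs) = Suc r"
            using Cs notin by (simp add: finite_subset[OF Cs(1)])
          fix col assume "col \<in> insert (c' w) Cs"
          then consider "col = c' w" | "col \<in> Cs" by blast
          then show "\<exists>\<rho>\<in>comb_lines ?A (m + n). line_at \<rho> t0 = line_at \<tau> t0 @ w \<and> (\<forall>t\<in>T. c (line_at \<rho> t) = col)"
          proof cases
            case 1
            have "\<tau> @ map Some w \<in> comb_lines ?A (m + n)"
              using \<tau>A w by (auto simp: comb_lines_def words_def)
            then show ?thesis using 1 c'eq w by (intro bexI) (auto simp: line_at_append)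
          next
            case 2
            with lines obtain \<sigma> where \<sigma>: "\<sigma> \<in> comb_lines ?A n" "line_at \<sigma> t0 = w" "\<forall>t\<in>T. c' (line_at \<sigma> t) = col" by blast
            have "\<tau> @ \<sigma> \<in> comb_lines ?A (m + n)"
              using \<tau>A \<sigma>(1) by (auto simp: comb_lines_def)
            then show ?thesis using \<sigma> c'eq line_at_in_words[OF \<sigma>(1)] by (intro bexI) (auto simp: line_at_append)
          qed
        qed
        then show ?thesis ..
      qed (use lift in blast)
    qed
  qed
  from foc[of k] obtain n where n: "\<And>c. (\<forall>w\<in>words ?A n. c w < k) \<Longrightarrow> ?mono n c \<or> ?focus k n c" by blast
  show ?case
  proof (intro exI[of _ n] allI impI)
    fix c assume c: "\<forall>w\<in>words ?A n. c w < k"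
    show "?mono n c"
    proof (cases "?mono n c")
      case False
      with n[OF c] obtain w Cs where w: "w \<in> words ?A n" and Cs: "Cs \<subseteq> {..<k}" "card Cs = k"
        and lines: "\<forall>col\<in>Cs. \<exists>\<tau>\<in>comb_lines ?A n. line_at \<tau> t0 = w \<and> (\<forall>t\<in>T. c (line_at \<tau> t) = col)" by blast
      \<comment> \<open>All \<open>k\<close> colours are focused, hence also the colour of the focus
        \<open>w\<close> itself.\<close>
      have "Cs = {..<k}" using Cs by (intro card_subset_eq) auto
      then have "c w \<in> Cs" using c w by blast
      then show ?thesis using focus_mono[OF w] lines by blast
    qed
  qed
qed

section \<open>Homothetic copies in the line\<close>

text \<open>Nonzero polynomials have finitely many roots. The bound \<open>m\<close> serves to make
  the chosen point positive.\<close>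

lemma ex_common_nonroot:
  fixes P :: "real poly set"
  assumes "finite P" "0 \<notin> P"
  shows "\<exists>x>m. \<forall>p\<in>P. poly p x \<noteq> 0"
proof -
  have "finite (\<Union>p\<in>P. {x. poly p x = 0})"
    using assms by (intro finite_UN_I poly_roots_finite) auto
  then have "infinite ({m<..} - (\<Union>p\<in>P. {x. poly p x = 0}))"
    using infinite_Ioi[of m] by (rule Diff_infinite_finite)
  then obtain x where "x \<in> {m<..} - (\<Union>p\<in>P. {x. poly p x = 0})"
    by (metis ex_in_conv finite.emptyI)
  then show ?thesis by auto
qed

definition pt :: "'v::real_vector \<times> 'v \<Rightarrow> real \<Rightarrow> 'v" where
  "pt \<phi> t = fst \<phi> + t *\<^sub>R snd \<phi>"

definition on_copy :: "real set \<Rightarrow> 'v::real_vector \<times> 'v \<Rightarrow> 'v \<Rightarrow> bool" where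
  "on_copy T \<phi> u \<longleftrightarrow> (\<exists>t\<in>T. u = pt \<phi> t)"

text \<open>\<open>B\<close> collects the parameters at which unwanted adjacencies may arise; the
  points there are kept out of all of \<open>V\<close>, not merely out of the copy in
  question.\<close>

definition copy_system :: "real set \<Rightarrow> real set \<Rightarrow> 'v::real_vector set \<Rightarrow> ('v \<times> 'v) set \<Rightarrow> bool" where
  "copy_system T B V \<Phi> \<longleftrightarrow> finite V \<and> finite \<Phi> \<and>
     (\<forall>\<phi>\<in>\<Phi>. (\<forall>t\<in>T. pt \<phi> t \<in> V) \<and> (\<forall>b\<in>B. pt \<phi> b \<notin> V))"

text \<open>\<open>col < k\<close> is demanded explicitly because \<open>T\<close> may be empty, for
  instance as an empty column.\<close>

definition mono_copies :: "nat \<Rightarrow> real set \<Rightarrow> ('v::real_vector \<times> 'v) set \<Rightarrow> bool" where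
  "mono_copies k T \<Phi> \<longleftrightarrow>
     (\<forall>c. (\<forall>x. c x < k) \<longrightarrow> (\<exists>\<phi>\<in>\<Phi>. \<exists>col<k. \<forall>t\<in>T. c (pt \<phi> t) = col))"

text \<open>No Berge cycle of total length less than \<open>g\<close>: small parts of the incidence graph have fewer
  edges than vertices.\<close>

definition sparse_rel :: "nat \<Rightarrow> ('a \<Rightarrow> 'b \<Rightarrow> bool) \<Rightarrow> 'a set \<Rightarrow> 'b set \<Rightarrow> bool" where
  "sparse_rel g R \<Phi> V \<longleftrightarrow> (\<forall>F\<subseteq>\<Phi>. \<forall>U\<subseteq>V. F \<noteq> {} \<longrightarrow> card F + card U < g \<longrightarrow>
     card {(\<phi>, u) \<in> F \<times> U. R \<phi> u} < card F + card U)"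

section \<open>From words to real numbers by polynomial evaluation\<close>

lemma pt_real [simp]: "pt (a, d) t = a + t * d" for a :: real
  by (simp add: pt_def)

text \<open>Putting \<open>t\<close> at the wildcards adds \<open>t\<close> times the 0/1 polynomial
  of the wildcard positions. So a combinatorial line becomes a homothetic copy, of positive ratio at
  \<open>x > 0\<close>.\<close>

lemma template_poly:
  "poly (Poly (line_at \<tau> t)) x =
     pt (poly (Poly (line_at \<tau> 0)) x, poly (Poly (map (\<lambda>p. if p = None then 1 else 0) \<tau>)) x) t"
  by (induction \<tau>) (auto simp: line_at_def algebra_simps split: option.splits)

lemma template_slope_nonneg:
  "x > 0 \<Longrightarrow> 0 \<le> poly (Poly (map (\<lambda>p. if p = None then 1 else 0) \<tau>)) (x::real)"
  by (induction \<tau>) auto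

lemma template_slope_pos:
  "x > 0 \<Longrightarrow> None \<in> set \<tau> \<Longrightarrow> 0 < poly (Poly (map (\<lambda>p. if p = None then 1 else 0) \<tau>)) (x::real)"
proof (induction \<tau>)
  case (Cons p \<tau>)
  then show ?case
    using template_slope_nonneg[of x \<tau>] by (auto intro: add_pos_nonneg)
qed simp

text \<open>The lengths matter because \<open>Poly\<close> forgets trailing zeros.\<close>

lemma Poly_inj:
  assumes "Poly v = Poly w" "length v = length w"
  shows "v = w"
proof (rule nth_equalityI)
  fix i assume "i < length v"
  moreover have "coeff (Poly v) i = coeff (Poly w) i" using assms(1) by simp
  ultimately show "v ! i = w ! i" using assms(2) by (simp add: coeff_Poly_eq nth_default_def)
qed (use assms in simp)

text \<open>Words over \<open>T\<close> are realised as reals by reading them as polynomials, evaluated at a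
  generic point.\<close>

lemma Gallai:
  assumes T: "finite T" and B: "finite B" "B \<inter> T = {}"
  shows "\<exists>(V :: real set) \<Phi>. copy_system T B V \<Phi> \<and> (\<forall>\<phi>\<in>\<Phi>. 0 < snd \<phi>) \<and> mono_copies k T \<Phi>"
proof -
  obtain n where n: "\<And>c. (\<forall>w\<in>words T n. c w < k) \<Longrightarrow>
      \<exists>\<tau>\<in>comb_lines T n. \<forall>s\<in>T. \<forall>t\<in>T. c (line_at \<tau> s) = c (line_at \<tau> t)"
    using Hales_Jewett[OF T, of k] by blast
  have finL: "finite (comb_lines T n)"
  proof (rule finite_subset)
    show "comb_lines T n \<subseteq> {\<tau>. set \<tau> \<subseteq> insert None (Some ` T) \<and> length \<tau> = n}"
      by (auto simp: comb_lines_def)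
    show "finite {\<tau>. set \<tau> \<subseteq> insert None (Some ` T) \<and> length \<tau> = n}"
      using T by (intro finite_lists_length_eq) auto
  qed
  \<comment> \<open>A wildcard occurs in \<open>\<tau>\<close>, so \<open>line_at \<tau> b\<close>
    contains the letter \<open>b\<close>, which is not in \<open>T\<close>. It thus differs from
    every word over \<open>T\<close> as a polynomial, and a common nonroot \<open>x\<close> keeps
    them apart as numbers.\<close>
  define P where "P = (\<lambda>(\<tau>, b, w). Poly (line_at \<tau> b) - Poly w) ` (comb_lines T n \<times> B \<times> words T n)"
  have "finite P" unfolding P_def using finL B finite_words[OF T] by simp
  moreover have "0 \<notin> P"
  proof
    assume "0 \<in> P"
    then obtain \<tau> b w where *: "\<tau> \<in> comb_lines T n" "b \<in> B" "w \<in> words T n" "Poly (line_at \<tau> b) = Poly w"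
      by (auto simp: P_def)
    then have "line_at \<tau> b = w" by (intro Poly_inj) (auto simp: comb_lines_def words_def line_at_def)
    moreover have "b \<in> set (line_at \<tau> b)" using *(1) by (force simp: comb_lines_def line_at_def)
    ultimately show False using * B by (auto simp: words_def)
  qed
  ultimately obtain x where x: "x > 0" "\<forall>p\<in>P. poly p x \<noteq> 0" using ex_common_nonroot by blast
  define ev where "ev w = poly (Poly w) x" for w
  define par where "par \<tau> = (ev (line_at \<tau> 0), ev (map (\<lambda>p. if p = None then 1 else 0) \<tau>))" for \<tau> :: "real option list"
  have pt_par: "pt (par \<tau>) t = ev (line_at \<tau> t)" for \<tau> t
    by (simp add: template_poly[of \<tau> t] par_def ev_def)
  show ?thesis
  proof (intro exI conjI)
    show "copy_system T B (ev ` words T n) (par ` comb_lines T n)"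
      unfolding copy_system_def
    proof (intro conjI ballI)
      fix \<phi> b assume "\<phi> \<in> par ` comb_lines T n" and b: "b \<in> B"
      then obtain \<tau> where \<tau>: "\<tau> \<in> comb_lines T n" "\<phi> = par \<tau>" by blast
      have "poly (Poly (line_at \<tau> b) - Poly w) x \<noteq> 0" if "w \<in> words T n" for w
        using x(2) \<tau> b that unfolding P_def by force
      then show "pt \<phi> b \<notin> ev ` words T n" unfolding \<tau> pt_par by (auto simp: ev_def)
    next
      fix \<phi> t assume "\<phi> \<in> par ` comb_lines T n" and t: "t \<in> T"
      then obtain \<tau> where \<tau>: "\<tau> \<in> comb_lines T n" "\<phi> = par \<tau>" by blast
      then show "pt \<phi> t \<in> ev ` words T n" using line_at_in_words[OF \<tau>(1) t] by (simp add: pt_par)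
    qed (use finL finite_words[OF T] in auto)
    show "\<forall>\<phi>\<in>par ` comb_lines T n. 0 < snd \<phi>"
      using template_slope_pos[OF x(1)] by (auto simp: par_def ev_def comb_lines_def)
    show "mono_copies k T (par ` comb_lines T n)"
      unfolding mono_copies_def
    proof (intro allI impI)
      fix c :: "real \<Rightarrow> nat" assume c: "\<forall>x. c x < k"
      then obtain \<tau> where \<tau>: "\<tau> \<in> comb_lines T n" "\<forall>s\<in>T. \<forall>t\<in>T. c (ev (line_at \<tau> s)) = c (ev (line_at \<tau> t))"
        using n[of "\<lambda>w. c (ev w)"] by auto
      have "\<exists>col<k. \<forall>t\<in>T. c (ev (line_at \<tau> t)) = col"
      proof (cases "T = {}")
        case True
        then show ?thesis using c[rule_format, of 0] by auto
      next
        case False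
        then obtain s where "s \<in> T" by blast
        then show ?thesis using \<tau>(2) c by (intro exI[of _ "c (ev (line_at \<tau> s))"] conjI ballI) blast+
      qed
      then show "\<exists>\<phi>\<in>par ` comb_lines T n. \<exists>col<k. \<forall>t\<in>T. c (pt \<phi> t) = col"
        using \<tau>(1) by (auto simp: pt_par)
    qed
  qed
qed

section \<open>Partite amalgamation\<close>

lemma pt_prod: "pt \<phi> t = (fst (fst \<phi>) + t * fst (snd \<phi>), snd (fst \<phi>) + t * snd (snd \<phi>))"
  for \<phi> :: "(real \<times> real) \<times> (real \<times> real)"
  by (simp add: pt_def prod_eq_iff)

text \<open>This is why \<open>W\<close> below contains the points at the parameters 0 and
  1.\<close>

lemma pt_determines: "\<phi> = \<psi>" if "pt \<phi> 0 = pt \<psi> 0" "pt \<phi> 1 = pt \<psi> 1"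
  using that by (simp add: pt_def prod_eq_iff)

text \<open>The amalgamation along the column \<open>y\<close>: for every copy \<open>h\<close> of that column in the system
  \<open>(V\<^sub>H, \<Phi>\<^sub>H)\<close>, the whole plane system is copied by the affine map \<open>\<sigma> h\<close>, which preserves columns and
  agrees with \<open>h\<close> on the column \<open>y\<close>. The shears \<open>\<epsilon> h\<close> keep different copies apart elsewhere.\<close>

locale amalgamation =
  fixes g :: nat and T B :: "real set" and V :: "(real \<times> real) set"
    and \<Phi> :: "((real \<times> real) \<times> (real \<times> real)) set" and y :: real
    and V\<^sub>H :: "real set" and \<Phi>\<^sub>H :: "(real \<times> real) set" and \<epsilon> :: "real \<times> real \<Rightarrow> real"
  fixes col W B\<^sub>H
  defines "col \<equiv> {z. (y, z) \<in> V}"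
    and "W \<equiv> V \<union> (\<lambda>(\<phi>, b). pt \<phi> b) ` (\<Phi> \<times> (B \<union> {0, 1}))"
    and "B\<^sub>H \<equiv> {z. \<exists>\<phi>\<in>\<Phi>. \<exists>b\<in>B. pt \<phi> b = (y, z)}"
  fixes \<sigma> \<tau>
  defines "\<sigma> \<equiv> \<lambda>h v. (fst v, fst h + snd h * snd v + \<epsilon> h * (fst v - y))"
    and "\<tau> \<equiv> \<lambda>h \<phi>. (\<sigma> h (fst \<phi>),
                 (fst (snd \<phi>), snd h * snd (snd \<phi>) + \<epsilon> h * fst (snd \<phi>)))"
  assumes sys: "copy_system T B V \<Phi>" and pos: "\<And>\<phi>. \<phi> \<in> \<Phi> \<Longrightarrow> 0 < fst (snd \<phi>)"
    and sparse: "sparse_rel (Suc g) (on_copy T) \<Phi> V"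
    and sysH: "copy_system col B\<^sub>H V\<^sub>H \<Phi>\<^sub>H" and posH: "\<And>h. h \<in> \<Phi>\<^sub>H \<Longrightarrow> 0 < snd h"
    and sparseH: "sparse_rel g (on_copy col) \<Phi>\<^sub>H V\<^sub>H"
    and generic: "\<And>h h' w w'. h \<in> \<Phi>\<^sub>H \<Longrightarrow> h' \<in> \<Phi>\<^sub>H \<Longrightarrow> h \<noteq> h' \<Longrightarrow> w \<in> W \<Longrightarrow> w' \<in> W \<Longrightarrow>
      fst w \<noteq> y \<Longrightarrow> fst w' = fst w \<Longrightarrow> snd (\<sigma> h w) \<noteq> snd (\<sigma> h' w')"
begin

definition V' where "V' = (\<Union>h\<in>\<Phi>\<^sub>H. \<sigma> h ` V)"
definition \<Phi>' where "\<Phi>' = (\<lambda>(h, \<phi>). \<tau> h \<phi>) ` (\<Phi>\<^sub>H \<times> \<Phi>)"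

lemma fin: "finite V" "finite \<Phi>" "finite V\<^sub>H" "finite \<Phi>\<^sub>H"
  using sys sysH by (auto simp: copy_system_def)

lemma pt_\<tau>: "pt (\<tau> h \<phi>) t = \<sigma> h (pt \<phi> t)"
  by (simp add: pt_prod \<tau>_def \<sigma>_def algebra_simps)

lemma pt_W: "\<phi> \<in> \<Phi> \<Longrightarrow> b \<in> B \<union> {0, 1} \<Longrightarrow> pt \<phi> b \<in> W"
  unfolding W_def by force

lemma fst_\<sigma> [simp]: "fst (\<sigma> h v) = fst v"
  by (simp add: \<sigma>_def)

lemma \<sigma>_y: "\<sigma> h (y, z) = (y, pt h z)"
  by (cases h) (simp add: \<sigma>_def mult.commute)

lemma inj_\<sigma>: "h \<in> \<Phi>\<^sub>H \<Longrightarrow> \<sigma> h v = \<sigma> h w \<longleftrightarrow> v = w"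
  using posH[of h] by (auto simp: \<sigma>_def prod_eq_iff)

text \<open>By genericity of the shears, different copies of the plane system can share points only
  on the column \<open>y\<close>.\<close>

lemma \<sigma>_eqD:
  assumes "h \<in> \<Phi>\<^sub>H" "h' \<in> \<Phi>\<^sub>H" "w \<in> W" "w' \<in> W" "\<sigma> h w = \<sigma> h' w'" "fst w \<noteq> y"
  shows "h = h'" "w = w'"
proof -
  have "fst w' = fst w" using arg_cong[OF assms(5), of fst] by simp
  then show "h = h'" using generic[OF assms(1,2) _ assms(3,4,6)] assms(5) by auto
  then show "w = w'" using assms inj_\<sigma> by blast
qed

lemma \<tau>_eqD:
  assumes "h \<in> \<Phi>\<^sub>H" "h' \<in> \<Phi>\<^sub>H" "\<phi> \<in> \<Phi>" "\<psi> \<in> \<Phi>" "\<tau> h \<phi> = \<tau> h' \<psi>"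
  shows "h = h' \<and> \<phi> = \<psi>"
proof -
  have eq: "\<sigma> h (pt \<phi> t) = \<sigma> h' (pt \<psi> t)" for t using assms(5) by (simp flip: pt_\<tau>)
  \<comment> \<open>The horizontal speed is positive, so the points at 0 and 1 are not both on the
    column \<open>y\<close>.\<close>
  have "fst (pt \<phi> 0) \<noteq> y \<or> fst (pt \<phi> 1) \<noteq> y" using pos[OF assms(3)] by (auto simp: pt_prod)
  then have "h = h'" using \<sigma>_eqD(1)[OF assms(1,2) _ _ eq] pt_W assms(3,4) by blast
  moreover from this have "pt \<phi> t = pt \<psi> t" for t using eq inj_\<sigma> assms(1) by blast
  ultimately show ?thesis using pt_determines by blast
qed

lemma inj_\<tau>: "inj_on (\<lambda>(h, \<phi>). \<tau> h \<phi>) (\<Phi>\<^sub>H \<times> \<Phi>)"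
proof (rule inj_onI)
  fix p q assume "p \<in> \<Phi>\<^sub>H \<times> \<Phi>" "q \<in> \<Phi>\<^sub>H \<times> \<Phi>" "(\<lambda>(h, \<phi>). \<tau> h \<phi>) p = (\<lambda>(h, \<phi>). \<tau> h \<phi>) q"
  then show "p = q"
    using \<tau>_eqD[of "fst p" "fst q" "snd p" "snd q"] by (simp add: mem_Times_iff case_prod_beta prod_eq_iff[of p])
qed

lemma \<Phi>'E:
  assumes "\<psi> \<in> \<Phi>'"
  obtains h \<phi> where "h \<in> \<Phi>\<^sub>H" "\<phi> \<in> \<Phi>" "\<psi> = \<tau> h \<phi>"
  using assms unfolding \<Phi>'_def image_iff by (metis (no_types, lifting) SigmaE case_prod_conv)

text \<open>A bad point could coincide with a vertex of another copy only on the column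
  \<open>y\<close>, and there it is a bad point of the column system. This is why that system has to
  avoid \<open>B\<^sub>H\<close>.\<close>

lemma copy_system': "copy_system T B V' \<Phi>'"
  unfolding copy_system_def
proof (intro conjI ballI)
  show "finite V'" "finite \<Phi>'" unfolding V'_def \<Phi>'_def using fin by auto
next
  fix \<psi> t assume "\<psi> \<in> \<Phi>'" "t \<in> T"
  then obtain h \<phi> where "h \<in> \<Phi>\<^sub>H" "\<phi> \<in> \<Phi>" "\<psi> = \<tau> h \<phi>" using \<Phi>'E by blast
  moreover from this have "pt \<phi> t \<in> V" using sys \<open>t \<in> T\<close> by (simp add: copy_system_def)
  ultimately show "pt \<psi> t \<in> V'" by (auto simp: V'_def pt_\<tau>)
next
  fix \<psi> b assume "\<psi> \<in> \<Phi>'" "b \<in> B"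
  then obtain h \<phi> where h: "h \<in> \<Phi>\<^sub>H" and \<phi>: "\<phi> \<in> \<Phi>" and \<psi>: "\<psi> = \<tau> h \<phi>" using \<Phi>'E by blast
  show "pt \<psi> b \<notin> V'"
  proof
    assume "pt \<psi> b \<in> V'"
    then obtain h' v where h': "h' \<in> \<Phi>\<^sub>H" and v: "v \<in> V" and eq: "\<sigma> h (pt \<phi> b) = \<sigma> h' v"
      by (auto simp: V'_def \<psi> pt_\<tau>)
    have bad: "pt \<phi> b \<notin> V" using sys \<phi> \<open>b \<in> B\<close> by (simp add: copy_system_def)
    show False
    proof (cases "fst (pt \<phi> b) = y")
      case True
      then obtain z where z: "pt \<phi> b = (y, z)" by (metis prod.collapse)
      have "fst v = y" using arg_cong[OF eq, of fst] True by simp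
      then obtain z' where z': "v = (y, z')" by (metis prod.collapse)
      have "pt h z = pt h' z'" using eq by (simp add: z z' \<sigma>_y)
      moreover have "z \<in> B\<^sub>H" using \<phi> \<open>b \<in> B\<close> z by (auto simp: B\<^sub>H_def)
      moreover have "z' \<in> col" using v z' by (simp add: col_def)
      ultimately show False using sysH h h' by (metis copy_system_def)
    next
      case False
      then have "pt \<phi> b = v"
        using \<sigma>_eqD(2)[OF h h' _ _ eq] pt_W \<phi> \<open>b \<in> B\<close> v by (auto simp: W_def)
      then show False using bad v by simp
    qed
  qed
qed

lemma pos': "\<psi> \<in> \<Phi>' \<Longrightarrow> 0 < fst (snd \<psi>)"
  using pos by (auto simp: \<Phi>'_def \<tau>_def)

text \<open>Copies have positive horizontal speed and so meet a column at most once.\<close>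

lemma single_column:
  assumes F: "F \<subseteq> \<Phi>'" and U: "U \<subseteq> {y} \<times> UNIV"
  shows "card {(f, u) \<in> F \<times> U. on_copy T f u} \<le> card F"
proof -
  have "finite F" using copy_system' F finite_subset by (auto simp: copy_system_def)
  moreover have "inj_on fst {(f, u) \<in> F \<times> U. on_copy T f u}"
  proof (rule inj_onI)
    fix p q assume p: "p \<in> {(f, u) \<in> F \<times> U. on_copy T f u}" and q: "q \<in> {(f, u) \<in> F \<times> U. on_copy T f u}"
      and eq: "fst p = fst q"
    from p q obtain s t where "snd p = pt (fst p) s" "snd q = pt (fst q) t"
      by (auto simp: on_copy_def)
    moreover have "fst (snd p) = y" "fst (snd q) = y" using p q U by auto
    moreover have "fst p \<in> \<Phi>'" using p F by auto
    ultimately show "p = q" using eq pos'[of "fst p"] by (auto simp: pt_prod prod_eq_iff[of p])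
  qed
  ultimately show ?thesis by (intro card_inj_on_le[of fst]) auto
qed

text \<open>Incidences are sorted by the copy \<open>h\<close>. Each used copy has at most |Fh| +
  |off| + |on| - 1 of them. Points off the column belong to one copy each; points on it count
  incidences between \<open>K\<close> and \<open>Uc\<close>, at most |K| + |Uc| - 1 by sparsity of
  the column system. The sum is at most |F| + |U| - 1.\<close>

lemma sparse': "sparse_rel (Suc g) (on_copy T) \<Phi>' V'"
  unfolding sparse_rel_def
proof (intro allI impI)
  fix F U assume F: "F \<subseteq> \<Phi>'" "F \<noteq> {}" and U: "U \<subseteq> V'" and less: "card F + card U < Suc g"
  let ?I = "{(f, u) \<in> F \<times> U. on_copy T f u}"
  have finF: "finite F" and finU: "finite U"
    using copy_system' F U finite_subset by (auto simp: copy_system_def)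
  have cF: "card F > 0" using F finF by auto
  show "card ?I < card F + card U"
  proof (cases "U \<subseteq> {y} \<times> UNIV")
    case True
    show ?thesis
    proof (cases "U = {}")
      case False
      then have "card U > 0" using finU by auto
      with single_column[OF F(1) True] show ?thesis by linarith
    qed (use cF in simp)
  next
    case False
    define Fh where "Fh h = {\<phi>\<in>\<Phi>. \<tau> h \<phi> \<in> F}" for h
    define Uh where "Uh h = {v\<in>V. \<sigma> h v \<in> U}" for h
    define off where "off h = {v\<in>Uh h. fst v \<noteq> y}" for h
    define on where "on h = {v\<in>Uh h. fst v = y}" for h
    define K where "K = {h\<in>\<Phi>\<^sub>H. Fh h \<noteq> {}}"
    define Uc where "Uc = {z. (y, z) \<in> U}"
    define Uo where "Uo = {u\<in>U. fst u \<noteq> y}"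
    define IH where "IH = {(h, z) \<in> K \<times> Uc. on_copy col h z}"
    have finK: "finite K" using fin by (simp add: K_def)
    have finh: "finite (Fh h)" "finite (Uh h)" "finite (off h)" "finite (on h)" for h
      using fin by (auto simp: Fh_def Uh_def off_def on_def)
    have finUc: "finite Uc"
      by (rule finite_subset[OF _ finite_imageI[OF finU, of snd]]) (force simp: Uc_def)
    have cardU: "card U = card Uc + card Uo"
    proof -
      have "U = Pair y ` Uc \<union> Uo" by (auto simp: Uc_def Uo_def)
      moreover have "Pair y ` Uc \<inter> Uo = {}" by (auto simp: Uo_def)
      ultimately have "card U = card (Pair y ` Uc) + card Uo"
        using finU by (metis card_Un_disjoint finite_Un)
      also have "card (Pair y ` Uc) = card Uc" by (intro card_image) (auto simp: inj_on_def)
      finally show ?thesis .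
    qed
    \<comment> \<open>The vertex off the column accounts for the gain from \<open>g\<close> to
      \<open>Suc g\<close>: it brings |K| + |Uc| below \<open>g\<close> although |F| + |U| is only
      below \<open>Suc g\<close>.\<close>
    have "Uo \<noteq> {}" using False by (auto simp: Uo_def)
    then have Uo: "card Uo > 0" using finU by (simp add: Uo_def card_gt_0_iff)
    have cardF: "card F = (\<Sum>h\<in>K. card (Fh h))"
    proof -
      have "F = (\<lambda>(h, \<phi>). \<tau> h \<phi>) ` (SIGMA h:K. Fh h)"
      proof
        show "F \<subseteq> (\<lambda>(h, \<phi>). \<tau> h \<phi>) ` (SIGMA h:K. Fh h)"
        proof
          fix f assume "f \<in> F"
          then obtain h \<phi> where "h \<in> \<Phi>\<^sub>H" "\<phi> \<in> \<Phi>" "f = \<tau> h \<phi>" using F \<Phi>'E by blast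
          with \<open>f \<in> F\<close> show "f \<in> (\<lambda>(h, \<phi>). \<tau> h \<phi>) ` (SIGMA h:K. Fh h)"
            by (intro image_eqI[of _ _ "(h, \<phi>)"]) (simp, unfold K_def Fh_def, blast)
        qed
      qed (auto simp: Fh_def)
      moreover have "inj_on (\<lambda>(h, \<phi>). \<tau> h \<phi>) (SIGMA h:K. Fh h)"
        by (rule inj_on_subset[OF inj_\<tau>]) (auto simp: K_def Fh_def)
      ultimately show ?thesis using finK finh by (simp add: card_image)
    qed
    have "card K \<le> card F"
    proof -
      have "card K = (\<Sum>h\<in>K. 1)" by simp
      also have "\<dots> \<le> (\<Sum>h\<in>K. card (Fh h))"
        using finh by (intro sum_mono) (simp add: K_def Suc_le_eq card_gt_0_iff)
      finally show ?thesis by (simp add: cardF)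
    qed
    moreover have "K \<noteq> {}" using cF cardF by auto
    moreover have "Uc \<subseteq> V\<^sub>H"
    proof
      fix z assume "z \<in> Uc"
      then obtain h v where h: "h \<in> \<Phi>\<^sub>H" "v \<in> V" "(y, z) = \<sigma> h v" using U by (auto simp: Uc_def V'_def)
      then have "v = (y, snd v)" by (metis fst_\<sigma> fst_conv prod.collapse)
      with h have "snd v \<in> col" "z = pt h (snd v)" using \<sigma>_y[of h "snd v"] by (auto simp: col_def)
      then show "z \<in> V\<^sub>H" using sysH h(1) by (simp add: copy_system_def)
    qed
    moreover have "K \<subseteq> \<Phi>\<^sub>H" by (simp add: K_def)
    moreover have "card K + card Uc < g" using \<open>card K \<le> card F\<close> less cardU Uo by linarith
    ultimately have IH: "card IH < card K + card Uc"
      unfolding IH_def using sparseH by (simp add: sparse_rel_def)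
    have "card ?I \<le> (\<Sum>h\<in>K. card {(\<phi>, v) \<in> Fh h \<times> Uh h. on_copy T \<phi> v})" (is "_ \<le> (\<Sum>h\<in>K. card (?Ih h))")
    proof -
      have finIh: "finite (?Ih h)" for h
        by (rule finite_subset[of _ "Fh h \<times> Uh h"]) (use finh in auto)
      have "?I \<subseteq> (\<Union>h\<in>K. map_prod (\<tau> h) (\<sigma> h) ` ?Ih h)"
      proof
        fix p assume "p \<in> ?I"
        then obtain f u where p: "p = (f, u)" and fu: "f \<in> F" "u \<in> U" "on_copy T f u" by blast
        then obtain t where t: "t \<in> T" "u = pt f t" by (auto simp: on_copy_def)
        from fu F obtain h \<phi> where h: "h \<in> \<Phi>\<^sub>H" "\<phi> \<in> \<Phi>" "f = \<tau> h \<phi>" using \<Phi>'E by blast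
        have "pt \<phi> t \<in> V" using sys h t by (simp add: copy_system_def)
        moreover have u: "u = \<sigma> h (pt \<phi> t)" using t h by (simp add: pt_\<tau>)
        ultimately have mem: "(\<phi>, pt \<phi> t) \<in> ?Ih h" using fu h t by (auto simp: Fh_def Uh_def on_copy_def)
        have hK: "h \<in> K" using h fu unfolding K_def Fh_def by blast
        have "p = map_prod (\<tau> h) (\<sigma> h) (\<phi>, pt \<phi> t)" using u h p by simp
        from image_eqI[where f = "map_prod (\<tau> h) (\<sigma> h)", OF this mem] hK
        show "p \<in> (\<Union>h\<in>K. map_prod (\<tau> h) (\<sigma> h) ` ?Ih h)" by blast
      qed
      then have "card ?I \<le> card (\<Union>h\<in>K. map_prod (\<tau> h) (\<sigma> h) ` ?Ih h)"
        using finK finIh by (intro card_mono) blast+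
      also have "\<dots> \<le> (\<Sum>h\<in>K. card (map_prod (\<tau> h) (\<sigma> h) ` ?Ih h))" using finK by (rule card_UN_le)
      also have "\<dots> \<le> (\<Sum>h\<in>K. card (?Ih h))" using finIh by (intro sum_mono card_image_le) auto
      finally show ?thesis .
    qed
    \<comment> \<open>Each used copy saves one; together these savings pay for the term
      \<open>card K\<close> in the bound on \<open>IH\<close>.\<close>
    moreover have "(\<Sum>h\<in>K. card (?Ih h)) + card K \<le> (\<Sum>h\<in>K. card (Fh h) + (card (off h) + card (on h)))"
    proof -
      have "card (?Ih h) + 1 \<le> card (Fh h) + (card (off h) + card (on h))" if h: "h \<in> K" for h
      proof -
        have hH: "h \<in> \<Phi>\<^sub>H" using h by (simp add: K_def)
        have "card (Fh h) \<le> card F"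
          using finF \<tau>_eqD[OF hH hH] by (intro card_inj_on_le[of "\<tau> h"] inj_onI) (auto simp: Fh_def)
        moreover have "card (Uh h) \<le> card U"
          using finU inj_\<sigma>[OF hH] by (intro card_inj_on_le[of "\<sigma> h"] inj_onI) (auto simp: Uh_def)
        ultimately have "card (Fh h) + card (Uh h) < Suc g" using less by linarith
        moreover have "Fh h \<subseteq> \<Phi>" "Uh h \<subseteq> V" "Fh h \<noteq> {}" using h by (auto simp: K_def Fh_def Uh_def)
        ultimately have "card (?Ih h) < card (Fh h) + card (Uh h)"
          using sparse unfolding sparse_rel_def by simp
        moreover have "card (Uh h) = card (off h) + card (on h)"
        proof -
          have "Uh h = off h \<union> on h" by (auto simp: off_def on_def)
          then show ?thesis using finh[of h] by (metis (mono_tags, lifting) card_Un_disjoint disjoint_iff mem_Collect_eq off_def on_def)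
        qed
        ultimately show ?thesis by linarith
      qed
      then have "(\<Sum>h\<in>K. card (?Ih h) + 1) \<le> (\<Sum>h\<in>K. card (Fh h) + (card (off h) + card (on h)))"
        by (rule sum_mono)
      then show ?thesis by (simp only: sum.distrib) simp
    qed
    moreover have "(\<Sum>h\<in>K. card (off h)) \<le> card Uo"
    proof -
      have "(\<Sum>h\<in>K. card (off h)) = card (SIGMA h:K. off h)" using finK finh by simp
      also have "\<dots> \<le> card Uo"
      proof (rule card_inj_on_le)
        show "inj_on (\<lambda>(h, v). \<sigma> h v) (SIGMA h:K. off h)"
        proof (rule inj_onI)
          fix p q assume p: "p \<in> (SIGMA h:K. off h)" and q: "q \<in> (SIGMA h:K. off h)"
            and eq: "(\<lambda>(h, v). \<sigma> h v) p = (\<lambda>(h, v). \<sigma> h v) q"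
          have "fst p \<in> \<Phi>\<^sub>H" "fst q \<in> \<Phi>\<^sub>H" "snd p \<in> W" "snd q \<in> W" "fst (snd p) \<noteq> y"
            using p q by (auto simp: K_def off_def Uh_def W_def)
          from \<sigma>_eqD[OF this(1-4) _ this(5)] eq show "p = q"
            by (simp add: case_prod_beta prod_eq_iff[of p])
        qed
      qed (use finU in \<open>auto simp: off_def Uo_def Uh_def\<close>)
      finally show ?thesis .
    qed
    \<comment> \<open>A vertex of copy \<open>h\<close> on the column is an incidence of
      \<open>h\<close> with the height of its image.\<close>
    moreover have "(\<Sum>h\<in>K. card (on h)) \<le> card IH"
    proof -
      have "(\<Sum>h\<in>K. card (on h)) = card (SIGMA h:K. on h)" using finK finh by simp
      also have "\<dots> \<le> card IH"
      proof (rule card_inj_on_le)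
        show "inj_on (\<lambda>(h, v). (h, snd (\<sigma> h v))) (SIGMA h:K. on h)"
        proof (rule inj_onI)
          fix p q assume p: "p \<in> (SIGMA h:K. on h)" and q: "q \<in> (SIGMA h:K. on h)"
            and eq: "(\<lambda>(h, v). (h, snd (\<sigma> h v))) p = (\<lambda>(h, v). (h, snd (\<sigma> h v))) q"
          from eq have h: "fst p = fst q" "snd (\<sigma> (fst p) (snd p)) = snd (\<sigma> (fst p) (snd q))"
            by (auto simp: case_prod_beta)
          moreover have "fst (snd p) = y" "fst (snd q) = y" "fst p \<in> \<Phi>\<^sub>H"
            using p q by (auto simp: on_def K_def)
          ultimately have "snd p = snd q"
            using inj_\<sigma>[of "fst p" "snd p" "snd q"] by (simp add: prod_eq_iff)
          with h(1) show "p = q" by (simp add: prod_eq_iff)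
        qed
        show "finite IH" by (rule finite_subset[of _ "K \<times> Uc"]) (use finK finUc in \<open>auto simp: IH_def\<close>)
        show "(\<lambda>(h, v). (h, snd (\<sigma> h v))) ` (SIGMA h:K. on h) \<subseteq> IH"
        proof clarify
          fix a d z1 z2 assume *: "(a, d) \<in> K" "(z1, z2) \<in> on (a, d)"
          then have "z1 = y" "z2 \<in> col" "\<sigma> (a, d) (y, z2) \<in> U" by (auto simp: on_def Uh_def col_def)
          then show "((a, d), snd (\<sigma> (a, d) (z1, z2))) \<in> IH"
            using *(1) by (auto simp: IH_def on_copy_def \<sigma>_y Uc_def)
        qed
      qed
      finally show ?thesis .
    qed
    ultimately show ?thesis
      using IH cardF cardU by (simp add: sum.distrib)
  qed
qed

end

section \<open>A sparse Gallai theorem\<close>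

text \<open>All shears are multiples \<open>s * f h\<close> of one number \<open>s\<close>, with
  \<open>f\<close> injective; each coincidence to be avoided is then a linear equation in
  \<open>s\<close> with nonzero coefficient.\<close>

lemma ex_generic_shears:
  fixes \<Phi>\<^sub>H :: "(real \<times> real) set" and W :: "(real \<times> real) set"
  assumes "finite \<Phi>\<^sub>H" "finite W"
  shows "\<exists>\<epsilon>. \<forall>h\<in>\<Phi>\<^sub>H. \<forall>h'\<in>\<Phi>\<^sub>H. \<forall>w\<in>W. \<forall>w'\<in>W. h \<noteq> h' \<longrightarrow> fst w \<noteq> y \<longrightarrow> fst w' = fst w \<longrightarrow>
     fst h + snd h * snd w + \<epsilon> h * (fst w - y) \<noteq> fst h' + snd h' * snd w' + \<epsilon> h' * (fst w' - y)"
proof -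
  obtain f :: "real \<times> real \<Rightarrow> nat" where f: "inj_on f \<Phi>\<^sub>H"
    using finite_imp_inj_to_nat_seg[OF assms(1)] by blast
  define Bad where "Bad = (\<lambda>(h, h', w, w'). (fst h + snd h * snd w - (fst h' + snd h' * snd w'))
      / ((real (f h') - real (f h)) * (fst w - y))) ` (\<Phi>\<^sub>H \<times> \<Phi>\<^sub>H \<times> W \<times> W)"
  have "finite Bad" unfolding Bad_def using assms by simp
  then obtain s where s: "s \<notin> Bad" using ex_new_if_finite infinite_UNIV_char_0 by blast
  show ?thesis
  proof (intro exI[of _ "\<lambda>h. s * real (f h)"] ballI impI)
    fix h h' w w' assume *: "h \<in> \<Phi>\<^sub>H" "h' \<in> \<Phi>\<^sub>H" "w \<in> W" "w' \<in> W" "h \<noteq> h'" "fst w \<noteq> y" "fst w' = fst w"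
    show "fst h + snd h * snd w + s * real (f h) * (fst w - y) \<noteq> fst h' + snd h' * snd w' + s * real (f h') * (fst w' - y)"
    proof
      assume eq: "fst h + snd h * snd w + s * real (f h) * (fst w - y) = fst h' + snd h' * snd w' + s * real (f h') * (fst w' - y)"
      have "f h \<noteq> f h'" using f * by (auto dest: inj_onD)
      then have "(real (f h') - real (f h)) * (fst w - y) \<noteq> 0" using * by simp
      moreover have "s * ((real (f h') - real (f h)) * (fst w - y)) = fst h + snd h * snd w - (fst h' + snd h' * snd w')"
        using eq *(7) by (simp add: algebra_simps)
      ultimately have "s = (fst h + snd h * snd w - (fst h' + snd h' * snd w')) / ((real (f h') - real (f h)) * (fst w - y))"
        by (simp add: field_simps)
      then have "s \<in> Bad" unfolding Bad_def using * by (intro image_eqI[of _ _ "(h, h', w, w')"]) auto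
      then show False using s by blast
    qed
  qed
qed

section \<open>Plane systems above the copies on the line\<close>

definition sparse_Gallai :: "nat \<Rightarrow> real set \<Rightarrow> real set \<Rightarrow> nat \<Rightarrow> bool" where
  "sparse_Gallai g T B k \<longleftrightarrow> (\<exists>(V :: real set) \<Phi>. copy_system T B V \<Phi> \<and> (\<forall>\<phi>\<in>\<Phi>. 0 < snd \<phi>) \<and>
     mono_copies k T \<Phi> \<and> sparse_rel g (on_copy T) \<Phi> V)"

text \<open>A system in the plane lying over the copies \<open>\<Psi>\<close> of \<open>T\<close> in the line, in which every colouring is
  constant on each column of \<open>Z\<close>, when restricted to a suitable choice of lifts of \<open>\<Psi>\<close>.\<close>

definition column_system ::
  "nat \<Rightarrow> real set \<Rightarrow> real set \<Rightarrow> nat \<Rightarrow> (real \<times> real) set \<Rightarrow> real set \<Rightarrow>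
    (real \<times> real) set \<Rightarrow> ((real \<times> real) \<times> (real \<times> real)) set \<Rightarrow> bool" where
  "column_system g T B k \<Psi> Z V \<Phi> \<longleftrightarrow>
     copy_system T B V \<Phi> \<and> (\<forall>\<phi>\<in>\<Phi>. 0 < fst (snd \<phi>)) \<and> sparse_rel g (on_copy T) \<Phi> V \<and>
     (\<forall>c. (\<forall>x. c x < k) \<longrightarrow> (\<exists>col. (\<forall>y. col y < k) \<and> (\<forall>\<psi>\<in>\<Psi>. \<exists>\<phi>\<in>\<Phi>.
        fst (fst \<phi>) = fst \<psi> \<and> fst (snd \<phi>) = snd \<psi> \<and> (\<forall>t\<in>T. pt \<psi> t \<in> Z \<longrightarrow> c (pt \<phi> t) = col (pt \<psi> t)))))"

text \<open>Each copy gets a row of its own. A point then lies on one copy only, which is sparse for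
  every \<open>g\<close>.\<close>

lemma column_system_start:
  assumes T: "finite T" and B: "B \<inter> T = {}" and \<Psi>: "finite \<Psi>" "\<And>\<psi>. \<psi> \<in> \<Psi> \<Longrightarrow> 0 < snd \<psi>"
  shows "\<exists>V \<Phi>. column_system g T B k \<Psi> {} V \<Phi>"
proof -
  obtain f :: "real \<times> real \<Rightarrow> nat" where f: "inj_on f \<Psi>"
    using finite_imp_inj_to_nat_seg[OF \<Psi>(1)] by blast
  define L where "L \<psi> = ((fst \<psi>, real (f \<psi>)), (snd \<psi>, 0::real))" for \<psi> :: "real \<times> real"
  define V where "V = (\<lambda>(\<psi>, t). pt (L \<psi>) t) ` (\<Psi> \<times> T)"
  have ptL: "pt (L \<psi>) t = (fst \<psi> + t * snd \<psi>, real (f \<psi>))" for \<psi> t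
    by (simp add: L_def pt_prod)
  have uniq: "\<psi> = \<psi>' \<and> s = t" if "\<psi> \<in> \<Psi>" "\<psi>' \<in> \<Psi>" "pt (L \<psi>) s = pt (L \<psi>') t" for \<psi> \<psi>' s t
  proof -
    have "\<psi> = \<psi>'" using that inj_onD[OF f] by (simp add: ptL)
    then show ?thesis using that \<Psi>(2)[of \<psi>] by (simp add: ptL)
  qed
  show ?thesis
  proof (intro exI[of _ V] exI[of _ "L ` \<Psi>"])
    show "column_system g T B k \<Psi> {} V (L ` \<Psi>)"
      unfolding column_system_def
    proof (intro conjI)
      show "copy_system T B V (L ` \<Psi>)"
        unfolding copy_system_def
      proof (intro conjI ballI)
        fix \<phi> b assume "\<phi> \<in> L ` \<Psi>" "b \<in> B"
        then obtain \<psi> where "\<psi> \<in> \<Psi>" "\<phi> = L \<psi>" by blast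
        then show "pt \<phi> b \<notin> V" using uniq \<open>b \<in> B\<close> B unfolding V_def by fastforce
      next
        fix \<phi> t assume "\<phi> \<in> L ` \<Psi>" "t \<in> T"
        then show "pt \<phi> t \<in> V" unfolding V_def by force
      qed (use T \<Psi> in \<open>auto simp: V_def\<close>)
      show "\<forall>\<phi>\<in>L ` \<Psi>. 0 < fst (snd \<phi>)" using \<Psi>(2) by (auto simp: L_def)
      show "sparse_rel g (on_copy T) (L ` \<Psi>) V"
        unfolding sparse_rel_def
      proof (intro allI impI)
        fix F U assume F: "F \<subseteq> L ` \<Psi>" "F \<noteq> {}" and U: "U \<subseteq> V"
        let ?I = "{(\<phi>, u) \<in> F \<times> U. on_copy T \<phi> u}"
        have "finite F" using F \<Psi>(1) finite_surj by blast
        then have "card F > 0" using F by auto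
        moreover have "card ?I \<le> card U"
        proof (rule card_inj_on_le[of snd])
          show "finite U" using U T \<Psi>(1) unfolding V_def by (meson finite_SigmaI finite_surj)
          show "inj_on snd ?I"
          proof (rule inj_onI)
            fix p q assume p: "p \<in> ?I" and q: "q \<in> ?I" and eq: "snd p = snd q"
            from p F obtain \<psi> s where "\<psi> \<in> \<Psi>" "fst p = L \<psi>" "snd p = pt (L \<psi>) s" by (force simp: on_copy_def)
            moreover from q F obtain \<psi>' t where "\<psi>' \<in> \<Psi>" "fst q = L \<psi>'" "snd q = pt (L \<psi>') t" by (force simp: on_copy_def)
            ultimately show "p = q" using eq uniq[of \<psi> \<psi>' s t] by (simp add: prod_eq_iff[of p])
          qed
        qed auto
        ultimately show "card ?I < card F + card U" by linarith
      qed
      show "\<forall>c. (\<forall>x. c x < k) \<longrightarrow> (\<exists>col. (\<forall>y. col y < k) \<and> (\<forall>\<psi>\<in>\<Psi>. \<exists>\<phi>\<in>L ` \<Psi>.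
        fst (fst \<phi>) = fst \<psi> \<and> fst (snd \<phi>) = snd \<psi> \<and> (\<forall>t\<in>T. pt \<psi> t \<in> {} \<longrightarrow> c (pt \<phi> t) = col (pt \<psi> t))))"
      proof (intro allI impI)
        fix c :: "real \<times> real \<Rightarrow> nat" assume "\<forall>x. c x < k"
        then show "\<exists>col. (\<forall>y. col y < k) \<and> (\<forall>\<psi>\<in>\<Psi>. \<exists>\<phi>\<in>L ` \<Psi>.
          fst (fst \<phi>) = fst \<psi> \<and> fst (snd \<phi>) = snd \<psi> \<and> (\<forall>t\<in>T. pt \<psi> t \<in> {} \<longrightarrow> c (pt \<phi> t) = col (pt \<psi> t)))"
          \<comment> \<open>With no column to respect, any \<open>col\<close> with values below
            \<open>k\<close> will do; one is read off \<open>c\<close>.\<close>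
          by (intro exI[of _ "\<lambda>y. c (y, y)"]) (auto simp: L_def)
      qed
    qed
  qed
qed

text \<open>The column \<open>y\<close> itself is the pattern to which \<open>IH\<close> is applied,
  so some copy \<open>h\<close> of it is monochromatic for \<open>c\<close>. Inside the plane copy
  \<open>\<sigma> h\<close>, the old system with the colouring \<open>c\<close> after
  \<open>\<sigma> h\<close> still handles \<open>Z\<close>, because \<open>\<sigma> h\<close>
  preserves columns.\<close>

lemma column_system_insert:
  assumes B: "finite B"
    and IH: "\<And>T B. finite T \<Longrightarrow> finite B \<Longrightarrow> B \<inter> T = {} \<Longrightarrow> sparse_Gallai g T B k"
    and sys: "column_system (Suc g) T B k \<Psi> Z V \<Phi>"
  shows "\<exists>V \<Phi>. column_system (Suc g) T B k \<Psi> (insert y Z) V \<Phi>"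
proof -
  define col where "col = {z. (y, z) \<in> V}"
  define B\<^sub>H where "B\<^sub>H = {z. \<exists>\<phi>\<in>\<Phi>. \<exists>b\<in>B. pt \<phi> b = (y, z)}"
  define W where "W = V \<union> (\<lambda>(\<phi>, b). pt \<phi> b) ` (\<Phi> \<times> (B \<union> {0, 1}))"
  from sys have cs: "copy_system T B V \<Phi>" and pos: "\<And>\<phi>. \<phi> \<in> \<Phi> \<Longrightarrow> 0 < fst (snd \<phi>)"
    and sp: "sparse_rel (Suc g) (on_copy T) \<Phi> V"
    and "\<forall>c. (\<forall>x. c x < k) \<longrightarrow> (\<exists>col. (\<forall>y. col y < k) \<and> (\<forall>\<psi>\<in>\<Psi>. \<exists>\<phi>\<in>\<Phi>.
        fst (fst \<phi>) = fst \<psi> \<and> fst (snd \<phi>) = snd \<psi> \<and> (\<forall>t\<in>T. pt \<psi> t \<in> Z \<longrightarrow> c (pt \<phi> t) = col (pt \<psi> t))))"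
    unfolding column_system_def by simp_all
  note mono = this(4)[rule_format]
  have fin: "finite V" "finite \<Phi>" using cs by (auto simp: copy_system_def)
  have finW: "finite W" unfolding W_def using fin B by simp
  have "finite col"
    by (rule finite_subset[OF _ finite_imageI[OF finW, of snd]]) (force simp: col_def W_def)
  moreover have "finite B\<^sub>H"
    by (rule finite_subset[OF _ finite_imageI[OF finW, of snd]]) (force simp: B\<^sub>H_def W_def)
  moreover have "B\<^sub>H \<inter> col = {}"
  proof -
    have "pt \<phi> b \<noteq> v" if "\<phi> \<in> \<Phi>" "b \<in> B" "v \<in> V" for \<phi> b v using cs that by (auto simp: copy_system_def)
    then show ?thesis unfolding B\<^sub>H_def col_def by blast
  qed
  ultimately obtain V\<^sub>H and \<Phi>\<^sub>H :: "(real \<times> real) set" where H: "copy_system col B\<^sub>H V\<^sub>H \<Phi>\<^sub>H" "\<And>h. h \<in> \<Phi>\<^sub>H \<Longrightarrow> 0 < snd h"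
      "mono_copies k col \<Phi>\<^sub>H" "sparse_rel g (on_copy col) \<Phi>\<^sub>H V\<^sub>H"
    using IH[of col B\<^sub>H] unfolding sparse_Gallai_def by blast
  have "finite \<Phi>\<^sub>H" using H(1) by (simp add: copy_system_def)
  then obtain \<epsilon> where \<epsilon>: "\<And>h h' w w'. h \<in> \<Phi>\<^sub>H \<Longrightarrow> h' \<in> \<Phi>\<^sub>H \<Longrightarrow> w \<in> W \<Longrightarrow> w' \<in> W \<Longrightarrow>
      h \<noteq> h' \<Longrightarrow> fst w \<noteq> y \<Longrightarrow> fst w' = fst w \<Longrightarrow>
     fst h + snd h * snd w + \<epsilon> h * (fst w - y) \<noteq> fst h' + snd h' * snd w' + \<epsilon> h' * (fst w' - y)"
    using ex_generic_shears[OF _ finW, of \<Phi>\<^sub>H y] by blast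
  define \<sigma> where "\<sigma> h v = (fst v, fst h + snd h * snd v + \<epsilon> h * (fst v - y))" for h v :: "real \<times> real"
  define \<tau> where "\<tau> h \<phi> = (\<sigma> h (fst \<phi>),
      (fst (snd \<phi>), snd h * snd (snd \<phi>) + \<epsilon> h * fst (snd \<phi>)))" for h and \<phi> :: "(real \<times> real) \<times> (real \<times> real)"
  interpret A: amalgamation g T B V \<Phi> y V\<^sub>H \<Phi>\<^sub>H \<epsilon> col W B\<^sub>H \<sigma> \<tau>
  proof (unfold_locales, goal_cases)
    case (7 h h' w w')
    then show ?case using \<epsilon>[of h h' w w'] by (simp add: W_def)
  qed (use cs pos sp H in \<open>simp_all add: col_def W_def B\<^sub>H_def \<sigma>_def \<tau>_def fun_eq_iff atomize_eq\<close>)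
  have "column_system (Suc g) T B k \<Psi> (insert y Z) A.V' A.\<Phi>'"
    unfolding column_system_def
  proof (intro conjI allI impI ballI)
    fix c :: "real \<times> real \<Rightarrow> nat" assume c: "\<forall>x. c x < k"
    from H(3) obtain h cy where h: "h \<in> \<Phi>\<^sub>H" "cy < k" "\<And>z. z \<in> col \<Longrightarrow> c (y, pt h z) = cy"
      using c unfolding mono_copies_def by (auto dest!: spec[of _ "\<lambda>z. c (y, z)"])
    obtain cl where cl: "\<And>y. cl y < k"
      and lift: "\<And>\<psi>. \<psi> \<in> \<Psi> \<Longrightarrow> \<exists>\<phi>\<in>\<Phi>. fst (fst \<phi>) = fst \<psi> \<and> fst (snd \<phi>) = snd \<psi> \<and>
        (\<forall>t\<in>T. pt \<psi> t \<in> Z \<longrightarrow> c (\<sigma> h (pt \<phi> t)) = cl (pt \<psi> t))"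
      using mono[of "\<lambda>v. c (\<sigma> h v)", OF c[rule_format]] by blast
    show "\<exists>col. (\<forall>y. col y < k) \<and> (\<forall>\<psi>\<in>\<Psi>. \<exists>\<phi>\<in>A.\<Phi>'. fst (fst \<phi>) = fst \<psi> \<and> fst (snd \<phi>) = snd \<psi> \<and>
        (\<forall>t\<in>T. pt \<psi> t \<in> insert y Z \<longrightarrow> c (pt \<phi> t) = col (pt \<psi> t)))"
    proof (intro exI[of _ "cl(y := cy)"] conjI ballI)
      fix \<psi> assume "\<psi> \<in> \<Psi>"
      with lift obtain \<phi> where \<phi>: "\<phi> \<in> \<Phi>" "fst (fst \<phi>) = fst \<psi>" "fst (snd \<phi>) = snd \<psi>"
        "\<And>t. t \<in> T \<Longrightarrow> pt \<psi> t \<in> Z \<Longrightarrow> c (\<sigma> h (pt \<phi> t)) = cl (pt \<psi> t)" by blast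
      have fst_pt: "fst (pt \<phi> t) = pt \<psi> t" for t using \<phi>(2,3) by (simp add: pt_prod) (simp add: pt_def)
      have "c (pt (\<tau> h \<phi>) t) = (cl(y := cy)) (pt \<psi> t)" if t: "t \<in> T" "pt \<psi> t \<in> insert y Z" for t
      proof (cases "pt \<psi> t = y")
        case True
        then have eq: "pt \<phi> t = (y, snd (pt \<phi> t))" using fst_pt by (metis prod.collapse)
        moreover have "pt \<phi> t \<in> V" using cs \<phi>(1) t(1) by (simp add: copy_system_def)
        ultimately have "snd (pt \<phi> t) \<in> col" by (simp add: col_def)
        then show ?thesis using True h(3) A.\<sigma>_y eq by (metis A.pt_\<tau> fun_upd_same)
      qed (use t \<phi>(4) in \<open>simp add: A.pt_\<tau>\<close>)
      then show "\<exists>\<phi>\<in>A.\<Phi>'. fst (fst \<phi>) = fst \<psi> \<and> fst (snd \<phi>) = snd \<psi> \<and>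
        (\<forall>t\<in>T. pt \<psi> t \<in> insert y Z \<longrightarrow> c (pt \<phi> t) = (cl(y := cy)) (pt \<psi> t))"
      proof (intro bexI conjI)
        show "\<tau> h \<phi> \<in> A.\<Phi>'" using \<phi>(1) h(1) unfolding A.\<Phi>'_def by blast
      qed (use \<phi> in \<open>auto simp: \<tau>_def \<sigma>_def\<close>)
    qed (use cl h in auto)
  qed (use A.copy_system' A.pos' A.sparse' in auto)
  then show ?thesis by blast
qed

section \<open>Projection of the plane systems to the line\<close>

lemma sparse_rel_image:
  assumes sp: "sparse_rel g R \<Phi> V" and inj: "inj_on f \<Phi>" "inj_on h V"
    and R: "\<And>\<phi> v. \<phi> \<in> \<Phi> \<Longrightarrow> v \<in> V \<Longrightarrow> R' (f \<phi>) (h v) \<Longrightarrow> R \<phi> v"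
    and fin: "finite \<Phi>" "finite V"
  shows "sparse_rel g R' (f ` \<Phi>) (h ` V)"
  unfolding sparse_rel_def
proof (intro allI impI)
  fix F' U' assume F': "F' \<subseteq> f ` \<Phi>" "F' \<noteq> {}" and U': "U' \<subseteq> h ` V" and less: "card F' + card U' < g"
  obtain F where F: "F \<subseteq> \<Phi>" "F' = f ` F" using F' by (meson subset_imageE)
  obtain U where U: "U \<subseteq> V" "U' = h ` U" using U' by (meson subset_imageE)
  have c: "card F' = card F" "card U' = card U"
    unfolding F(2) U(2)
    using card_image inj_on_subset[OF inj(1) F(1)] inj_on_subset[OF inj(2) U(1)] by blast+
  have finFU: "finite F" "finite U" using F U fin finite_subset by auto
  have "card {(\<phi>, u) \<in> F' \<times> U'. R' \<phi> u} \<le> card (map_prod f h ` {(\<phi>, u) \<in> F \<times> U. R \<phi> u})"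
  proof (intro card_mono finite_imageI)
    show "finite {(\<phi>, u) \<in> F \<times> U. R \<phi> u}" by (rule finite_subset[of _ "F \<times> U"]) (use finFU in auto)
    show "{(\<phi>, u) \<in> F' \<times> U'. R' \<phi> u} \<subseteq> map_prod f h ` {(\<phi>, u) \<in> F \<times> U. R \<phi> u}"
    proof
      fix p assume "p \<in> {(\<phi>, u) \<in> F' \<times> U'. R' \<phi> u}"
      then obtain \<phi> u where *: "p = (f \<phi>, h u)" "\<phi> \<in> F" "u \<in> U" "R' (f \<phi>) (h u)"
        unfolding F(2) U(2) by blast
      then have "R \<phi> u" using R F(1) U(1) by blast
      with * have "(\<phi>, u) \<in> {(\<phi>, u) \<in> F \<times> U. R \<phi> u}" "p = map_prod f h (\<phi>, u)" by simp_all
      then show "p \<in> map_prod f h ` {(\<phi>, u) \<in> F \<times> U. R \<phi> u}" by blast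
    qed
  qed
  also have "\<dots> \<le> card {(\<phi>, u) \<in> F \<times> U. R \<phi> u}"
    by (rule card_image_le, rule finite_subset[of _ "F \<times> U"]) (use finFU in auto)
  also have "\<dots> < card F + card U"
    using sp F U F' less c unfolding sparse_rel_def by auto
  finally show "card {(\<phi>, u) \<in> F' \<times> U'. R' \<phi> u} < card F' + card U'" by (simp add: c)
qed

text \<open>For large \<open>s\<close> the horizontal coordinate dominates and keeps the slopes
  positive; only finitely many \<open>s\<close> identify two points of \<open>W\<close>.\<close>

lemma ex_generic_projection:
  fixes V W :: "(real \<times> real) set"
  assumes "finite W" "finite D" "\<And>d. d \<in> D \<Longrightarrow> 0 < fst d"
  shows "\<exists>s. inj_on (\<lambda>v. snd v + s * fst v) W \<and> (\<forall>d\<in>D. 0 < snd d + s * fst d)"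
proof -
  define Bad where "Bad = (\<lambda>(v, w). (snd w - snd v) / (fst v - fst w)) ` (W \<times> W)"
  define s where "s = Max (insert 0 (Bad \<union> (\<lambda>d. - snd d / fst d) ` D)) + 1"
  have fin: "finite (insert 0 (Bad \<union> (\<lambda>d. - snd d / fst d) ` D))" using assms by (simp add: Bad_def)
  have lt: "x < s" if "x \<in> Bad \<union> (\<lambda>d. - snd d / fst d) ` D" for x
    using Max_ge[OF fin, of x] that unfolding s_def by auto
  have "inj_on (\<lambda>v. snd v + s * fst v) W"
  proof (rule inj_onI, rule ccontr)
    fix v w assume *: "v \<in> W" "w \<in> W" "snd v + s * fst v = snd w + s * fst w" "v \<noteq> w"
    then have "fst v \<noteq> fst w" by (auto simp: prod_eq_iff)
    then have "s = (snd w - snd v) / (fst v - fst w)" using * by (simp add: field_simps)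
    then have "s \<in> Bad" unfolding Bad_def using * by force
    then show False using lt[of s] by simp
  qed
  moreover have "0 < snd d + s * fst d" if "d \<in> D" for d
  proof -
    have "- snd d / fst d < s" using lt that by blast
    then show ?thesis using assms(3)[OF that] by (simp add: field_simps)
  qed
  ultimately show ?thesis by blast
qed

text \<open>\<open>T\<close> and \<open>B\<close> vary in the induction since the patterns in the
  step are columns of a plane system. Once all columns are treated, a colouring of the points
  becomes a colouring of the columns, to which Gallai's theorem without sparsity applies.\<close>

theorem sparse_Gallai_holds:
  assumes "finite T" "finite B" "B \<inter> T = {}"
  shows "sparse_Gallai g T B k"
  using assms
proof (induction g arbitrary: T B)
  case 0
  then show ?case using Gallai unfolding sparse_Gallai_def sparse_rel_def by simp
next
  case (Suc g)
  \<comment> \<open>These copies only provide the column positions, hence no bad parameters here;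
    \<open>B\<close> is taken care of by the plane systems above them.\<close>
  obtain Y0 :: "real set" and \<Psi> where \<Psi>: "copy_system T {} Y0 \<Psi>" "\<And>\<psi>. \<psi> \<in> \<Psi> \<Longrightarrow> 0 < snd \<psi>" "mono_copies k T \<Psi>"
    using Gallai[OF Suc.prems(1), of "{}" k] by auto
  have fin: "finite Y0" "finite \<Psi>" and Y0: "\<And>\<psi> t. \<psi> \<in> \<Psi> \<Longrightarrow> t \<in> T \<Longrightarrow> pt \<psi> t \<in> Y0"
    using \<Psi>(1) by (auto simp: copy_system_def)
  have "\<exists>V \<Phi>. column_system (Suc g) T B k \<Psi> Y0 V \<Phi>"
    using fin(1)
  proof (induction Y0 rule: finite_induct)
    case empty
    show ?case using column_system_start Suc.prems fin(2) \<Psi>(2) by blast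
  next
    case (insert y Z)
    then show ?case using column_system_insert[OF Suc.prems(2) Suc.IH] by blast
  qed
  then obtain V and \<Phi> :: "((real \<times> real) \<times> (real \<times> real)) set" where cs: "copy_system T B V \<Phi>" and pos: "\<And>\<phi>. \<phi> \<in> \<Phi> \<Longrightarrow> 0 < fst (snd \<phi>)"
    and sp: "sparse_rel (Suc g) (on_copy T) \<Phi> V"
    and mono: "\<And>c. (\<forall>x. c x < k) \<Longrightarrow> (\<exists>col. (\<forall>y. col y < k) \<and> (\<forall>\<psi>\<in>\<Psi>. \<exists>\<phi>\<in>\<Phi>.
        fst (fst \<phi>) = fst \<psi> \<and> fst (snd \<phi>) = snd \<psi> \<and> (\<forall>t\<in>T. pt \<psi> t \<in> Y0 \<longrightarrow> c (pt \<phi> t) = col (pt \<psi> t))))"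
    unfolding column_system_def by blast
  \<comment> \<open>Injectivity on \<open>W\<close> keeps apart not only vertices but also vertices
    from bad points, and, through the parameters 0 and 1, distinct copies.\<close>
  define W where "W = V \<union> (\<lambda>(\<phi>, b). pt \<phi> b) ` (\<Phi> \<times> (B \<union> {0, 1}))"
  have finV: "finite V" "finite \<Phi>" using cs by (auto simp: copy_system_def)
  then have "finite W" using Suc.prems(2) by (simp add: W_def)
  then obtain s where inj: "inj_on (\<lambda>v. snd v + s * fst v) W" and slope: "\<And>\<phi>. \<phi> \<in> \<Phi> \<Longrightarrow> 0 < snd (snd \<phi>) + s * fst (snd \<phi>)"
    using ex_generic_projection[of W "snd ` \<Phi>"] finV pos by blast
  define f where "f v = snd v + s * fst v" for v :: "real \<times> real"
  define q where "q \<phi> = (f (fst \<phi>), f (snd \<phi>))" for \<phi>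
  have ptq: "pt (q \<phi>) t = f (pt \<phi> t)" for \<phi> t
    by (simp add: q_def f_def pt_prod algebra_simps)
  have inW: "pt \<phi> b \<in> W" if "\<phi> \<in> \<Phi>" "b \<in> B \<union> {0, 1}" for \<phi> b using that by (force simp: W_def)
  have VW: "V \<subseteq> W" by (simp add: W_def)
  have injf: "v = w" if "v \<in> W" "w \<in> W" "f v = f w" for v w using inj that by (auto simp: inj_on_def f_def)
  have TV: "pt \<phi> t \<in> V" if "\<phi> \<in> \<Phi>" "t \<in> T" for \<phi> t using cs that by (auto simp: copy_system_def)
  show ?case
    unfolding sparse_Gallai_def
  proof (intro exI conjI)
    show "copy_system T B (f ` V) (q ` \<Phi>)"
      unfolding copy_system_def
    proof (intro conjI ballI)
      fix \<phi>' b assume "\<phi>' \<in> q ` \<Phi>" "b \<in> B"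
      then obtain \<phi> where \<phi>: "\<phi> \<in> \<Phi>" "\<phi>' = q \<phi>" by blast
      have "pt \<phi> b \<notin> V" using cs \<phi> \<open>b \<in> B\<close> by (simp add: copy_system_def)
      then show "pt \<phi>' b \<notin> f ` V" using injf inW[OF \<phi>(1), of b] VW \<open>b \<in> B\<close> unfolding \<phi>(2) ptq by blast
    qed (use finV TV in \<open>auto simp: ptq\<close>)
    show "\<forall>\<phi>\<in>q ` \<Phi>. 0 < snd \<phi>" using slope by (auto simp: q_def f_def)
    show "mono_copies k T (q ` \<Phi>)"
      unfolding mono_copies_def
    proof (intro allI impI)
      fix c :: "real \<Rightarrow> nat" assume c: "\<forall>x. c x < k"
      then have "\<forall>v. c (f v) < k" by blast
      from mono[OF this] obtain col where col: "\<forall>y. col y < k" and lift: "\<forall>\<psi>\<in>\<Psi>. \<exists>\<phi>\<in>\<Phi>.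
          fst (fst \<phi>) = fst \<psi> \<and> fst (snd \<phi>) = snd \<psi> \<and> (\<forall>t\<in>T. pt \<psi> t \<in> Y0 \<longrightarrow> c (f (pt \<phi> t)) = col (pt \<psi> t))"
        by (elim exE conjE)
      from \<Psi>(3) col obtain \<psi> a where \<psi>: "\<psi> \<in> \<Psi>" "a < k" "\<forall>t\<in>T. col (pt \<psi> t) = a"
        unfolding mono_copies_def by blast
      from bspec[OF lift \<psi>(1)] obtain \<phi> where "\<phi> \<in> \<Phi>" "\<forall>t\<in>T. c (f (pt \<phi> t)) = a" using \<psi> Y0 by auto
      then show "\<exists>\<phi>\<in>q ` \<Phi>. \<exists>col<k. \<forall>t\<in>T. c (pt \<phi> t) = col" using \<psi>(2) by (auto simp: ptq)
    qed
    show "sparse_rel (Suc g) (on_copy T) (q ` \<Phi>) (f ` V)"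
    proof (rule sparse_rel_image[OF sp])
      show "inj_on f V" using injf VW by (intro inj_onI) blast
      show "inj_on q \<Phi>"
      proof (rule inj_onI)
        fix \<phi> \<psi> assume *: "\<phi> \<in> \<Phi>" "\<psi> \<in> \<Phi>" "q \<phi> = q \<psi>"
        have "f (pt \<phi> t) = f (pt \<psi> t)" for t using *(3) by (simp flip: ptq)
        then have "pt \<phi> 0 = pt \<psi> 0" "pt \<phi> 1 = pt \<psi> 1" using injf inW * by auto
        then show "\<phi> = \<psi>" by (rule pt_determines)
      qed
      show "on_copy T \<phi> v" if v: "\<phi> \<in> \<Phi>" "v \<in> V" "on_copy T (q \<phi>) (f v)" for \<phi> v
      proof -
        obtain t where t: "t \<in> T" "f v = f (pt \<phi> t)" using v(3) by (auto simp: on_copy_def ptq)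
        then have "v = pt \<phi> t" using injf[of v "pt \<phi> t"] VW TV v by blast
        then show ?thesis using t(1) by (auto simp: on_copy_def)
      qed
    qed (use finV in auto)
  qed
qed

section \<open>Attaching copies of a graph\<close>

definition edges_in :: "('v \<Rightarrow> 'v \<Rightarrow> bool) \<Rightarrow> 'v set \<Rightarrow> ('v \<times> 'v) set" where
  "edges_in E S = {(u, v) \<in> S \<times> S. E u v}"

text \<open>Edges are counted as ordered pairs, whence the factor two.\<close>

definition local_forest :: "nat \<Rightarrow> ('v \<Rightarrow> 'v \<Rightarrow> bool) \<Rightarrow> 'v set \<Rightarrow> bool" where
  "local_forest g E V \<longleftrightarrow>
     (\<forall>S\<subseteq>V. S \<noteq> {} \<longrightarrow> card S < g \<longrightarrow> card (edges_in E S) + 2 \<le> 2 * card S)"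

definition uncolourable :: "nat \<Rightarrow> ('v \<Rightarrow> 'v \<Rightarrow> bool) \<Rightarrow> 'v set \<Rightarrow> bool" where
  "uncolourable k E V \<longleftrightarrow> (\<forall>c. (\<forall>v\<in>V. c v < k) \<longrightarrow> (\<exists>u\<in>V. \<exists>v\<in>V. E u v \<and> c u = c v))"

lemma finite_edges_in: "finite S \<Longrightarrow> finite (edges_in E S)"
  by (rule finite_subset[of _ "S \<times> S"]) (auto simp: edges_in_def)

text \<open>\<open>X\<close> places the points of \<open>Xs\<close> as an independent set, and \<open>e \<phi>\<close> places a copy of \<open>C\<close> whose
  vertices are matched to the points of the copy \<open>\<phi>\<close> of \<open>\<tau> ` C\<close>; further adjacencies to \<open>X\<close> may only
  occur at the bad points \<open>pt \<phi> ` B\<close>.\<close>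

definition attached ::
  "('v \<Rightarrow> 'v \<Rightarrow> bool) \<Rightarrow> 'v set \<Rightarrow> ('v \<Rightarrow> real) \<Rightarrow> real set \<Rightarrow> real set \<Rightarrow> (real \<times> real) set \<Rightarrow>
    (real \<Rightarrow> 'v) \<Rightarrow> (real \<times> real \<Rightarrow> 'v \<Rightarrow> 'v) \<Rightarrow> bool" where
  "attached E C \<tau> B Xs \<Phi> X e \<longleftrightarrow>
     inj_on X Xs \<and> (\<forall>s\<in>Xs. \<forall>t\<in>Xs. \<not> E (X s) (X t)) \<and>
     (\<forall>\<phi>\<in>\<Phi>. inj_on (e \<phi>) C \<and> (\<forall>u\<in>C. \<forall>v\<in>C. E (e \<phi> u) (e \<phi> v) \<longleftrightarrow> E u v)) \<and>
     (\<forall>\<phi>\<in>\<Phi>. \<forall>\<psi>\<in>\<Phi>. \<phi> \<noteq> \<psi> \<longrightarrow> (\<forall>u\<in>C. \<forall>v\<in>C. e \<phi> u \<noteq> e \<psi> v \<and> \<not> E (e \<phi> u) (e \<psi> v))) \<and>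
     (\<forall>\<phi>\<in>\<Phi>. \<forall>v\<in>C. \<forall>s\<in>Xs. e \<phi> v \<noteq> X s \<and>
        (s = pt \<phi> (\<tau> v) \<longrightarrow> E (e \<phi> v) (X s)) \<and>
        (E (e \<phi> v) (X s) \<longrightarrow> s = pt \<phi> (\<tau> v) \<or> s \<in> pt \<phi> ` B))"

locale attached_copies =
  fixes E :: "'v \<Rightarrow> 'v \<Rightarrow> bool" and C \<tau> B Xs \<Phi> X e and g k :: nat
  assumes sym: "\<And>u v. E u v \<Longrightarrow> E v u"
    and finC: "finite C" and forest: "local_forest g E C" and chrom: "uncolourable k E C"
    and inj\<tau>: "inj_on \<tau> C"
    and sys: "copy_system (\<tau> ` C) B Xs \<Phi>" and slope: "\<And>\<phi>. \<phi> \<in> \<Phi> \<Longrightarrow> 0 < snd \<phi>"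
    and mono: "mono_copies (Suc k) (\<tau> ` C) \<Phi>"
    and sparse: "sparse_rel g (on_copy (\<tau> ` C)) \<Phi> Xs"
    and att: "attached E C \<tau> B Xs \<Phi> X e"
begin

definition V where "V = X ` Xs \<union> (\<Union>\<phi>\<in>\<Phi>. e \<phi> ` C)"

lemma fin: "finite Xs" "finite \<Phi>"
  using sys by (auto simp: copy_system_def)

lemma finV: "finite V"
  unfolding V_def using fin finC by auto

lemma injX: "inj_on X Xs" and indepX: "s \<in> Xs \<Longrightarrow> t \<in> Xs \<Longrightarrow> \<not> E (X s) (X t)"
  using att by (auto simp: attached_def)

lemma inje: "\<phi> \<in> \<Phi> \<Longrightarrow> inj_on (e \<phi>) C"
  and iso: "\<phi> \<in> \<Phi> \<Longrightarrow> u \<in> C \<Longrightarrow> v \<in> C \<Longrightarrow> E (e \<phi> u) (e \<phi> v) \<longleftrightarrow> E u v"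
  using att by (simp_all add: attached_def)

lemma apart:
  assumes "\<phi> \<in> \<Phi>" "\<psi> \<in> \<Phi>" "u \<in> C" "v \<in> C" "e \<phi> u = e \<psi> v \<or> E (e \<phi> u) (e \<psi> v)"
  shows "\<phi> = \<psi>"
  using att assms unfolding attached_def by metis

lemma matched:
  assumes "\<phi> \<in> \<Phi>" "v \<in> C" "s \<in> Xs"
  shows "e \<phi> v \<noteq> X s" "E (e \<phi> v) (X s) \<longleftrightarrow> s = pt \<phi> (\<tau> v)"
proof -
  have "s \<notin> pt \<phi> ` B" using sys assms by (auto simp: copy_system_def)
  then show "e \<phi> v \<noteq> X s" "E (e \<phi> v) (X s) \<longleftrightarrow> s = pt \<phi> (\<tau> v)"
    using att assms unfolding attached_def by metis+
qed

lemma VE: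
  assumes "v \<in> V"
  obtains s where "s \<in> Xs" "v = X s" | \<phi> w where "\<phi> \<in> \<Phi>" "w \<in> C" "v = e \<phi> w"
  using assms unfolding V_def by blast

text \<open>Let \<open>a\<close> be the colour of a monochromatic copy. Either \<open>a\<close>
  occurs on the graph attached there, and a matching edge is monochromatic, or that graph uses only
  \<open>k\<close> of the \<open>Suc k\<close> colours and has a monochromatic edge itself.\<close>

lemma uncolourable_V: "uncolourable (Suc k) E V"
  unfolding uncolourable_def
proof (intro allI impI)
  fix c :: "'v \<Rightarrow> nat" assume c: "\<forall>v\<in>V. c v < Suc k"
  \<comment> \<open>\<open>mono_copies\<close> speaks of colourings of all reals, hence the default
    0; the copy that it yields lies in \<open>Xs\<close>.\<close>
  define cX where "cX s = (if s \<in> Xs then c (X s) else 0)" for s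
  have "\<forall>s. cX s < Suc k" using c by (auto simp: cX_def V_def)
  then obtain \<phi> a where \<phi>: "\<phi> \<in> \<Phi>" "a < Suc k" "\<And>v. v \<in> C \<Longrightarrow> cX (pt \<phi> (\<tau> v)) = a"
    using mono unfolding mono_copies_def by blast
  have inX: "pt \<phi> (\<tau> v) \<in> Xs" if "v \<in> C" for v using sys \<phi>(1) that by (auto simp: copy_system_def)
  have eV: "e \<phi> v \<in> V" if "v \<in> C" for v using \<phi>(1) that by (auto simp: V_def)
  show "\<exists>u\<in>V. \<exists>v\<in>V. E u v \<and> c u = c v"
  proof (cases "\<exists>v\<in>C. c (e \<phi> v) = a")
    case True
    then obtain v where v: "v \<in> C" "c (e \<phi> v) = a" by blast
    then have "E (e \<phi> v) (X (pt \<phi> (\<tau> v)))" using matched(2)[OF \<phi>(1)] inX by blast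
    moreover have "X (pt \<phi> (\<tau> v)) \<in> V" "c (X (pt \<phi> (\<tau> v))) = a"
      using inX[OF v(1)] \<phi>(3)[OF v(1)] by (auto simp: V_def cX_def)
    ultimately show ?thesis using v eV by metis
  next
    case False
    \<comment> \<open>The colour \<open>a\<close> is free on this copy of \<open>C\<close>; renaming
      \<open>k\<close> to \<open>a\<close> brings all colours below \<open>k\<close> without merging
      two of them.\<close>
    define c' where "c' v = (if c (e \<phi> v) = k then a else c (e \<phi> v))" for v
    have "c' v < k" if "v \<in> C" for v
    proof (cases "c (e \<phi> v) = k")
      case True
      then show ?thesis using False that \<phi>(2) by (auto simp: c'_def)
    next
      case False
      moreover have "c (e \<phi> v) < Suc k" using c eV that by blast
      ultimately show ?thesis by (simp add: c'_def)
    qed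
    then obtain u v where uv: "u \<in> C" "v \<in> C" "E u v" "c' u = c' v"
      using chrom unfolding uncolourable_def by blast
    then have "c (e \<phi> u) = c (e \<phi> v)" using False by (auto simp: c'_def split: if_splits)
    then show ?thesis using uv iso \<phi>(1) eV by blast
  qed
qed

text \<open>In ordered pairs, each copy contributes at most 2|Sh| - 2 inner edges, and the matching
  edges number at most 2(|F| + |Y| - 1) by sparsity; the savings -2|F| cancel and 2|S| - 2
  remains.\<close>

lemma local_forest_V: "local_forest g E V"
  unfolding local_forest_def
proof (intro allI impI)
  fix S assume S: "S \<subseteq> V" "S \<noteq> {}" and less: "card S < g"
  define Y where "Y = {s\<in>Xs. X s \<in> S}"
  define Sh where "Sh \<phi> = {v\<in>C. e \<phi> v \<in> S}" for \<phi>
  define F where "F = {\<phi>\<in>\<Phi>. Sh \<phi> \<noteq> {}}"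
  define M where "M = {(\<phi>, v). \<phi> \<in> F \<and> v \<in> Sh \<phi> \<and> pt \<phi> (\<tau> v) \<in> Y}"
  define I where "I = {(\<phi>, s) \<in> F \<times> Y. on_copy (\<tau> ` C) \<phi> s}"
  have finS: "finite S" using S finV finite_subset by blast
  have finY: "finite Y" and finF: "finite F" and finSh: "\<And>\<phi>. finite (Sh \<phi>)"
    using fin finC by (simp_all add: Y_def F_def Sh_def)
  have F\<Phi>: "F \<subseteq> \<Phi>" and ShC: "\<And>\<phi>. Sh \<phi> \<subseteq> C" and YX: "Y \<subseteq> Xs" by (auto simp: F_def Sh_def Y_def)
  have cardS: "card S = card Y + (\<Sum>\<phi>\<in>F. card (Sh \<phi>))"
  proof -
    have "S = X ` Y \<union> (\<lambda>(\<phi>, v). e \<phi> v) ` (SIGMA \<phi>:F. Sh \<phi>)" (is "_ = ?A \<union> ?B")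
    proof
      show "S \<subseteq> ?A \<union> ?B"
      proof
        fix v assume v: "v \<in> S"
        with S have "v \<in> V" by blast
        then show "v \<in> ?A \<union> ?B"
        proof (cases rule: VE)
          case (1 s)
          then show ?thesis using v by (auto simp: Y_def)
        next
          case (2 \<phi> w)
          then have "w \<in> Sh \<phi>" using v by (simp add: Sh_def)
          moreover from this 2 have "\<phi> \<in> F" by (auto simp: F_def)
          ultimately show ?thesis using 2 by blast
        qed
      qed
    qed (auto simp: Y_def Sh_def)
    moreover have "?A \<inter> ?B = {}" using matched(1) F\<Phi> ShC YX by fastforce
    ultimately have "card S = card ?A + card ?B"
      using finS by (metis card_Un_disjoint finite_Un)
    moreover have "card ?A = card Y" using inj_on_subset[OF injX YX] by (rule card_image)
    moreover have "card ?B = card (SIGMA \<phi>:F. Sh \<phi>)"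
    proof (rule card_image, rule inj_onI)
      fix p q assume p: "p \<in> (SIGMA \<phi>:F. Sh \<phi>)" and q: "q \<in> (SIGMA \<phi>:F. Sh \<phi>)"
        and "(\<lambda>(\<phi>, v). e \<phi> v) p = (\<lambda>(\<phi>, v). e \<phi> v) q"
      then have eq: "e (fst p) (snd p) = e (fst q) (snd q)" by (simp add: case_prod_beta)
      have *: "fst p \<in> \<Phi>" "fst q \<in> \<Phi>" "snd p \<in> C" "snd q \<in> C"
        using p q F\<Phi> ShC[of "fst p"] ShC[of "fst q"] by auto
      then have "fst p = fst q" using apart eq by blast
      moreover from this have "snd p = snd q" using inj_onD[OF inje[OF *(1)]] eq * by metis
      ultimately show "p = q" by (simp add: prod_eq_iff)
    qed
    ultimately show ?thesis using finF finSh by simp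
  qed
  have finM: "finite M"
    by (rule finite_subset[of _ "F \<times> C"]) (use finF finC ShC in \<open>auto simp: M_def\<close>)
  \<comment> \<open>A matching edge is determined by its copy and its end in \<open>Y\<close>, as
    \<open>\<tau>\<close> and the homothety are injective.\<close>
  have MI: "card M \<le> card I"
  proof (rule card_inj_on_le)
    show "inj_on (\<lambda>(\<phi>, v). (\<phi>, pt \<phi> (\<tau> v))) M"
    proof (rule inj_onI)
      fix p q assume p: "p \<in> M" and q: "q \<in> M"
        and "(\<lambda>(\<phi>, v). (\<phi>, pt \<phi> (\<tau> v))) p = (\<lambda>(\<phi>, v). (\<phi>, pt \<phi> (\<tau> v))) q"
      then have eq: "fst p = fst q" "pt (fst p) (\<tau> (snd p)) = pt (fst p) (\<tau> (snd q))"
        by (auto simp: case_prod_beta)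
      have *: "fst p \<in> \<Phi>" "snd p \<in> C" "snd q \<in> C" 
        using p q F\<Phi> ShC[of "fst p"] ShC[of "fst q"] by (auto simp: M_def)
      have "\<tau> (snd p) = \<tau> (snd q)" using eq(2) slope[OF *(1)] by (simp add: pt_def)
      then show "p = q" using eq(1) inj_onD[OF inj\<tau>] * by (simp add: prod_eq_iff)
    qed
    show "(\<lambda>(\<phi>, v). (\<phi>, pt \<phi> (\<tau> v))) ` M \<subseteq> I" using ShC by (auto simp: M_def I_def on_copy_def)
    show "finite I" by (rule finite_subset[of _ "F \<times> Y"]) (use finF finY in \<open>auto simp: I_def\<close>)
  qed
  have edges: "card (edges_in E S) \<le> (\<Sum>\<phi>\<in>F. card (edges_in E (Sh \<phi>))) + 2 * card M"
  proof -
    let ?in = "\<Union>\<phi>\<in>F. map_prod (e \<phi>) (e \<phi>) ` edges_in E (Sh \<phi>)"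
    let ?ex = "(\<lambda>(\<phi>, v). (e \<phi> v, X (pt \<phi> (\<tau> v)))) ` M"
    let ?xe = "(\<lambda>(\<phi>, v). (X (pt \<phi> (\<tau> v)), e \<phi> v)) ` M"
    have sub: "edges_in E S \<subseteq> ?in \<union> (?ex \<union> ?xe)"
    proof
      fix p assume "p \<in> edges_in E S"
      then obtain u v where p: "p = (u, v)" and uv: "u \<in> S" "v \<in> S" "E u v" by (auto simp: edges_in_def)
      have cross: "\<exists>m\<in>M. a = e (fst m) (snd m) \<and> b = X (pt (fst m) (\<tau> (snd m)))"
        if ab: "a \<in> S" "b \<in> S" "E a b" "\<phi> \<in> \<Phi>" "w \<in> C" "a = e \<phi> w" "s \<in> Xs" "b = X s" for a b \<phi> w s
      proof -
        have s: "s = pt \<phi> (\<tau> w)" using matched(2) ab by blast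
        have "w \<in> Sh \<phi>" using ab by (simp add: Sh_def)
        moreover from this have "\<phi> \<in> F" using ab by (auto simp: F_def)
        moreover have "s \<in> Y" using ab by (simp add: Y_def)
        ultimately have "(\<phi>, w) \<in> M" using s by (simp add: M_def)
        then show ?thesis using ab s by (intro bexI[of _ "(\<phi>, w)"]) auto
      qed
      have "u \<in> V" "v \<in> V" using uv S by auto
      then consider (XX) s t where "s \<in> Xs" "t \<in> Xs" "u = X s" "v = X t"
        | (eX) \<phi> w s where "\<phi> \<in> \<Phi>" "w \<in> C" "u = e \<phi> w" "s \<in> Xs" "v = X s"
        | (Xe) \<phi> w s where "\<phi> \<in> \<Phi>" "w \<in> C" "v = e \<phi> w" "s \<in> Xs" "u = X s"
        | (ee) \<phi> w \<psi> w' where "\<phi> \<in> \<Phi>" "w \<in> C" "u = e \<phi> w" "\<psi> \<in> \<Phi>" "w' \<in> C" "v = e \<psi> w'"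
        by (elim VE) blast+
      then show "p \<in> ?in \<union> (?ex \<union> ?xe)"
      proof cases
        case XX
        then show ?thesis using uv indepX by blast
      next
        case eX
        then obtain m where "m \<in> M" "u = e (fst m) (snd m)" "v = X (pt (fst m) (\<tau> (snd m)))"
          using cross[OF uv eX] by blast
        then have "p \<in> ?ex" unfolding p by (intro image_eqI[of _ _ m]) (auto simp: case_prod_beta)
        then show ?thesis by blast
      next
        case Xe
        then obtain m where "m \<in> M" "v = e (fst m) (snd m)" "u = X (pt (fst m) (\<tau> (snd m)))"
          using cross[OF uv(2,1) sym[OF uv(3)] Xe] by blast
        then have "p \<in> ?xe" unfolding p by (intro image_eqI[of _ _ m]) (auto simp: case_prod_beta)
        then show ?thesis by blast
      next
        case ee
        then have "\<phi> = \<psi>" using apart uv by blast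
        then have "(w, w') \<in> edges_in E (Sh \<phi>)" using ee uv iso by (auto simp: edges_in_def Sh_def)
        moreover from this have "\<phi> \<in> F" using ee by (auto simp: F_def edges_in_def)
        moreover have "p = map_prod (e \<phi>) (e \<phi>) (w, w')" using ee p \<open>\<phi> = \<psi>\<close> by simp
        ultimately show ?thesis by blast
      qed
    qed
    have fine: "finite (edges_in E (Sh \<phi>))" for \<phi> using finSh by (rule finite_edges_in)
    have "card (edges_in E S) \<le> card (?in \<union> (?ex \<union> ?xe))"
      using sub finF fine finM by (intro card_mono) auto
    also have "\<dots> \<le> card ?in + card (?ex \<union> ?xe)" by (rule card_Un_le)
    also have "\<dots> \<le> card ?in + (card ?ex + card ?xe)" using card_Un_le by (rule add_left_mono)
    also have "\<dots> \<le> (\<Sum>\<phi>\<in>F. card (edges_in E (Sh \<phi>))) + (card M + card M)"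
    proof (intro add_mono card_image_le finM)
      have "card ?in \<le> (\<Sum>\<phi>\<in>F. card (map_prod (e \<phi>) (e \<phi>) ` edges_in E (Sh \<phi>)))"
        using finF by (rule card_UN_le)
      also have "\<dots> \<le> (\<Sum>\<phi>\<in>F. card (edges_in E (Sh \<phi>)))"
        using fine by (intro sum_mono card_image_le)
      finally show "card ?in \<le> (\<Sum>\<phi>\<in>F. card (edges_in E (Sh \<phi>)))" .
    qed
    finally show ?thesis by simp
  qed
  have Sh1: "1 \<le> card (Sh \<phi>)" if "\<phi> \<in> F" for \<phi>
    using that finSh by (simp add: F_def Suc_le_eq card_gt_0_iff)
  have forestSh: "card (edges_in E (Sh \<phi>)) + 2 \<le> 2 * card (Sh \<phi>)" if \<phi>: "\<phi> \<in> F" for \<phi>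
  proof -
    have "card (Sh \<phi>) \<le> (\<Sum>\<phi>\<in>F. card (Sh \<phi>))" using \<phi> finF by (intro member_le_sum) auto
    then have "card (Sh \<phi>) < g" using less cardS by linarith
    then show ?thesis using forest ShC \<phi> unfolding local_forest_def F_def by blast
  qed
  have "(\<Sum>\<phi>\<in>F. card (edges_in E (Sh \<phi>)) + 2) \<le> (\<Sum>\<phi>\<in>F. 2 * card (Sh \<phi>))"
    using forestSh by (rule sum_mono)
  then have sum: "(\<Sum>\<phi>\<in>F. card (edges_in E (Sh \<phi>))) + 2 * card F \<le> 2 * (\<Sum>\<phi>\<in>F. card (Sh \<phi>))"
    by (simp only: sum.distrib flip: sum_distrib_left) simp
  show "card (edges_in E S) + 2 \<le> 2 * card S"
  \<comment> \<open>Sparsity speaks of nonempty \<open>F\<close> only; without copies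
    \<open>S\<close> has no edges at all.\<close>
  proof (cases "F = {}")
    case True
    then have "M = {}" by (simp add: M_def)
    moreover have "card S \<ge> 1" using S finS by (simp add: Suc_le_eq card_gt_0_iff)
    ultimately show ?thesis using edges True by simp
  next
    case False
    have "card F = (\<Sum>\<phi>\<in>F. 1)" by simp
    also have "\<dots> \<le> (\<Sum>\<phi>\<in>F. card (Sh \<phi>))" using Sh1 by (rule sum_mono)
    finally have "card F + card Y < g" using less cardS by linarith
    then have "card I < card F + card Y"
      using sparse False F\<Phi> YX unfolding sparse_rel_def I_def by blast
    then show ?thesis using edges sum MI cardS by linarith
  qed
qed

end

text \<open>\<open>N\<close> is the invariant that makes the next extension possible:
  \<open>finite\<close> for tangency, \<open>circle_family\<close> for positive angles.
  \<open>\<tau>\<close> and \<open>B\<close> have to be fixed before \<open>Xs\<close> and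
  \<open>\<Phi>\<close>, because the sparse system is built from them.\<close>

theorem ex_local_forest_uncolourable:
  assumes sym: "\<And>u v. E u v \<Longrightarrow> E v u" and irrefl: "\<And>v. \<not> E v v"
    and start: "N {v0}" and fin: "\<And>C. N C \<Longrightarrow> finite C"
    and extend: "\<And>C. N C \<Longrightarrow> \<exists>\<tau> B. finite B \<and> inj_on \<tau> C \<and> B \<inter> \<tau> ` C = {} \<and>
      (\<forall>Xs \<Phi>. finite Xs \<longrightarrow> finite \<Phi> \<longrightarrow> (\<forall>\<phi>\<in>\<Phi>. 0 < snd \<phi>) \<longrightarrow>
        (\<exists>X e. N (X ` Xs \<union> (\<Union>\<phi>\<in>\<Phi>. e \<phi> ` C)) \<and> attached E C \<tau> B Xs \<Phi> X e))"
  shows "\<exists>V. N V \<and> local_forest g E V \<and> uncolourable k E V"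
proof (induction k)
  case 0
  have "local_forest g E {v0}"
    unfolding local_forest_def
  proof (intro allI impI)
    fix S assume "S \<subseteq> {v0}" "S \<noteq> {}"
    then have "S = {v0}" by blast
    moreover from this have "edges_in E S = {}" using irrefl by (auto simp: edges_in_def)
    ultimately show "card (edges_in E S) + 2 \<le> 2 * card S" by simp
  qed
  moreover have "uncolourable 0 E {v0}" by (simp add: uncolourable_def)
  ultimately show ?case using start by blast
next
  case (Suc k)
  then obtain C where C: "N C" "local_forest g E C" "uncolourable k E C" by blast
  obtain \<tau> B where \<tau>: "finite B" "inj_on \<tau> C" "B \<inter> \<tau> ` C = {}"
    and ext: "\<And>Xs \<Phi>. finite Xs \<Longrightarrow> finite \<Phi> \<Longrightarrow> (\<forall>\<phi>\<in>\<Phi>. 0 < snd \<phi>) \<Longrightarrow>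
        (\<exists>X e. N (X ` Xs \<union> (\<Union>\<phi>\<in>\<Phi>. e \<phi> ` C)) \<and> attached E C \<tau> B Xs \<Phi> X e)"
    using extend[OF C(1)] by blast
  have "sparse_Gallai g (\<tau> ` C) B (Suc k)"
    using fin[OF C(1)] \<tau> by (intro sparse_Gallai_holds) auto
  then obtain Xs and \<Phi> :: "(real \<times> real) set" where SG: "copy_system (\<tau> ` C) B Xs \<Phi>" "\<forall>\<phi>\<in>\<Phi>. 0 < snd \<phi>"
    "mono_copies (Suc k) (\<tau> ` C) \<Phi>" "sparse_rel g (on_copy (\<tau> ` C)) \<Phi> Xs"
    unfolding sparse_Gallai_def by blast
  then obtain X e where X: "N (X ` Xs \<union> (\<Union>\<phi>\<in>\<Phi>. e \<phi> ` C))" "attached E C \<tau> B Xs \<Phi> X e"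
    using ext[of Xs \<Phi>] by (auto simp: copy_system_def)
  interpret attached_copies E C \<tau> B Xs \<Phi> X e g k
    using sym fin[OF C(1)] C \<tau> SG X by unfold_locales auto
  show ?case using X(1) local_forest_V uncolourable_V by (auto simp: V_def)
qed

section \<open>Lines, circles and inversion\<close>

type_synonym triple = "real \<times> real \<times> real"

abbreviation xc :: "triple \<Rightarrow> real" where "xc v \<equiv> fst v"
abbreviation yc :: "triple \<Rightarrow> real" where "yc v \<equiv> fst (snd v)"
abbreviation rad :: "triple \<Rightarrow> real" where "rad v \<equiv> snd (snd v)"

definition sqdist :: "triple \<Rightarrow> triple \<Rightarrow> real" where
  "sqdist u v = (xc u - xc v)\<^sup>2 + (yc u - yc v)\<^sup>2"

text \<open>The law of cosines: the expression inside the absolute value is twice the inner product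
  of the two radius vectors at a common point. This form names no common point.\<close>

definition angle_rel :: "real \<Rightarrow> triple \<Rightarrow> triple \<Rightarrow> bool" where
  "angle_rel \<kappa> u v \<longleftrightarrow> \<bar>(rad u)\<^sup>2 + (rad v)\<^sup>2 - sqdist u v\<bar> = 2 * rad u * rad v * \<kappa>"

lemma sqdist_commute: "sqdist u v = sqdist v u"
  by (simp add: sqdist_def power2_commute)

lemma angle_rel_sym: "angle_rel \<kappa> u v \<Longrightarrow> angle_rel \<kappa> v u"
  by (simp add: angle_rel_def sqdist_commute[of u v] algebra_simps)

text \<open>Under the rational parametrisation of the unit circle each forbidden equation is a
  polynomial in \<open>t\<close> of degree at most 2, which vanishes identically only if
  \<open>a = b = 0\<close>.\<close>

lemma ex_unit_vector_avoiding:
  fixes P :: "(real \<times> real \<times> real) set"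
  assumes "finite P" and nz: "\<And>a b q. (a, b, q) \<in> P \<Longrightarrow> a \<noteq> 0 \<or> b \<noteq> 0"
  shows "\<exists>m n. m\<^sup>2 + n\<^sup>2 = 1 \<and> (\<forall>(a, b, q)\<in>P. a * m + b * n \<noteq> q)"
proof -
  define pl where "pl p = [:fst p - snd (snd p), 2 * fst (snd p), - fst p - snd (snd p):]" for p :: "real \<times> real \<times> real"
  have "finite (pl ` P)" using assms(1) by simp
  moreover have "0 \<notin> pl ` P" using nz by (fastforce simp: pl_def)
  ultimately obtain t where t: "\<forall>p\<in>pl ` P. poly p t \<noteq> 0" using ex_common_nonroot by blast
  define m n where "m = (1 - t\<^sup>2) / (1 + t\<^sup>2)" and "n = 2 * t / (1 + t\<^sup>2)"
  have pos: "1 + t\<^sup>2 > 0" by (simp add: add_pos_nonneg)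
  have "m\<^sup>2 + n\<^sup>2 = ((1 - t\<^sup>2)\<^sup>2 + (2 * t)\<^sup>2) / (1 + t\<^sup>2)\<^sup>2"
    by (simp add: m_def n_def power_divide add_divide_distrib)
  also have "(1 - t\<^sup>2)\<^sup>2 + (2 * t)\<^sup>2 = (1 + t\<^sup>2)\<^sup>2" by algebra
  finally have "m\<^sup>2 + n\<^sup>2 = 1" using pos by simp
  moreover have "a * m + b * n \<noteq> q" if "(a, b, q) \<in> P" for a b q
  proof
    assume "a * m + b * n = q"
    then have "(a * m + b * n) * (1 + t\<^sup>2) = q * (1 + t\<^sup>2)" by simp
    moreover have "m * (1 + t\<^sup>2) = 1 - t\<^sup>2" "n * (1 + t\<^sup>2) = 2 * t" using pos by (simp_all add: m_def n_def)
    ultimately have "a * (1 - t\<^sup>2) + b * (2 * t) = q * (1 + t\<^sup>2)" by algebra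
    then have "poly (pl (a, b, q)) t = 0" by (simp add: pl_def algebra_simps power2_eq_square)
    then show False using t that by blast
  qed
  ultimately show ?thesis by blast
qed

text \<open>Inversion in the unit circle around \<open>(a, b)\<close>, which is then moved to the
  origin. \<open>P\<close> is the power of \<open>(a, b)\<close> with respect to the circle; the
  image is again a circle if \<open>P\<close> is nonzero.\<close>

definition invert :: "real \<Rightarrow> real \<Rightarrow> triple \<Rightarrow> triple" where
  "invert a b v = (let P = (xc v - a)\<^sup>2 + (yc v - b)\<^sup>2 - (rad v)\<^sup>2
     in ((xc v - a) / P, (yc v - b) / P, rad v / \<bar>P\<bar>))"

text \<open>The image of the vertical line \<open>x = s\<close>, in coordinates centred at the centre of inversion.\<close>

definition invert_vertical :: "real \<Rightarrow> real \<Rightarrow> triple" where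
  "invert_vertical a s = (1 / (2 * (s - a)), 0, 1 / (2 * \<bar>s - a\<bar>))"

text \<open>The numerator of the cosine is divided by \<open>P * P'\<close>, the product of the
  radii by its absolute value; the absolute value in \<open>angle_rel\<close> absorbs the
  sign.\<close>

lemma angle_rel_invert_aux:
  fixes X Y r X' Y' r' :: real
  assumes "P = X\<^sup>2 + Y\<^sup>2 - r\<^sup>2" "P' = X'\<^sup>2 + Y'\<^sup>2 - r'\<^sup>2" "P \<noteq> 0" "P' \<noteq> 0"
  shows "(r / \<bar>P\<bar>)\<^sup>2 + (r' / \<bar>P'\<bar>)\<^sup>2 - ((X / P - X' / P')\<^sup>2 + (Y / P - Y' / P')\<^sup>2) =
    (r\<^sup>2 + r'\<^sup>2 - ((X - X')\<^sup>2 + (Y - Y')\<^sup>2)) / (P * P')" (is "?l = ?r")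
proof -
  have "?l * (P\<^sup>2 * P'\<^sup>2) = r\<^sup>2 * P'\<^sup>2 + r'\<^sup>2 * P\<^sup>2 - ((X * P' - X' * P)\<^sup>2 + (Y * P' - Y' * P)\<^sup>2)"
    using assms(3,4) by (simp add: power_divide field_simps power2_eq_square)
  also have "\<dots> = (r\<^sup>2 + r'\<^sup>2 - ((X - X')\<^sup>2 + (Y - Y')\<^sup>2)) * (P * P')"
    unfolding assms(1,2) by algebra
  also have "\<dots> = ?r * (P\<^sup>2 * P'\<^sup>2)" using assms(3,4) by (simp add: power2_eq_square)
  finally have "?l * (P\<^sup>2 * P'\<^sup>2) = ?r * (P\<^sup>2 * P'\<^sup>2)" .
  moreover have "P\<^sup>2 * P'\<^sup>2 \<noteq> 0" using assms(3,4) by simp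
  ultimately show ?thesis using mult_right_cancel by blast
qed

lemma angle_rel_invert:
  assumes "(xc u - a)\<^sup>2 + (yc u - b)\<^sup>2 \<noteq> (rad u)\<^sup>2" "(xc v - a)\<^sup>2 + (yc v - b)\<^sup>2 \<noteq> (rad v)\<^sup>2"
  shows "angle_rel \<kappa> (invert a b u) (invert a b v) \<longleftrightarrow> angle_rel \<kappa> u v"
proof -
  define P Q where "P = (xc u - a)\<^sup>2 + (yc u - b)\<^sup>2 - (rad u)\<^sup>2" and "Q = (xc v - a)\<^sup>2 + (yc v - b)\<^sup>2 - (rad v)\<^sup>2"
  have nz: "P \<noteq> 0" "Q \<noteq> 0" using assms by (simp_all add: P_def Q_def)
  have u: "invert a b u = ((xc u - a) / P, (yc u - b) / P, rad u / \<bar>P\<bar>)"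
    and v: "invert a b v = ((xc v - a) / Q, (yc v - b) / Q, rad v / \<bar>Q\<bar>)"
    by (simp_all add: invert_def P_def Q_def Let_def)
  let ?e = "(rad u)\<^sup>2 + (rad v)\<^sup>2 - sqdist u v"
  have "angle_rel \<kappa> (invert a b u) (invert a b v) \<longleftrightarrow>
     \<bar>?e / (P * Q)\<bar> = 2 * (rad u / \<bar>P\<bar>) * (rad v / \<bar>Q\<bar>) * \<kappa>"
    using angle_rel_invert_aux[OF P_def Q_def nz] by (simp add: angle_rel_def sqdist_def u v)
  also have "\<dots> \<longleftrightarrow> \<bar>?e\<bar> / (\<bar>P\<bar> * \<bar>Q\<bar>) = (2 * rad u * rad v * \<kappa>) / (\<bar>P\<bar> * \<bar>Q\<bar>)"
    by (simp add: abs_mult)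
  also have "\<dots> \<longleftrightarrow> angle_rel \<kappa> u v" using nz by (simp add: angle_rel_def)
  finally show ?thesis .
qed

text \<open>A line makes the angle \<open>arccos \<kappa>\<close> with a circle if its distance from
  the centre is \<open>\<kappa>\<close> times the radius, and inversion preserves angles.\<close>

lemma angle_rel_invert_vertical:
  assumes "(xc v - a)\<^sup>2 + (yc v - b)\<^sup>2 \<noteq> (rad v)\<^sup>2" "s \<noteq> a"
  shows "angle_rel \<kappa> (invert a b v) (invert_vertical a s) \<longleftrightarrow> \<bar>xc v - s\<bar> = rad v * \<kappa>"
proof -
  define X Y r P \<delta> where "X = xc v - a" and "Y = yc v - b" and "r = rad v"
    and P: "P = X\<^sup>2 + Y\<^sup>2 - r\<^sup>2" and "\<delta> = s - a"
  have nz: "P \<noteq> 0" "\<delta> \<noteq> 0" using assms by (simp_all add: P X_def Y_def r_def \<delta>_def)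
  have v: "invert a b v = (X / P, Y / P, r / \<bar>P\<bar>)"
    by (simp add: invert_def P X_def Y_def r_def Let_def)
  have "(r / \<bar>P\<bar>)\<^sup>2 + (1 / (2 * \<bar>\<delta>\<bar>))\<^sup>2 - ((X / P - 1 / (2 * \<delta>))\<^sup>2 + (Y / P)\<^sup>2)
      = (X - \<delta>) / (\<delta> * P)" (is "?l = ?r")
  proof -
    have "?l * (P\<^sup>2 * \<delta>) = r\<^sup>2 * \<delta> - (X\<^sup>2 * \<delta> - X * P + Y\<^sup>2 * \<delta>)"
      using nz by (simp add: power_divide field_simps power2_eq_square)
    also have "\<dots> = (X - \<delta>) * P" unfolding P by algebra
    also have "\<dots> = ?r * (P\<^sup>2 * \<delta>)" using nz by (simp add: power2_eq_square)
    finally have "?l * (P\<^sup>2 * \<delta>) = ?r * (P\<^sup>2 * \<delta>)" .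
    moreover have "P\<^sup>2 * \<delta> \<noteq> 0" using nz by simp
    ultimately show ?thesis using mult_right_cancel by blast
  qed
  then have "angle_rel \<kappa> (invert a b v) (invert_vertical a s) \<longleftrightarrow>
     \<bar>(X - \<delta>) / (\<delta> * P)\<bar> = 2 * (r / \<bar>P\<bar>) * (1 / (2 * \<bar>\<delta>\<bar>)) * \<kappa>"
    by (simp add: angle_rel_def sqdist_def v invert_vertical_def flip: \<delta>_def)
  also have "\<dots> \<longleftrightarrow> \<bar>X - \<delta>\<bar> / (\<bar>\<delta>\<bar> * \<bar>P\<bar>) = (r * \<kappa>) / (\<bar>\<delta>\<bar> * \<bar>P\<bar>)"
    by (simp add: abs_mult mult.commute)
  also have "\<dots> \<longleftrightarrow> \<bar>X - \<delta>\<bar> = r * \<kappa>" using nz by simp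
  finally show ?thesis by (simp add: X_def \<delta>_def r_def)
qed

text \<open>The images of parallel lines touch at the centre of inversion, which corresponds to
  \<open>\<kappa> = 1\<close>.\<close>

lemma angle_rel_invert_verticals:
  assumes "s \<noteq> a" "t \<noteq> a" "\<kappa> < 1"
  shows "\<not> angle_rel \<kappa> (invert_vertical a s) (invert_vertical a t)"
proof -
  define \<delta> \<eta> where "\<delta> = s - a" and "\<eta> = t - a"
  have nz: "\<delta> \<noteq> 0" "\<eta> \<noteq> 0" using assms by (simp_all add: \<delta>_def \<eta>_def)
  have "(1 / (2 * \<bar>\<delta>\<bar>))\<^sup>2 + (1 / (2 * \<bar>\<eta>\<bar>))\<^sup>2 - (1 / (2 * \<delta>) - 1 / (2 * \<eta>))\<^sup>2 = 1 / (2 * (\<delta> * \<eta>))"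
    using nz by (simp add: power_divide power2_diff power2_abs power_mult_distrib)
  then have "angle_rel \<kappa> (invert_vertical a s) (invert_vertical a t) \<longleftrightarrow>
      \<bar>1 / (2 * (\<delta> * \<eta>))\<bar> = 2 * (1 / (2 * \<bar>\<delta>\<bar>)) * (1 / (2 * \<bar>\<eta>\<bar>)) * \<kappa>"
    by (simp add: angle_rel_def sqdist_def invert_vertical_def flip: \<delta>_def \<eta>_def)
  also have "\<dots> \<longleftrightarrow> 1 / (2 * (\<bar>\<delta>\<bar> * \<bar>\<eta>\<bar>)) = \<kappa> / (2 * (\<bar>\<delta>\<bar> * \<bar>\<eta>\<bar>))"
    by (simp add: abs_mult mult.left_commute)
  also have "\<dots> \<longleftrightarrow> \<kappa> = 1" unfolding divide_cancel_right using nz by auto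
  finally show ?thesis using assms(3) by simp
qed

text \<open>The centre of inversion is taken on a line with equation \<open>x + w y = 0\<close>. The images of two circles are
  concentric only for finitely many centres on that line, since otherwise the centres of the
  circles have the same value of \<open>x + w y\<close>.\<close>

lemma ex_generic_inversion:
  assumes fin: "finite Q" "finite Xs" and inj: "inj_on (\<lambda>v. (xc v, yc v)) Q"
  shows "\<exists>a b. (\<forall>s\<in>Xs. s \<noteq> a) \<and> (\<forall>v\<in>Q. (xc v - a)\<^sup>2 + (yc v - b)\<^sup>2 \<noteq> (rad v)\<^sup>2) \<and>
    inj_on (\<lambda>v. (xc v, yc v)) (invert a b ` Q \<union> invert_vertical a ` Xs) \<and>
    inj_on (invert a b) Q \<and> inj_on (invert_vertical a) Xs \<and> invert a b ` Q \<inter> invert_vertical a ` Xs = {}"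
proof -
  have "finite ((\<lambda>(u, v). [:xc u - xc v, yc u - yc v:]) ` {(u, v) \<in> Q \<times> Q. u \<noteq> v})"
    by (rule finite_imageI, rule finite_subset[of _ "Q \<times> Q"]) (use fin in auto)
  moreover have "0 \<notin> (\<lambda>(u, v). [:xc u - xc v, yc u - yc v:]) ` {(u, v) \<in> Q \<times> Q. u \<noteq> v}"
  proof
    assume "0 \<in> (\<lambda>(u, v). [:xc u - xc v, yc u - yc v:]) ` {(u, v) \<in> Q \<times> Q. u \<noteq> v}"
    then obtain q where q: "q \<in> {(u, v) \<in> Q \<times> Q. u \<noteq> v}" "0 = (\<lambda>(u, v). [:xc u - xc v, yc u - yc v:]) q" by blast
    obtain u v where "q = (u, v)" by (cases q)
    with q have uv: "u \<in> Q" "v \<in> Q" "u \<noteq> v" "[:xc u - xc v, yc u - yc v:] = 0" by simp_all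
    then have "xc u = xc v" "yc u = yc v" by auto
    then show False using inj_onD[OF inj _ uv(1,2)] uv(3) by simp
  qed
  \<comment> \<open>\<open>x + w y\<close> separates the centres of \<open>Q\<close>;
    \<open>w > 0\<close> makes the polynomials \<open>D s\<close> below nonzero.\<close>
  ultimately obtain w where w: "w > 0"
    and sep0: "\<forall>p\<in>(\<lambda>(u, v). [:xc u - xc v, yc u - yc v:]) ` {(u, v) \<in> Q \<times> Q. u \<noteq> v}. poly p w \<noteq> 0"
    using ex_common_nonroot[of _ 0] by blast
  define A where "A v = xc v + w * yc v" for v
  have sep: "A u \<noteq> A v" if "u \<in> Q" "v \<in> Q" "u \<noteq> v" for u v
  proof -
    have "poly [:xc u - xc v, yc u - yc v:] w \<noteq> 0" using bspec[OF sep0 imageI, of "(u, v)"] that by simp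
    then show ?thesis by (simp add: A_def algebra_simps)
  qed
  \<comment> \<open>For the centre of inversion \<open>(- w * t, t)\<close>, these are its power
    with respect to \<open>v\<close> and its signed distance \<open>s - a\<close> from the line, as
    polynomials in \<open>t\<close>.\<close>
  define P where "P v = [:(xc v)\<^sup>2 + (yc v)\<^sup>2 - (rad v)\<^sup>2, 2 * (w * xc v - yc v), 1 + w\<^sup>2:]" for v
  define D where "D s = [:s, w:]" for s
  \<comment> \<open>On the images \<open>x + w y\<close> has the values \<open>A v / p v\<close> and
    \<open>1 / (2 * (s - a))\<close>. An equality that involves a circle makes a member of the last
    two groups vanish at \<open>t\<close>; those have a nonzero coefficient of
    \<open>t^2\<close>.\<close>
  define R where "R = P ` Q \<union> D ` Xs \<union> (\<lambda>(u, v). smult (A u) (P v) - smult (A v) (P u)) ` {(u, v) \<in> Q \<times> Q. u \<noteq> v}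
     \<union> (\<lambda>(v, s). smult (2 * A v) (D s) - P v) ` (Q \<times> Xs)"
  have w2: "1 + w\<^sup>2 > 0" by (simp add: add_pos_nonneg)
  have c2: "coeff (P v) 2 = 1 + w\<^sup>2" "coeff (D s) 2 = 0" for v s by (simp_all add: P_def D_def numeral_2_eq_2)
  have "finite {(u, v) \<in> Q \<times> Q. u \<noteq> v}" by (rule finite_subset[of _ "Q \<times> Q"]) (use fin in auto)
  then have "finite R" unfolding R_def using fin by simp
  moreover have "0 \<notin> R"
  proof -
    have "P v \<noteq> 0" for v
    proof
      assume "P v = 0" then show False using c2(1)[of v] w2 by simp
    qed
    moreover have "D s \<noteq> 0" for s using w by (simp add: D_def)
    moreover have "smult (A u) (P v) \<noteq> smult (A v) (P u)" if "u \<in> Q" "v \<in> Q" "u \<noteq> v" for u v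
    proof
      assume "smult (A u) (P v) = smult (A v) (P u)"
      from arg_cong[OF this, of "\<lambda>p. coeff p 2"] show False using sep that w2 by (simp add: c2)
    qed
    moreover have "smult (2 * A v) (D s) \<noteq> P v" for v s
    proof
      assume "smult (2 * A v) (D s) = P v"
      from arg_cong[OF this, of "\<lambda>p. coeff p 2"] show False using w2 by (simp add: c2)
    qed
    ultimately have "p \<noteq> 0" if "p \<in> R" for p
      using that unfolding R_def by (elim UnE imageE) (simp_all add: case_prod_beta)
    then show ?thesis by blast
  qed
  ultimately obtain t where t: "\<forall>p\<in>R. poly p t \<noteq> 0" using ex_common_nonroot by blast
  define a b where "a = - w * t" and "b = t"
  define p where "p v = (xc v - a)\<^sup>2 + (yc v - b)\<^sup>2 - (rad v)\<^sup>2" for v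
  have pP: "poly (P v) t = p v" for v
    by (simp add: P_def p_def a_def b_def power2_eq_square algebra_simps)
  have dD: "poly (D s) t = s - a" for s by (simp add: D_def a_def mult.commute)
  have pnz: "p v \<noteq> 0" if "v \<in> Q" for v using t that unfolding R_def by (auto simp flip: pP)
  have snz: "s - a \<noteq> 0" if "s \<in> Xs" for s using t that unfolding R_def by (auto simp flip: dD)
  have uv: "A u * p v \<noteq> A v * p u" if "u \<in> Q" "v \<in> Q" "u \<noteq> v" for u v
  proof -
    have "smult (A u) (P v) - smult (A v) (P u) \<in> R"
      unfolding R_def by (rule UnI1, rule UnI2, rule image_eqI[of _ _ "(u, v)"]) (use that in simp_all)
    then have "poly (smult (A u) (P v) - smult (A v) (P u)) t \<noteq> 0" using t by blast
    then show ?thesis by (simp add: pP)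
  qed
  have vs: "2 * A v * (s - a) \<noteq> p v" if "v \<in> Q" "s \<in> Xs" for v s
  proof -
    have "smult (2 * A v) (D s) - P v \<in> R"
      unfolding R_def by (rule UnI2, rule image_eqI[of _ _ "(v, s)"]) (use that in simp_all)
    then have "poly (smult (2 * A v) (D s) - P v) t \<noteq> 0" using t by blast
    then show ?thesis by (simp add: pP dD)
  qed
  define B where "B v = xc v + w * yc v" for v
  \<comment> \<open>Since \<open>a + w * b = 0\<close>, the numerator does not depend on
    \<open>t\<close>.\<close>
  have Bv: "B (invert a b v) = A v / p v" for v
  proof -
    have "xc (invert a b v) = (xc v - a) / p v" "yc (invert a b v) = (yc v - b) / p v"
      by (simp_all add: invert_def p_def Let_def)
    then have "B (invert a b v) = (xc v - a + w * (yc v - b)) / p v" by (simp add: B_def add_divide_distrib)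
    then show ?thesis by (simp add: A_def a_def b_def algebra_simps)
  qed
  have Bs: "B (invert_vertical a s) = 1 / (2 * (s - a))" for s by (simp add: B_def invert_vertical_def)
  have vv': "u = v" if "u \<in> Q" "v \<in> Q" "B (invert a b u) = B (invert a b v)" for u v
    using that uv[of u v] pnz by (auto simp: Bv field_simps)
  have vs': "B (invert a b v) \<noteq> B (invert_vertical a s)" if "v \<in> Q" "s \<in> Xs" for v s
  proof
    assume "B (invert a b v) = B (invert_vertical a s)"
    then have "2 * A v * (s - a) = p v" using that pnz snz by (simp add: Bv Bs frac_eq_eq algebra_simps)
    then show False using vs that by blast
  qed
  have ss': "s = s'" if "s \<in> Xs" "s' \<in> Xs" "B (invert_vertical a s) = B (invert_vertical a s')" for s s'
    using that snz by (simp add: Bs)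
  have sepB: "x = y" if x: "x \<in> invert a b ` Q \<union> invert_vertical a ` Xs"
    and y: "y \<in> invert a b ` Q \<union> invert_vertical a ` Xs" and eq: "B x = B y" for x y
  proof -
    from x y consider u v where "u \<in> Q" "v \<in> Q" "x = invert a b u" "y = invert a b v"
      | v s where "v \<in> Q" "s \<in> Xs" "x = invert a b v" "y = invert_vertical a s"
      | v s where "v \<in> Q" "s \<in> Xs" "y = invert a b v" "x = invert_vertical a s"
      | s s' where "s \<in> Xs" "s' \<in> Xs" "x = invert_vertical a s" "y = invert_vertical a s'"
      by blast
    then show ?thesis
    proof cases
      case (1 u v) then show ?thesis using vv'[of u v] eq by simp
    next
      case (2 v s) then show ?thesis using vs'[of v s] eq by simp
    next
      case (3 v s) then show ?thesis using vs'[of v s] eq by simp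
    next
      case (4 s s') then show ?thesis using ss'[of s s'] eq by simp
    qed
  qed
  have "inj_on (\<lambda>v. (xc v, yc v)) (invert a b ` Q \<union> invert_vertical a ` Xs)"
  proof (rule inj_onI)
    fix x y assume x: "x \<in> invert a b ` Q \<union> invert_vertical a ` Xs"
      and y: "y \<in> invert a b ` Q \<union> invert_vertical a ` Xs" and "(xc x, yc x) = (xc y, yc y)"
    from this(3) have "B x = B y" by (simp add: B_def)
    then show "x = y" by (rule sepB[OF x y])
  qed
  moreover have "inj_on (invert a b) Q"
  proof (rule inj_onI)
    fix u v assume "u \<in> Q" "v \<in> Q" "invert a b u = invert a b v"
    then show "u = v" using vv'[of u v] by simp
  qed
  moreover have "inj_on (invert_vertical a) Xs"
  proof (rule inj_onI)
    fix s t assume "s \<in> Xs" "t \<in> Xs" "invert_vertical a s = invert_vertical a t"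
    then show "s = t" using ss'[of s t] by simp
  qed
  moreover have "x \<notin> invert_vertical a ` Xs" if x: "x \<in> invert a b ` Q" for x
  proof
    assume "x \<in> invert_vertical a ` Xs"
    with x obtain v s where "v \<in> Q" "s \<in> Xs" "invert a b v = invert_vertical a s" by (elim imageE) simp
    then show False using vs'[of v s] by simp
  qed
  then have "invert a b ` Q \<inter> invert_vertical a ` Xs = {}" by blast
  moreover have "\<forall>v\<in>Q. (xc v - a)\<^sup>2 + (yc v - b)\<^sup>2 \<noteq> (rad v)\<^sup>2" using pnz by (auto simp: p_def)
  moreover have "\<forall>s\<in>Xs. s \<noteq> a" using snz by auto
  ultimately show ?thesis by blast
qed

section \<open>Extension for positive angles\<close>

lemma rotation_sqnorm:
  fixes m n x y :: real
  assumes "m\<^sup>2 + n\<^sup>2 = 1"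
  shows "(x * m + y * n)\<^sup>2 + (y * m - x * n)\<^sup>2 = x\<^sup>2 + y\<^sup>2"
proof -
  have "(x * m + y * n)\<^sup>2 + (y * m - x * n)\<^sup>2 = (x\<^sup>2 + y\<^sup>2) * (m\<^sup>2 + n\<^sup>2)" by algebra
  then show ?thesis using assms by simp
qed

lemma finite_upper_bound:
  fixes f :: "'a \<Rightarrow> real"
  assumes "finite A"
  shows "\<exists>R\<ge>0. \<forall>x\<in>A. f x \<le> R"
proof (intro exI[of _ "Max (insert 0 (f ` A))"] conjI ballI)
  fix x assume "x \<in> A"
  then show "f x \<le> Max (insert 0 (f ` A))" using assms by (intro Max_ge) auto
qed (use assms in \<open>intro Max_ge, auto\<close>)

lemma angle_rel_sqdist_le:
  assumes "angle_rel \<kappa> u v" "\<kappa> \<le> 1" "0 < rad u" "0 < rad v"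
  shows "sqdist u v \<le> (rad u + rad v)\<^sup>2"
proof -
  have "2 * rad u * rad v * \<kappa> \<le> 2 * rad u * rad v" using assms by (simp add: mult_left_le)
  then have "sqdist u v \<le> (rad u)\<^sup>2 + (rad v)\<^sup>2 + 2 * rad u * rad v"
    using assms(1) unfolding angle_rel_def by linarith
  then show ?thesis by (simp add: power2_sum)
qed

definition circle_rel :: "real \<Rightarrow> triple \<Rightarrow> triple \<Rightarrow> bool" where
  "circle_rel \<kappa> u v \<longleftrightarrow> u \<noteq> v \<and> angle_rel \<kappa> u v"

text \<open>Distinct centres are required so that, for \<open>\<kappa> = 0\<close>, too, the circles can be met at the
  prescribed angle by different parallel lines.\<close>

definition circle_family :: "triple set \<Rightarrow> bool" where
  "circle_family C \<longleftrightarrow> finite C \<and> (\<forall>v\<in>C. 0 < rad v) \<and> inj_on (\<lambda>v. (xc v, yc v)) C"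

text \<open>A circle \<open>v\<close> makes the angle \<open>arccos \<kappa>\<close> with two lines orthogonal to the unit vector \<open>(m, n)\<close>, at
  heights \<open>\<tau> v\<close> and \<open>\<beta> v\<close>.\<close>

lemma circle_family_extend:
  assumes \<kappa>: "0 \<le> \<kappa>" "\<kappa> < 1" and C: "circle_family C"
  shows "\<exists>\<tau> B. finite B \<and> inj_on \<tau> C \<and> B \<inter> \<tau> ` C = {} \<and>
      (\<forall>Xs \<Phi>. finite Xs \<longrightarrow> finite \<Phi> \<longrightarrow> (\<forall>\<phi>\<in>\<Phi>. 0 < snd \<phi>) \<longrightarrow>
        (\<exists>X e. circle_family (X ` Xs \<union> (\<Union>\<phi>\<in>\<Phi>. e \<phi> ` C)) \<and> attached (circle_rel \<kappa>) C \<tau> B Xs \<Phi> X e))"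
proof -
  have finC: "finite C" and radC: "\<And>v. v \<in> C \<Longrightarrow> 0 < rad v"
    and injC: "\<And>u v. u \<in> C \<Longrightarrow> v \<in> C \<Longrightarrow> u \<noteq> v \<Longrightarrow> xc u - xc v \<noteq> 0 \<or> yc u - yc v \<noteq> 0"
    using C by (auto simp: circle_family_def inj_on_def)
  define D where "D = {(u, v) \<in> C \<times> C. u \<noteq> v}"
  have finD: "finite D" by (rule finite_subset[of _ "C \<times> C"]) (use finC in \<open>auto simp: D_def\<close>)
  \<comment> \<open>The two kinds of forbidden equations express \<open>\<tau> u = \<tau> v\<close>
    and \<open>\<beta> u = \<tau> v\<close>.\<close>
  define P where "P = (\<lambda>(u, v). (xc u - xc v, yc u - yc v, \<kappa> * (rad u - rad v))) ` D \<union>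
    (\<lambda>(u, v). (xc u - xc v, yc u - yc v, - \<kappa> * (rad u + rad v))) ` D"
  have "finite P" unfolding P_def using finD by simp
  moreover have "a \<noteq> 0 \<or> b \<noteq> 0" if "(a, b, q) \<in> P" for a b q
    using that injC unfolding P_def D_def by (elim UnE imageE) (simp_all add: case_prod_beta)
  ultimately obtain m n where mn: "m\<^sup>2 + n\<^sup>2 = 1" and avoid: "\<forall>(a, b, q)\<in>P. a * m + b * n \<noteq> q"
    using ex_unit_vector_avoiding by meson
  define \<xi> where "\<xi> v = xc v * m + yc v * n" for v
  define \<zeta> where "\<zeta> v = yc v * m - xc v * n" for v
  define \<tau> where "\<tau> v = \<xi> v - rad v * \<kappa>" for v
  define \<beta> where "\<beta> v = \<xi> v + rad v * \<kappa>" for v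
  have gen: "\<tau> u \<noteq> \<tau> v" "\<beta> u \<noteq> \<tau> v" if uv: "u \<in> C" "v \<in> C" "u \<noteq> v" for u v
  proof -
    have "(u, v) \<in> D" using uv by (simp add: D_def)
    then have "(xc u - xc v, yc u - yc v, \<kappa> * (rad u - rad v)) \<in> P"
      "(xc u - xc v, yc u - yc v, - \<kappa> * (rad u + rad v)) \<in> P"
      unfolding P_def by (force+)
    with avoid have "(xc u - xc v) * m + (yc u - yc v) * n \<noteq> \<kappa> * (rad u - rad v)"
      "(xc u - xc v) * m + (yc u - yc v) * n \<noteq> - \<kappa> * (rad u + rad v)" by blast+
    then show "\<tau> u \<noteq> \<tau> v" "\<beta> u \<noteq> \<tau> v" by (auto simp: \<tau>_def \<beta>_def \<xi>_def algebra_simps)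
  qed
  have inj\<tau>: "inj_on \<tau> C" using gen(1) by (meson inj_onI)
  \<comment> \<open>For \<open>\<kappa> = 0\<close> the two heights of a circle coincide, so the
    values of \<open>\<tau>\<close> have to be removed.\<close>
  define B where "B = \<beta> ` C - \<tau> ` C"
  have sqdist_rot: "(\<xi> u - \<xi> v)\<^sup>2 + (\<zeta> u - \<zeta> v)\<^sup>2 = sqdist u v" for u v
    using rotation_sqnorm[OF mn, of "xc u - xc v" "yc u - yc v"]
    by (simp add: \<xi>_def \<zeta>_def sqdist_def algebra_simps)
  have ext: "\<exists>X e. circle_family (X ` Xs \<union> (\<Union>\<phi>\<in>\<Phi>. e \<phi> ` C)) \<and> attached (circle_rel \<kappa>) C \<tau> B Xs \<Phi> X e"
    if Xs: "finite Xs" and \<Phi>: "finite \<Phi>" "\<forall>\<phi>\<in>\<Phi>. 0 < snd \<phi>" for Xs and \<Phi> :: "(real \<times> real) set"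
  proof -
    obtain idx :: "real \<times> real \<Rightarrow> nat" where idx: "inj_on idx \<Phi>"
      using finite_imp_inj_to_nat_seg[OF \<Phi>(1)] by blast
    obtain R where R: "\<forall>p\<in>\<Phi> \<times> C. \<bar>snd (fst p) * \<zeta> (snd p)\<bar> + snd (fst p) * rad (snd p) \<le> R"
      using finite_upper_bound[of "\<Phi> \<times> C" "\<lambda>p. \<bar>snd (fst p) * \<zeta> (snd p)\<bar> + snd (fst p) * rad (snd p)"] \<Phi>(1) finC by blast
    \<comment> \<open>\<open>R\<close> bounds the vertical reach of a scaled copy from its axis, so
      axes at distance \<open>L\<close> keep the copies disjoint.\<close>
    define L where "L = 2 * \<bar>R\<bar> + 1"
    \<comment> \<open>The direction \<open>(m, n)\<close> is turned to the horizontal. The homothety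
      acts on heights as on \<open>\<tau>\<close>, and the shift by
      \<open>L * real (idx \<phi>)\<close> runs along the vertical lines, so it does not affect the
      angles with them.\<close>
    define Pl where "Pl \<phi> v = (pt \<phi> (\<xi> v), L * real (idx \<phi>) + snd \<phi> * \<zeta> v, snd \<phi> * rad v)" for \<phi> v
    define Q where "Q = (\<Union>\<phi>\<in>\<Phi>. Pl \<phi> ` C)"
    have rad_pos: "0 < rad (Pl \<phi> v)" if "\<phi> \<in> \<Phi>" "v \<in> C" for \<phi> v
      using that \<Phi>(2) radC by (simp add: Pl_def)
    have sq: "sqdist (Pl \<phi> u) (Pl \<phi> v) = (snd \<phi>)\<^sup>2 * sqdist u v" for \<phi> u v
    proof -
      have "sqdist (Pl \<phi> u) (Pl \<phi> v) = (snd \<phi> * (\<xi> u - \<xi> v))\<^sup>2 + (snd \<phi> * (\<zeta> u - \<zeta> v))\<^sup>2"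
        by (simp add: sqdist_def Pl_def pt_def algebra_simps)
      also have "\<dots> = (snd \<phi>)\<^sup>2 * ((\<xi> u - \<xi> v)\<^sup>2 + (\<zeta> u - \<zeta> v)\<^sup>2)" by (simp only: power_mult_distrib distrib_left)
      finally show ?thesis by (simp add: sqdist_rot)
    qed
    have iso: "angle_rel \<kappa> (Pl \<phi> u) (Pl \<phi> v) \<longleftrightarrow> angle_rel \<kappa> u v" if "\<phi> \<in> \<Phi>" for \<phi> u v
    proof -
      have d: "snd \<phi> > 0" using \<Phi>(2) that by blast
      have "(rad (Pl \<phi> u))\<^sup>2 + (rad (Pl \<phi> v))\<^sup>2 - sqdist (Pl \<phi> u) (Pl \<phi> v)
          = (snd \<phi>)\<^sup>2 * ((rad u)\<^sup>2 + (rad v)\<^sup>2 - sqdist u v)"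
        by (simp add: sq) (simp add: Pl_def power_mult_distrib algebra_simps)
      moreover have "2 * rad (Pl \<phi> u) * rad (Pl \<phi> v) * \<kappa> = (snd \<phi>)\<^sup>2 * (2 * rad u * rad v * \<kappa>)"
        by (simp add: Pl_def power2_eq_square algebra_simps)
      ultimately have "angle_rel \<kappa> (Pl \<phi> u) (Pl \<phi> v) \<longleftrightarrow>
          (snd \<phi>)\<^sup>2 * \<bar>(rad u)\<^sup>2 + (rad v)\<^sup>2 - sqdist u v\<bar> = (snd \<phi>)\<^sup>2 * (2 * rad u * rad v * \<kappa>)"
        by (simp only: angle_rel_def abs_mult) simp
      then show ?thesis using d unfolding angle_rel_def mult_cancel_left by simp
    qed
    have sqdist_far: "(rad (Pl \<phi> u) + rad (Pl \<psi> v))\<^sup>2 < sqdist (Pl \<phi> u) (Pl \<psi> v)"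
      if *: "\<phi> \<in> \<Phi>" "\<psi> \<in> \<Phi>" "\<phi> \<noteq> \<psi>" "u \<in> C" "v \<in> C" for \<phi> \<psi> u v
    proof -
      have "idx \<phi> \<noteq> idx \<psi>" using idx * by (auto dest: inj_onD)
      then have "1 \<le> \<bar>real (idx \<phi>) - real (idx \<psi>)\<bar>" by linarith
      then have "L * 1 \<le> L * \<bar>real (idx \<phi>) - real (idx \<psi>)\<bar>" unfolding L_def by (intro mult_left_mono) auto
      also have "\<dots> = \<bar>L * real (idx \<phi>) - L * real (idx \<psi>)\<bar>"
        by (simp add: L_def abs_mult flip: right_diff_distrib)
      finally have "L \<le> \<bar>L * real (idx \<phi>) - L * real (idx \<psi>)\<bar>" by simp
      moreover have "\<bar>snd \<phi> * \<zeta> u\<bar> + rad (Pl \<phi> u) \<le> R" "\<bar>snd \<psi> * \<zeta> v\<bar> + rad (Pl \<psi> v) \<le> R"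
        using R * by (simp_all add: Pl_def)
      ultimately have "rad (Pl \<phi> u) + rad (Pl \<psi> v) < \<bar>yc (Pl \<phi> u) - yc (Pl \<psi> v)\<bar>"
        unfolding L_def Pl_def by simp linarith
      then have "(rad (Pl \<phi> u) + rad (Pl \<psi> v))\<^sup>2 < \<bar>yc (Pl \<phi> u) - yc (Pl \<psi> v)\<bar>\<^sup>2"
        using rad_pos[OF *(1,4)] rad_pos[OF *(2,5)] by (intro power_strict_mono) auto
      then show ?thesis unfolding sqdist_def power2_abs by (smt (verit) zero_le_power2)
    qed
    have injQ: "\<phi> = \<psi> \<and> u = v"
      if *: "\<phi> \<in> \<Phi>" "\<psi> \<in> \<Phi>" "u \<in> C" "v \<in> C" "xc (Pl \<phi> u) = xc (Pl \<psi> v)" "yc (Pl \<phi> u) = yc (Pl \<psi> v)" for \<phi> \<psi> u v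
    proof -
      have 0: "sqdist (Pl \<phi> u) (Pl \<psi> v) = 0" using * by (simp add: sqdist_def)
      have "\<phi> = \<psi>"
      proof (rule ccontr)
        assume "\<phi> \<noteq> \<psi>"
        from sqdist_far[OF *(1,2) this *(3,4)] 0 show False by (smt (verit) zero_le_power2)
      qed
      moreover from this 0 have "(snd \<phi>)\<^sup>2 * sqdist u v = 0" using sq by simp
      then have "sqdist u v = 0" using \<Phi>(2) *(1) by auto
      then have "u = v" using injC[OF *(3,4)] by (auto simp: sqdist_def sum_power2_eq_zero_iff)
      ultimately show ?thesis by blast
    qed
    have "finite Q" unfolding Q_def using \<Phi>(1) finC by blast
    moreover have "inj_on (\<lambda>v. (xc v, yc v)) Q"
    proof (rule inj_onI)
      fix x y assume "x \<in> Q" "y \<in> Q" and eq: "(xc x, yc x) = (xc y, yc y)"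
      then obtain \<phi> u \<psi> v where *: "\<phi> \<in> \<Phi>" "\<psi> \<in> \<Phi>" "u \<in> C" "v \<in> C" "x = Pl \<phi> u" "y = Pl \<psi> v"
        unfolding Q_def by blast
      have "xc (Pl \<phi> u) = xc (Pl \<psi> v)" "yc (Pl \<phi> u) = yc (Pl \<psi> v)" using eq *(5,6) by auto
      from injQ[OF *(1-4) this] show "x = y" using * by simp
    qed
    ultimately obtain a b where ab: "\<forall>s\<in>Xs. s \<noteq> a" "\<forall>v\<in>Q. (xc v - a)\<^sup>2 + (yc v - b)\<^sup>2 \<noteq> (rad v)\<^sup>2"
      and centres: "inj_on (\<lambda>v. (xc v, yc v)) (invert a b ` Q \<union> invert_vertical a ` Xs)"
      and inj: "inj_on (invert a b) Q" "inj_on (invert_vertical a) Xs"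
      and disj: "invert a b ` Q \<inter> invert_vertical a ` Xs = {}"
      using ex_generic_inversion[OF _ Xs, of Q] by blast
    define e where "e \<phi> v = invert a b (Pl \<phi> v)" for \<phi> v
    have inQ: "Pl \<phi> v \<in> Q" if "\<phi> \<in> \<Phi>" "v \<in> C" for \<phi> v using that by (auto simp: Q_def)
    have eQ: "(\<Union>\<phi>\<in>\<Phi>. e \<phi> ` C) = invert a b ` Q" by (auto simp: e_def Q_def)
    have e_eq: "e \<phi> u = e \<psi> v \<Longrightarrow> \<phi> = \<psi> \<and> u = v" if "\<phi> \<in> \<Phi>" "\<psi> \<in> \<Phi>" "u \<in> C" "v \<in> C" for \<phi> \<psi> u v
    proof -
      assume "e \<phi> u = e \<psi> v"
      then have "Pl \<phi> u = Pl \<psi> v" using inj_onD[OF inj(1)] inQ that by (simp add: e_def)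
      then show ?thesis using injQ that by simp
    qed
    have e_rel: "angle_rel \<kappa> (e \<phi> u) (e \<psi> v) \<longleftrightarrow> angle_rel \<kappa> (Pl \<phi> u) (Pl \<psi> v)"
      if "\<phi> \<in> \<Phi>" "\<psi> \<in> \<Phi>" "u \<in> C" "v \<in> C" for \<phi> \<psi> u v
      unfolding e_def using angle_rel_invert ab(2) inQ that by blast
    have "circle_family (invert_vertical a ` Xs \<union> (\<Union>\<phi>\<in>\<Phi>. e \<phi> ` C))"
      unfolding circle_family_def eQ
    proof (intro conjI ballI)
      fix v assume "v \<in> invert_vertical a ` Xs \<union> invert a b ` Q"
      then consider s where "s \<in> Xs" "v = invert_vertical a s" | \<phi> u where "\<phi> \<in> \<Phi>" "u \<in> C" "v = invert a b (Pl \<phi> u)"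
        unfolding Q_def by blast
      then show "0 < rad v"
      proof cases
        case (1 s)
        then show ?thesis using ab(1) by (simp add: invert_vertical_def)
      next
        case (2 \<phi> u)
        then have "(xc (Pl \<phi> u) - a)\<^sup>2 + (yc (Pl \<phi> u) - b)\<^sup>2 \<noteq> (rad (Pl \<phi> u))\<^sup>2" using ab(2) inQ by blast
        then show ?thesis using rad_pos[OF 2(1,2)] 2(3) by (simp add: invert_def Let_def)
      qed
    qed (use centres \<open>finite Q\<close> Xs in \<open>simp_all add: Un_commute\<close>)
    moreover have "attached (circle_rel \<kappa>) C \<tau> B Xs \<Phi> (invert_vertical a) e"
      unfolding attached_def
    proof (intro conjI ballI impI)
      show "inj_on (invert_vertical a) Xs" by (fact inj(2))
      show "\<not> circle_rel \<kappa> (invert_vertical a s) (invert_vertical a t)" if "s \<in> Xs" "t \<in> Xs" for s t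
        using angle_rel_invert_verticals ab(1) that \<kappa>(2) by (auto simp: circle_rel_def)
      show "inj_on (e \<phi>) C" if "\<phi> \<in> \<Phi>" for \<phi> using e_eq that by (meson inj_onI)
      show "circle_rel \<kappa> (e \<phi> u) (e \<phi> v) \<longleftrightarrow> circle_rel \<kappa> u v" if "\<phi> \<in> \<Phi>" "u \<in> C" "v \<in> C" for \<phi> u v
        using e_rel e_eq iso that unfolding circle_rel_def by metis
      show "e \<phi> u \<noteq> e \<psi> v" "\<not> circle_rel \<kappa> (e \<phi> u) (e \<psi> v)"
        if *: "\<phi> \<in> \<Phi>" "\<psi> \<in> \<Phi>" "\<phi> \<noteq> \<psi>" "u \<in> C" "v \<in> C" for \<phi> \<psi> u v
      proof -
        show "e \<phi> u \<noteq> e \<psi> v" using e_eq * by blast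
        have "\<not> angle_rel \<kappa> (Pl \<phi> u) (Pl \<psi> v)"
          using sqdist_far[OF *] angle_rel_sqdist_le[of \<kappa> "Pl \<phi> u" "Pl \<psi> v"] \<kappa>(2) rad_pos * by fastforce
        then show "\<not> circle_rel \<kappa> (e \<phi> u) (e \<psi> v)" using e_rel * by (simp add: circle_rel_def)
      qed
      fix \<phi> v s assume *: "\<phi> \<in> \<Phi>" "v \<in> C" "s \<in> Xs"
      show ne: "e \<phi> v \<noteq> invert_vertical a s" using disj inQ * unfolding e_def by blast
      have d: "snd \<phi> > 0" using \<Phi>(2) *(1) by blast
      have "circle_rel \<kappa> (e \<phi> v) (invert_vertical a s) \<longleftrightarrow> \<bar>xc (Pl \<phi> v) - s\<bar> = rad (Pl \<phi> v) * \<kappa>"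
        using angle_rel_invert_vertical[of "Pl \<phi> v" a b s \<kappa>] ab inQ * ne by (simp add: circle_rel_def e_def)
      also have "\<dots> \<longleftrightarrow> s = xc (Pl \<phi> v) - rad (Pl \<phi> v) * \<kappa> \<or> s = xc (Pl \<phi> v) + rad (Pl \<phi> v) * \<kappa>"
        using mult_nonneg_nonneg[OF less_imp_le[OF rad_pos[OF *(1,2)]] \<kappa>(1)] by linarith
      also have "xc (Pl \<phi> v) - rad (Pl \<phi> v) * \<kappa> = pt \<phi> (\<tau> v)" by (simp add: Pl_def pt_def \<tau>_def algebra_simps)
      also have "xc (Pl \<phi> v) + rad (Pl \<phi> v) * \<kappa> = pt \<phi> (\<beta> v)" by (simp add: Pl_def pt_def \<beta>_def algebra_simps)
      finally have iff: "circle_rel \<kappa> (e \<phi> v) (invert_vertical a s) \<longleftrightarrow> s = pt \<phi> (\<tau> v) \<or> s = pt \<phi> (\<beta> v)" .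
      show "circle_rel \<kappa> (e \<phi> v) (invert_vertical a s)" if "s = pt \<phi> (\<tau> v)" using iff that by blast
      show "s = pt \<phi> (\<tau> v) \<or> s \<in> pt \<phi> ` B" if "circle_rel \<kappa> (e \<phi> v) (invert_vertical a s)"
      \<comment> \<open>By \<open>gen\<close>, a height \<open>\<beta> v\<close> that is also some
        \<open>\<tau> w\<close> can only be \<open>\<tau> v\<close>, the wanted neighbour.\<close>
      proof (cases "\<beta> v \<in> \<tau> ` C")
        case True
        then obtain w where "w \<in> C" "\<beta> v = \<tau> w" by blast
        then have "\<beta> v = \<tau> v" using gen(2) *(2) by metis
        then show ?thesis using iff that by simp
      next
        case False
        then have "\<beta> v \<in> B" using *(2) by (simp add: B_def)
        then show ?thesis using iff that by blast
      qed
    qed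
    ultimately show ?thesis by blast
  qed
  have "finite B" "B \<inter> \<tau> ` C = {}" using finC by (auto simp: B_def)
  with inj\<tau> ext show ?thesis by blast
qed

section \<open>Extension for tangency\<close>

text \<open>Internal tangency of circles with signed radii.\<close>

definition null_rel :: "triple \<Rightarrow> triple \<Rightarrow> bool" where
  "null_rel u v \<longleftrightarrow> sqdist u v = (rad u - rad v)\<^sup>2"

definition tangent_rel :: "triple \<Rightarrow> triple \<Rightarrow> bool" where
  "tangent_rel u v \<longleftrightarrow> u \<noteq> v \<and> null_rel u v"

lemma null_rel_sym: "null_rel u v \<Longrightarrow> null_rel v u"
  by (simp add: null_rel_def sqdist_commute power2_commute)

text \<open>The squared form of the inequation excludes \<open>\<plusminus> sqrt Du \<plusminus> sqrt Dv = \<rho>\<close> for all choices of signs. On a line through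
  the origin whose direction avoids finitely many values, all but finitely many points will do.\<close>

lemma ex_generic_axis:
  assumes fin: "finite C"
  shows "\<exists>a b. \<forall>u\<in>C. \<forall>v\<in>C. (let Du = (xc u - a)\<^sup>2 + (yc u - b)\<^sup>2; Dv = (xc v - a)\<^sup>2 + (yc v - b)\<^sup>2;
     \<rho> = rad u - rad v in Du \<noteq> 0 \<and> (u \<noteq> v \<longrightarrow> (Du - Dv - \<rho>\<^sup>2)\<^sup>2 \<noteq> 4 * \<rho>\<^sup>2 * Dv))"
proof -
  define S where "S = {(u, v) \<in> C \<times> C. xc u \<noteq> xc v \<or> yc u \<noteq> yc v}"
  have finS: "finite S" by (rule finite_subset[of _ "C \<times> C"]) (use fin in \<open>auto simp: S_def\<close>)
  define P where "P = (\<lambda>(u, v). (xc u - xc v, yc u - yc v, rad u - rad v)) ` S \<union>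
    (\<lambda>(u, v). (xc u - xc v, yc u - yc v, rad v - rad u)) ` S"
  have "finite P" unfolding P_def using finS by simp
  moreover have "a \<noteq> 0 \<or> b \<noteq> 0" if "(a, b, q) \<in> P" for a b q
    using that unfolding P_def S_def by (elim UnE imageE) (auto simp: case_prod_beta)
  ultimately obtain m n where mn: "m\<^sup>2 + n\<^sup>2 = 1" and avoid: "\<forall>(a, b, q)\<in>P. a * m + b * n \<noteq> q"
    using ex_unit_vector_avoiding by meson
  \<comment> \<open>This makes the coefficient of \<open>t^2\<close> in \<open>H u v\<close> below
    nonzero. Distinct concentric circles need no condition on the direction, as their radii
    differ.\<close>
  have lead: "(m * (xc u - xc v) + n * (yc u - yc v))\<^sup>2 \<noteq> (rad u - rad v)\<^sup>2" if "u \<in> C" "v \<in> C" "u \<noteq> v" for u v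
  proof (cases "xc u = xc v \<and> yc u = yc v")
    case True
    then have "rad u \<noteq> rad v" using that by (auto simp: prod_eq_iff)
    then show ?thesis using True by simp
  next
    case False
    then have "(u, v) \<in> S" using that by (simp add: S_def)
    then have "(xc u - xc v, yc u - yc v, rad u - rad v) \<in> P" "(xc u - xc v, yc u - yc v, rad v - rad u) \<in> P"
      unfolding P_def by force+
    with avoid have "(xc u - xc v) * m + (yc u - yc v) * n \<noteq> rad u - rad v"
      "(xc u - xc v) * m + (yc u - yc v) * n \<noteq> rad v - rad u" by blast+
    then show ?thesis unfolding power2_eq_iff by (auto simp: mult.commute)
  qed
  define D where "D v = [:(xc v)\<^sup>2 + (yc v)\<^sup>2, - 2 * (m * xc v + n * yc v), 1:]" for v
  \<comment> \<open>The squared distances have the same leading term in \<open>t\<close>, so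
    \<open>G u v\<close> has degree at most 1 and \<open>H u v\<close> degree at most 2.\<close>
  define G where "G u v = D u - D v - [:(rad u - rad v)\<^sup>2:]" for u v
  define H where "H u v = G u v * G u v - smult (4 * (rad u - rad v)\<^sup>2) (D v)" for u v
  have G: "G u v = [:coeff (G u v) 0, - 2 * (m * (xc u - xc v) + n * (yc u - yc v)):]" for u v
    by (simp add: G_def D_def algebra_simps)
  have Hnz: "H u v \<noteq> 0" if "u \<in> C" "v \<in> C" "u \<noteq> v" for u v
  proof
    assume "H u v = 0"
    then have "coeff (H u v) 2 = 0" by simp
    moreover have "coeff (H u v) 2 = 4 * ((m * (xc u - xc v) + n * (yc u - yc v))\<^sup>2 - (rad u - rad v)\<^sup>2)"
      unfolding H_def by (subst (1 2) G) (simp add: D_def numeral_2_eq_2 algebra_simps)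
    ultimately show False using lead that by simp
  qed
  have Dnz: "D v \<noteq> 0" for v by (simp add: D_def)
  define R where "R = D ` C \<union> (\<lambda>(u, v). H u v) ` {(u, v) \<in> C \<times> C. u \<noteq> v}"
  have "finite {(u, v) \<in> C \<times> C. u \<noteq> v}" by (rule finite_subset[of _ "C \<times> C"]) (use fin in auto)
  then have "finite R" unfolding R_def using fin by simp
  moreover have "p \<noteq> 0" if "p \<in> R" for p
    using that Hnz Dnz unfolding R_def by (elim UnE imageE) (simp_all add: case_prod_beta)
  then have "0 \<notin> R" by blast
  ultimately obtain t where t: "\<forall>p\<in>R. poly p t \<noteq> 0" using ex_common_nonroot by blast
  have Dt: "poly (D v) t = (xc v - t * m)\<^sup>2 + (yc v - t * n)\<^sup>2" for v
  proof -
    have "poly (D v) t = (xc v)\<^sup>2 + (yc v)\<^sup>2 - 2 * t * (m * xc v + n * yc v) + t\<^sup>2 * (m\<^sup>2 + n\<^sup>2)"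
      unfolding mn by (simp add: D_def algebra_simps power2_eq_square)
    then show ?thesis by (simp add: power2_diff power_mult_distrib algebra_simps)
  qed
  show ?thesis
  proof (intro exI ballI)
    fix u v assume uv: "u \<in> C" "v \<in> C"
    let ?Du = "(xc u - t * m)\<^sup>2 + (yc u - t * n)\<^sup>2" and ?Dv = "(xc v - t * m)\<^sup>2 + (yc v - t * n)\<^sup>2"
    have "?Du \<noteq> 0" using t uv unfolding R_def Dt[symmetric] by blast
    moreover have "(?Du - ?Dv - (rad u - rad v)\<^sup>2)\<^sup>2 \<noteq> 4 * (rad u - rad v)\<^sup>2 * ?Dv" if "u \<noteq> v"
    proof -
      have "H u v \<in> R" unfolding R_def by (rule UnI2, rule image_eqI[of _ _ "(u, v)"]) (use uv that in simp_all)
      then have "poly (H u v) t \<noteq> 0" using t by blast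
      then show ?thesis by (simp add: H_def G_def Dt power2_eq_square)
    qed
    ultimately show "let Du = ?Du; Dv = ?Dv; \<rho> = rad u - rad v
        in Du \<noteq> 0 \<and> (u \<noteq> v \<longrightarrow> (Du - Dv - \<rho>\<^sup>2)\<^sup>2 \<noteq> 4 * \<rho>\<^sup>2 * Dv)" by (simp add: Let_def)
  qed
qed

text \<open>\<open>w\<close> stands for a complex number of modulus 1: a rotation about
  \<open>(a, b)\<close>, followed by the homothety, with \<open>(a, b)\<close> moved to the
  origin.\<close>

definition spin :: "real \<times> real \<Rightarrow> real \<Rightarrow> real \<Rightarrow> real \<times> real \<Rightarrow> triple \<Rightarrow> triple" where
  "spin w a b \<phi> v = (snd \<phi> * (fst w * (xc v - a) - snd w * (yc v - b)),
     snd \<phi> * (fst w * (yc v - b) + snd w * (xc v - a)), pt \<phi> (rad v))"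

text \<open>Rotations about the common centre replace the translations along the lines, since they
  preserve tangency to the concentric circles. Contact between two copies is a linear equation in
  the unit vector of the rotation, so the copies can be placed one after another.\<close>

lemma ex_generic_spins:
  assumes \<Phi>: "finite \<Phi>" "\<And>\<phi>. \<phi> \<in> \<Phi> \<Longrightarrow> 0 < snd \<phi>" and fin: "finite C"
    and nz: "\<And>v. v \<in> C \<Longrightarrow> (xc v - a)\<^sup>2 + (yc v - b)\<^sup>2 \<noteq> 0"
  shows "\<exists>w. (\<forall>\<phi>\<in>\<Phi>. (fst (w \<phi>))\<^sup>2 + (snd (w \<phi>))\<^sup>2 = 1) \<and>
    (\<forall>\<phi>\<in>\<Phi>. \<forall>\<psi>\<in>\<Phi>. \<phi> \<noteq> \<psi> \<longrightarrow> (\<forall>u\<in>C. \<forall>v\<in>C. \<not> null_rel (spin (w \<phi>) a b \<phi> u) (spin (w \<psi>) a b \<psi> v)))"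
  using \<Phi>
proof (induction \<Phi> rule: finite_induct)
  case (insert \<eta> \<Phi>)
  obtain w where unit: "\<And>\<phi>. \<phi> \<in> \<Phi> \<Longrightarrow> (fst (w \<phi>))\<^sup>2 + (snd (w \<phi>))\<^sup>2 = 1"
    and far: "\<And>\<phi> \<psi> u v. \<phi> \<in> \<Phi> \<Longrightarrow> \<psi> \<in> \<Phi> \<Longrightarrow> \<phi> \<noteq> \<psi> \<Longrightarrow> u \<in> C \<Longrightarrow> v \<in> C \<Longrightarrow>
      \<not> null_rel (spin (w \<phi>) a b \<phi> u) (spin (w \<psi>) a b \<psi> v)"
    using insert.IH[OF insert.prems[OF insertI2]] by blast
  define c where "c \<psi> v = spin (w \<psi>) a b \<psi> v" for \<psi> v
  define X Y where "X u = xc u - a" and "Y u = yc u - b" for u :: triple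
  \<comment> \<open>The coefficients of the equation
    \<open>\<alpha> * m + \<beta> * n = \<gamma>\<close> that expresses contact of \<open>u\<close>,
    in the new copy turned by \<open>(m, n)\<close>, with \<open>c \<psi> v\<close>.\<close>
  define q where "q = (\<lambda>(\<psi>, u, v). (X u * xc (c \<psi> v) + Y u * yc (c \<psi> v), X u * yc (c \<psi> v) - Y u * xc (c \<psi> v),
     ((snd \<eta>)\<^sup>2 * ((X u)\<^sup>2 + (Y u)\<^sup>2) + (xc (c \<psi> v))\<^sup>2 + (yc (c \<psi> v))\<^sup>2 - (pt \<eta> (rad u) - rad (c \<psi> v))\<^sup>2) / (2 * snd \<eta>)))"
  have c_sq: "(xc (c \<psi> v))\<^sup>2 + (yc (c \<psi> v))\<^sup>2 = (snd \<psi>)\<^sup>2 * ((X v)\<^sup>2 + (Y v)\<^sup>2)" if "\<psi> \<in> \<Phi>" for \<psi> v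
  proof -
    have "(xc (c \<psi> v))\<^sup>2 + (yc (c \<psi> v))\<^sup>2 = (snd \<psi>)\<^sup>2 * ((X v)\<^sup>2 + (Y v)\<^sup>2) * ((fst (w \<psi>))\<^sup>2 + (snd (w \<psi>))\<^sup>2)"
      unfolding c_def spin_def X_def Y_def fst_conv snd_conv by algebra
    then show ?thesis using unit[OF that] by simp
  qed
  have "finite (q ` (\<Phi> \<times> C \<times> C))" using insert.hyps fin by simp
  moreover have "\<alpha> \<noteq> 0 \<or> \<beta> \<noteq> 0" if "(\<alpha>, \<beta>, \<gamma>) \<in> q ` (\<Phi> \<times> C \<times> C)" for \<alpha> \<beta> \<gamma>
  proof -
    from that obtain \<psi> u v where *: "\<psi> \<in> \<Phi>" "u \<in> C" "v \<in> C"
      and \<alpha>: "\<alpha> = X u * xc (c \<psi> v) + Y u * yc (c \<psi> v)" and \<beta>: "\<beta> = X u * yc (c \<psi> v) - Y u * xc (c \<psi> v)"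
      by (auto simp: q_def)
    have "\<alpha>\<^sup>2 + \<beta>\<^sup>2 = ((X u)\<^sup>2 + (Y u)\<^sup>2) * ((xc (c \<psi> v))\<^sup>2 + (yc (c \<psi> v))\<^sup>2)" unfolding \<alpha> \<beta> by algebra
    \<comment> \<open>Both factors are nonzero because no circle of \<open>C\<close> is centred at
      \<open>(a, b)\<close>.\<close>
    also have "\<dots> \<noteq> 0" using nz[OF *(2)] nz[OF *(3)] insert.prems[of \<psi>] *(1) by (simp add: c_sq[OF *(1)] X_def Y_def)
    finally show ?thesis by auto
  qed
  ultimately obtain m n where mn: "m\<^sup>2 + n\<^sup>2 = 1" and avoid: "\<forall>(\<alpha>, \<beta>, \<gamma>)\<in>q ` (\<Phi> \<times> C \<times> C). \<alpha> * m + \<beta> * n \<noteq> \<gamma>"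
    using ex_unit_vector_avoiding by meson
  have new: "\<not> null_rel (spin (m, n) a b \<eta> u) (c \<psi> v)" if *: "\<psi> \<in> \<Phi>" "u \<in> C" "v \<in> C" for \<psi> u v
  proof
    assume "null_rel (spin (m, n) a b \<eta> u) (c \<psi> v)"
    then have eq: "(snd \<eta> * (m * X u - n * Y u) - xc (c \<psi> v))\<^sup>2 + (snd \<eta> * (m * Y u + n * X u) - yc (c \<psi> v))\<^sup>2
        = (pt \<eta> (rad u) - rad (c \<psi> v))\<^sup>2"
      by (simp add: null_rel_def sqdist_def spin_def X_def Y_def)
    define \<alpha> \<beta> where "\<alpha> = X u * xc (c \<psi> v) + Y u * yc (c \<psi> v)" and "\<beta> = X u * yc (c \<psi> v) - Y u * xc (c \<psi> v)"
    have "(snd \<eta> * (m * X u - n * Y u) - xc (c \<psi> v))\<^sup>2 + (snd \<eta> * (m * Y u + n * X u) - yc (c \<psi> v))\<^sup>2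
      = (m\<^sup>2 + n\<^sup>2) * (snd \<eta>)\<^sup>2 * ((X u)\<^sup>2 + (Y u)\<^sup>2) + (xc (c \<psi> v))\<^sup>2 + (yc (c \<psi> v))\<^sup>2 - 2 * snd \<eta> * (\<alpha> * m + \<beta> * n)"
      unfolding \<alpha>_def \<beta>_def by algebra
    with eq mn have "2 * snd \<eta> * (\<alpha> * m + \<beta> * n) =
       (snd \<eta>)\<^sup>2 * ((X u)\<^sup>2 + (Y u)\<^sup>2) + (xc (c \<psi> v))\<^sup>2 + (yc (c \<psi> v))\<^sup>2 - (pt \<eta> (rad u) - rad (c \<psi> v))\<^sup>2" by simp
    moreover have "snd \<eta> > 0" using insert.prems by blast
    ultimately have "\<alpha> * m + \<beta> * n = ((snd \<eta>)\<^sup>2 * ((X u)\<^sup>2 + (Y u)\<^sup>2) + (xc (c \<psi> v))\<^sup>2 + (yc (c \<psi> v))\<^sup>2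
       - (pt \<eta> (rad u) - rad (c \<psi> v))\<^sup>2) / (2 * snd \<eta>)" by (simp add: field_simps)
    moreover have "q (\<psi>, u, v) \<in> q ` (\<Phi> \<times> C \<times> C)" using * by blast
    ultimately show False using bspec[OF avoid, of "q (\<psi>, u, v)"] by (simp add: q_def \<alpha>_def \<beta>_def)
  qed
  define w' where "w' = w(\<eta> := (m, n))"
  have w': "w' \<eta> = (m, n)" "\<And>\<phi>. \<phi> \<in> \<Phi> \<Longrightarrow> w' \<phi> = w \<phi>" using insert.hyps(2) by (auto simp: w'_def)
  show ?case
  proof (intro exI[of _ w'] conjI ballI impI)
    fix \<phi> assume "\<phi> \<in> insert \<eta> \<Phi>"
    then show "(fst (w' \<phi>))\<^sup>2 + (snd (w' \<phi>))\<^sup>2 = 1"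
    proof
      assume "\<phi> = \<eta>" then show ?thesis using mn w'(1) by simp
    next
      assume "\<phi> \<in> \<Phi>" then show ?thesis using unit w'(2) by simp
    qed
  next
    fix \<phi> \<psi> u v assume *: "\<phi> \<in> insert \<eta> \<Phi>" "\<psi> \<in> insert \<eta> \<Phi>" "\<phi> \<noteq> \<psi>" "u \<in> C" "v \<in> C"
    then consider "\<phi> = \<eta>" "\<psi> \<in> \<Phi>" | "\<psi> = \<eta>" "\<phi> \<in> \<Phi>" | "\<phi> \<in> \<Phi>" "\<psi> \<in> \<Phi>" by blast
    then show "\<not> null_rel (spin (w' \<phi>) a b \<phi> u) (spin (w' \<psi>) a b \<psi> v)"
    proof cases
      case 1 then show ?thesis using new * w' by (simp add: c_def)
    next
      case 2
      then have "\<not> null_rel (spin (w' \<psi>) a b \<psi> v) (spin (w' \<phi>) a b \<phi> u)"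
        using new[of \<phi> v u] * w' by (simp add: c_def)
      then show ?thesis using null_rel_sym by blast
    next
      case 3 then show ?thesis using far * w' by simp
    qed
  qed
qed simp

text \<open>Here the parallel lines are replaced by concentric circles, the common centre \<open>(a, b)\<close> being
  moved to the origin; the circle \<open>v\<close> touches those of radius \<open>rad v \<plusminus> D v\<close>.\<close>

lemma tangent_family_extend:
  assumes finC: "finite C"
  shows "\<exists>\<tau> B. finite B \<and> inj_on \<tau> C \<and> B \<inter> \<tau> ` C = {} \<and>
      (\<forall>Xs \<Phi>. finite Xs \<longrightarrow> finite \<Phi> \<longrightarrow> (\<forall>\<phi>\<in>\<Phi>. 0 < snd \<phi>) \<longrightarrow>
        (\<exists>X e. finite (X ` Xs \<union> (\<Union>\<phi>\<in>\<Phi>. e \<phi> ` C)) \<and> attached tangent_rel C \<tau> B Xs \<Phi> X e))"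
proof -
  define sq where "sq a b v = (xc v - a)\<^sup>2 + (yc v - b)\<^sup>2" for a b and v :: triple
  obtain a b where sqnz: "\<And>v. v \<in> C \<Longrightarrow> sq a b v \<noteq> 0"
    and gen: "\<And>u v. u \<in> C \<Longrightarrow> v \<in> C \<Longrightarrow> u \<noteq> v \<Longrightarrow>
      (sq a b u - sq a b v - (rad u - rad v)\<^sup>2)\<^sup>2 \<noteq> 4 * (rad u - rad v)\<^sup>2 * sq a b v"
    using ex_generic_axis[OF finC] unfolding Let_def sq_def by metis
  define D where "D v = sqrt (sq a b v)" for v
  have D2: "(D v)\<^sup>2 = sq a b v" for v by (simp add: D_def sq_def)
  have D: "0 < D v" if "v \<in> C" for v using sqnz[OF that] by (simp add: D_def sq_def sum_power2_gt_zero_iff)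
  define \<tau> where "\<tau> v = rad v - D v" for v
  define \<beta> where "\<beta> v = rad v + D v" for v
  have gen': "\<tau> u \<noteq> \<tau> v" "\<beta> u \<noteq> \<tau> v" if uv: "u \<in> C" "v \<in> C" "u \<noteq> v" for u v
  proof -
    define \<rho> where "\<rho> = rad u - rad v"
    have ne: "((D u)\<^sup>2 - (D v)\<^sup>2 - \<rho>\<^sup>2)\<^sup>2 \<noteq> 4 * \<rho>\<^sup>2 * (D v)\<^sup>2" using gen[OF uv] by (simp add: D2 \<rho>_def)
    show "\<tau> u \<noteq> \<tau> v"
    proof
      assume "\<tau> u = \<tau> v"
      then have "D u = D v + \<rho>" by (simp add: \<tau>_def \<rho>_def)
      then show False using ne by algebra
    qed
    show "\<beta> u \<noteq> \<tau> v"
    proof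
      assume "\<beta> u = \<tau> v"
      then have "D u = - D v - \<rho>" by (simp add: \<tau>_def \<beta>_def \<rho>_def)
      then show False using ne by algebra
    qed
  qed
  have inj\<tau>: "inj_on \<tau> C" using gen'(1) by (meson inj_onI)
  \<comment> \<open>In contrast to orthogonality, the two values of one circle always differ, by
    \<open>2 * D v > 0\<close>.\<close>
  have disj: "\<beta> ` C \<inter> \<tau> ` C = {}"
  proof -
    have "\<beta> u \<noteq> \<tau> v" if "u \<in> C" "v \<in> C" for u v
      using gen'(2)[OF that] D[OF that(1)] by (cases "u = v") (auto simp: \<beta>_def \<tau>_def)
    then show ?thesis by blast
  qed
  have ext: "\<exists>X e. finite (X ` Xs \<union> (\<Union>\<phi>\<in>\<Phi>. e \<phi> ` C)) \<and> attached tangent_rel C \<tau> (\<beta> ` C) Xs \<Phi> X e"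
    if Xs: "finite Xs" and \<Phi>: "finite \<Phi>" "\<forall>\<phi>\<in>\<Phi>. 0 < snd \<phi>" for Xs and \<Phi> :: "(real \<times> real) set"
  proof -
    obtain w where unit: "\<And>\<phi>. \<phi> \<in> \<Phi> \<Longrightarrow> (fst (w \<phi>))\<^sup>2 + (snd (w \<phi>))\<^sup>2 = 1"
      and far: "\<And>\<phi> \<psi> u v. \<phi> \<in> \<Phi> \<Longrightarrow> \<psi> \<in> \<Phi> \<Longrightarrow> \<phi> \<noteq> \<psi> \<Longrightarrow> u \<in> C \<Longrightarrow> v \<in> C \<Longrightarrow>
        \<not> null_rel (spin (w \<phi>) a b \<phi> u) (spin (w \<psi>) a b \<psi> v)"
      using ex_generic_spins[OF \<Phi>(1) _ finC, of a b] \<Phi>(2) sqnz unfolding sq_def by metis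
    define e where "e \<phi> = spin (w \<phi>) a b \<phi>" for \<phi>
    define X where "X s = (0::real, 0::real, s)" for s :: real
    have sqd: "sqdist (e \<phi> u) (e \<phi> v) = (snd \<phi>)\<^sup>2 * sqdist u v" if "\<phi> \<in> \<Phi>" for \<phi> u v
    proof -
      have "sqdist (e \<phi> u) (e \<phi> v) = (snd \<phi>)\<^sup>2 * sqdist u v * ((fst (w \<phi>))\<^sup>2 + (snd (w \<phi>))\<^sup>2)"
        unfolding e_def spin_def sqdist_def fst_conv snd_conv by algebra
      then show ?thesis using unit[OF that] by simp
    qed
    have rd: "(rad (e \<phi> u) - rad (e \<phi> v))\<^sup>2 = (snd \<phi>)\<^sup>2 * (rad u - rad v)\<^sup>2" for \<phi> u v
      by (simp add: e_def spin_def pt_def flip: power_mult_distrib) (simp add: algebra_simps)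
    have e_inj: "u = v" if "\<phi> \<in> \<Phi>" "e \<phi> u = e \<phi> v" for \<phi> u v
    proof -
      have "snd \<phi> \<noteq> 0" using \<Phi>(2) that(1) by auto
      then have "sqdist u v = 0" "(rad u - rad v)\<^sup>2 = 0"
        using sqd[OF that(1), of u v] rd[of \<phi> u v] that(2) by (auto simp: sqdist_def)
      then show ?thesis by (simp add: sqdist_def sum_power2_eq_zero_iff prod_eq_iff)
    qed
    have iso: "null_rel (e \<phi> u) (e \<phi> v) \<longleftrightarrow> null_rel u v" if "\<phi> \<in> \<Phi>" for \<phi> u v
      using \<Phi>(2) that by (auto simp: null_rel_def sqd[OF that] rd)
    have "attached tangent_rel C \<tau> (\<beta> ` C) Xs \<Phi> X e"
      unfolding attached_def
    proof (intro conjI ballI impI)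
      show "inj_on X Xs" by (auto simp: X_def inj_on_def)
      \<comment> \<open>Concentric circles satisfy \<open>null_rel\<close> only if their signed
        radii are equal, and then they are the same triple.\<close>
      show "\<not> tangent_rel (X s) (X t)" for s t by (auto simp: tangent_rel_def null_rel_def sqdist_def X_def)
      show "inj_on (e \<phi>) C" if "\<phi> \<in> \<Phi>" for \<phi> using e_inj that by (meson inj_onI)
      show "tangent_rel (e \<phi> u) (e \<phi> v) \<longleftrightarrow> tangent_rel u v" if "\<phi> \<in> \<Phi>" for \<phi> u v
        unfolding tangent_rel_def using e_inj[OF that] iso[OF that] by metis
      show "e \<phi> u \<noteq> e \<psi> v" "\<not> tangent_rel (e \<phi> u) (e \<psi> v)"
        if "\<phi> \<in> \<Phi>" "\<psi> \<in> \<Phi>" "\<phi> \<noteq> \<psi>" "u \<in> C" "v \<in> C" for \<phi> \<psi> u v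
      proof -
        have "\<not> null_rel (e \<phi> u) (e \<psi> v)" using far that by (simp add: e_def)
        moreover from this show "e \<phi> u \<noteq> e \<psi> v" by (auto simp: null_rel_def sqdist_def)
        ultimately show "\<not> tangent_rel (e \<phi> u) (e \<psi> v)" by (simp add: tangent_rel_def)
      qed
      fix \<phi> v s assume *: "\<phi> \<in> \<Phi>" "v \<in> C" "s \<in> Xs"
      have d: "snd \<phi> > 0" using \<Phi>(2) *(1) by blast
      \<comment> \<open>The distance from the common centre is only scaled, by
        \<open>snd \<phi>\<close>; hence tangency means
        \<open>s = pt \<phi> (rad v) \<plusminus> snd \<phi> * D v\<close>.\<close>
      have "sqdist (e \<phi> v) (X s) = (snd \<phi>)\<^sup>2 * sq a b v * ((fst (w \<phi>))\<^sup>2 + (snd (w \<phi>))\<^sup>2)"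
        unfolding e_def spin_def sqdist_def X_def sq_def fst_conv snd_conv by algebra
      then have sqX: "sqdist (e \<phi> v) (X s) = (snd \<phi> * D v)\<^sup>2"
        using unit[OF *(1)] by (simp add: D2 power_mult_distrib)
      have "0 < (snd \<phi> * D v)\<^sup>2" using d D[OF *(2)] by simp
      then have ne: "sqdist (e \<phi> v) (X s) \<noteq> 0" using sqX by simp
      then show ne': "e \<phi> v \<noteq> X s" by (auto simp: sqdist_def)
      have "tangent_rel (e \<phi> v) (X s) \<longleftrightarrow> (snd \<phi> * D v)\<^sup>2 = (pt \<phi> (rad v) - s)\<^sup>2"
        using ne' sqX by (simp add: tangent_rel_def null_rel_def) (simp add: e_def spin_def X_def)
      also have "\<dots> \<longleftrightarrow> s = pt \<phi> (\<tau> v) \<or> s = pt \<phi> (\<beta> v)"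
        unfolding power2_eq_iff by (auto simp: pt_def \<tau>_def \<beta>_def algebra_simps)
      finally have iff: "tangent_rel (e \<phi> v) (X s) \<longleftrightarrow> s = pt \<phi> (\<tau> v) \<or> s = pt \<phi> (\<beta> v)" .
      show "tangent_rel (e \<phi> v) (X s)" if "s = pt \<phi> (\<tau> v)" using iff that by blast
      show "s = pt \<phi> (\<tau> v) \<or> s \<in> pt \<phi> ` \<beta> ` C" if "tangent_rel (e \<phi> v) (X s)" using iff that *(2) by blast
    qed
    moreover have "finite (X ` Xs \<union> (\<Union>\<phi>\<in>\<Phi>. e \<phi> ` C))" using Xs \<Phi>(1) finC by blast
    ultimately show ?thesis by blast
  qed
  have "finite (\<beta> ` C)" using finC by simp
  with inj\<tau> disj ext show ?thesis by blast
qed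

section \<open>Circles in the plane\<close>

text \<open>If the centres differed, the two points of the first sphere on the line of centres would
  be at different distances from \<open>d\<close>.\<close>

lemma sphere_inj:
  fixes c d :: "'a::euclidean_space"
  assumes eq: "sphere c r = sphere d s" and r: "0 < r"
  shows "c = d \<and> r = s"
proof -
  have "c = d"
  proof (rule ccontr)
    assume ne: "c \<noteq> d"
    define v where "v = (r / norm (c - d)) *\<^sub>R (c - d)"
    have nv: "norm v = r" using ne r by (simp add: v_def)
    have "c + v \<in> sphere c r" "c - v \<in> sphere c r" using nv by (simp_all add: dist_norm)
    then have "norm ((c + v) - d) = s" "norm ((c - v) - d) = s"
      unfolding eq by (simp_all add: dist_commute flip: dist_norm)
    moreover have "(c + v) - d = (c - d) + v" "(c - v) - d = (c - d) - v" by simp_all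
    ultimately have "((c - d) + v) \<bullet> ((c - d) + v) = ((c - d) - v) \<bullet> ((c - d) - v)"
      by (simp flip: power2_norm_eq_inner)
    then have "(c - d) \<bullet> v = 0" by (simp add: inner_add_left inner_add_right inner_diff_left inner_diff_right inner_commute)
    then have "r * norm (c - d) = 0" using ne by (simp add: v_def power2_norm_eq_inner[symmetric] power2_eq_square)
    then show False using r ne by simp
  qed
  moreover from r have "sphere c r \<noteq> {}" by simp
  then obtain p where "p \<in> sphere c r" by blast
  ultimately show ?thesis using eq by auto
qed

definition circ :: "triple \<Rightarrow> (real^2) set" where
  "circ v = sphere (vector [xc v, yc v]) (rad v)"

lemma circ_inj:
  assumes "circ u = circ v" "0 < rad u"
  shows "u = v"
proof -
  from sphere_inj[OF assms(1)[unfolded circ_def] assms(2)]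
  have "(vector [xc u, yc u] :: real^2) = vector [xc v, yc v]" "rad u = rad v" by auto
  then have "(vector [xc u, yc u] :: real^2) $ 1 = (vector [xc v, yc v] :: real^2) $ 1"
    "(vector [xc u, yc u] :: real^2) $ 2 = (vector [xc v, yc v] :: real^2) $ 2" by simp_all
  with \<open>rad u = rad v\<close> show ?thesis by (simp add: prod_eq_iff)
qed

text \<open>The hypothesis is the triangle inequality for \<open>r\<close>, \<open>s\<close> and the
  distance of the centres. In the proof \<open>a\<close> and \<open>h\<close> are the coordinates of
  a common point along and across the line of centres.\<close>

lemma spheres_meet:
  fixes c d :: "real^2"
  assumes r: "0 < r" "0 < s" and le: "\<bar>r\<^sup>2 + s\<^sup>2 - (norm (c - d))\<^sup>2\<bar> \<le> 2 * r * s"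
  shows "sphere c r \<inter> sphere d s \<noteq> {}"
proof (cases "c = d")
  case True
  then have "(r - s)\<^sup>2 \<le> 0" using le by (simp add: power2_diff)
  then have "r = s" by simp
  then show ?thesis using True r by simp
next
  case False
  define l where "l = norm (c - d)"
  have l: "l > 0" using False by (simp add: l_def)
  define a where "a = (l\<^sup>2 + r\<^sup>2 - s\<^sup>2) / (2 * l)"
  have a: "2 * l * a = l\<^sup>2 + r\<^sup>2 - s\<^sup>2" using l by (simp add: a_def)
  have "(2 * l * a)\<^sup>2 \<le> (2 * l * r)\<^sup>2"
  proof -
    \<comment> \<open>Both sides are 16 times Heron's expression for the squared area of a triangle
      with sides \<open>l\<close>, \<open>r\<close>, \<open>s\<close>.\<close>
    have "(2 * l * r)\<^sup>2 - (2 * l * a)\<^sup>2 = (2 * r * s)\<^sup>2 - (r\<^sup>2 + s\<^sup>2 - l\<^sup>2)\<^sup>2" unfolding a by algebra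
    moreover have "(r\<^sup>2 + s\<^sup>2 - l\<^sup>2)\<^sup>2 \<le> (2 * r * s)\<^sup>2"
      using power_mono[OF le, of 2] by (simp add: l_def)
    ultimately show ?thesis by simp
  qed
  then have "(2 * l)\<^sup>2 * a\<^sup>2 \<le> (2 * l)\<^sup>2 * r\<^sup>2" by (simp only: power_mult_distrib)
  then have ar: "a\<^sup>2 \<le> r\<^sup>2" using l by (simp add: mult_le_cancel_left_pos)
  define h where "h = sqrt (r\<^sup>2 - a\<^sup>2)"
  have h: "h\<^sup>2 = r\<^sup>2 - a\<^sup>2" using ar by (simp add: h_def)
  define u where "u = (1 / l) *\<^sub>R (d - c)"
  have uu: "u \<bullet> u = 1" using l by (simp add: u_def power2_norm_eq_inner[symmetric] norm_minus_commute[of d] l_def power2_eq_square)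
  have dc: "d - c = l *\<^sub>R u" using l by (simp add: u_def)
  define p where "p = c + (a *\<^sub>R u + h *\<^sub>R rot90 u)"
  have orth: "rot90 u \<bullet> u = 0" "u \<bullet> rot90 u = 0" "rot90 u \<bullet> rot90 u = 1"
    using rot90_props[of u] rot90_props(2)[of u u] uu by (simp_all add: inner_commute)
  have sqn: "(norm (x *\<^sub>R u + y *\<^sub>R rot90 u))\<^sup>2 = x\<^sup>2 + y\<^sup>2" for x y
    unfolding power2_norm_eq_inner
    by (simp add: inner_add_left inner_add_right orth uu power2_eq_square)
  then have "(norm (p - c))\<^sup>2 = a\<^sup>2 + h\<^sup>2" by (simp add: p_def)
  then have "(norm (p - c))\<^sup>2 = r\<^sup>2" by (simp add: h)
  then have "norm (p - c) = r" using r by (simp add: power2_eq_iff_nonneg)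
  moreover have "p - d = (a - l) *\<^sub>R u + h *\<^sub>R rot90 u"
    using dc by (simp add: p_def algebra_simps)
  then have "(norm (p - d))\<^sup>2 = (a - l)\<^sup>2 + h\<^sup>2"
    by (simp add: sqn)
  then have "(norm (p - d))\<^sup>2 = s\<^sup>2" using a by (simp add: h power2_diff algebra_simps)
  then have "norm (p - d) = s" using r by (simp add: power2_eq_iff_nonneg)
  ultimately have "p \<in> sphere c r \<inter> sphere d s" by (simp add: dist_norm norm_minus_commute)
  then show ?thesis by blast
qed

text \<open>The inner product of the radius vectors is the same at every common point, so the
  quantifier over points collapses; \<open>cos \<theta> \<le> 1\<close> ensures that a common point
  exists.\<close>

lemma intersect_at_angle_circ:
  assumes r: "0 < rad u" "0 < rad v" and \<theta>: "0 \<le> \<theta>" "\<theta> \<le> pi / 2"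
  shows "intersect_at_angle \<theta> (circ u) (circ v) \<longleftrightarrow> angle_rel (cos \<theta>) u v"
proof -
  define c d :: "real^2" where "c = vector [xc u, yc u]" and "d = vector [xc v, yc v]"
  have sq: "sqdist u v = (norm (c - d))\<^sup>2"
    by (simp add: c_def d_def sqdist_def sum_sq_vec2)
  have inner: "2 * ((p - c) \<bullet> (p - d)) = (rad u)\<^sup>2 + (rad v)\<^sup>2 - sqdist u v" if "p \<in> circ u \<inter> circ v" for p
  proof -
    have "norm (p - c) = rad u" "norm (p - d) = rad v"
      using that by (auto simp: circ_def c_def d_def dist_norm norm_minus_commute)
    then have "(rad u)\<^sup>2 = (p - c) \<bullet> (p - c)" "(rad v)\<^sup>2 = (p - d) \<bullet> (p - d)"
      by (simp_all flip: power2_norm_eq_inner)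
    moreover have "sqdist u v = ((p - d) - (p - c)) \<bullet> ((p - d) - (p - c))" by (simp add: sq power2_norm_eq_inner)
    ultimately show ?thesis by (simp add: inner_diff_left inner_diff_right inner_commute)
  qed
  have "intersect_at_angle \<theta> (circ u) (circ v) \<longleftrightarrow> circ u \<inter> circ v \<noteq> {} \<and>
      (\<forall>p\<in>circ u \<inter> circ v. \<bar>(p - c) \<bullet> (p - d)\<bar> = rad u * rad v * cos \<theta>)"
    unfolding circ_def c_def d_def by (rule intersect_at_angle_sphere[OF r \<theta>])
  also have "\<dots> \<longleftrightarrow> circ u \<inter> circ v \<noteq> {} \<and> (\<forall>p\<in>circ u \<inter> circ v. angle_rel (cos \<theta>) u v)"
  proof -
    have "\<bar>(p - c) \<bullet> (p - d)\<bar> = rad u * rad v * cos \<theta> \<longleftrightarrow> angle_rel (cos \<theta>) u v" if "p \<in> circ u \<inter> circ v" for p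
      unfolding angle_rel_def inner[OF that, symmetric] by (auto simp: abs_mult)
    then show ?thesis by blast
  qed
  also have "\<dots> \<longleftrightarrow> angle_rel (cos \<theta>) u v"
  proof -
    have "circ u \<inter> circ v \<noteq> {}" if "angle_rel (cos \<theta>) u v"
    proof -
      have "2 * rad u * rad v * cos \<theta> \<le> 2 * rad u * rad v" using r by (simp add: mult_left_le)
      then show ?thesis
        using that r unfolding circ_def by (intro spheres_meet) (simp_all add: angle_rel_def sq c_def d_def)
    qed
    then show ?thesis by blast
  qed
  finally show ?thesis .
qed

section \<open>Transfer to the \<open>\<theta>\<close>-graph\<close>

lemma card_edges_in_cycle:
  assumes len: "3 \<le> length ws" and dist: "distinct ws" and ws: "set ws \<subseteq> S" and fin: "finite S"
    and E: "\<And>i. i < length ws \<Longrightarrow> E (ws ! i) (ws ! (Suc i mod length ws)) \<and> E (ws ! (Suc i mod length ws)) (ws ! i)"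
  shows "2 * length ws \<le> card (edges_in E S)"
proof -
  define m where "m = length ws"
  define nx where "nx i = Suc i mod m" for i
  have m: "3 \<le> m" using len by (simp add: m_def)
  have nx: "nx i < m" for i using m by (simp add: nx_def)
  have inj: "ws ! i = ws ! j \<longleftrightarrow> i = j" if "i < m" "j < m" for i j
    using nth_eq_iff_index_eq[OF dist] that by (simp add: m_def)
  let ?A = "(\<lambda>i. (ws ! i, ws ! nx i)) ` {..<m}" and ?B = "(\<lambda>i. (ws ! nx i, ws ! i)) ` {..<m}"
  have "card ?A = m" using inj by (subst card_image) (auto intro!: inj_onI)
  moreover have "card ?B = m" using inj by (subst card_image) (auto intro!: inj_onI)
  moreover have "?A \<inter> ?B = {}"
  proof (rule ccontr)
    assume "?A \<inter> ?B \<noteq> {}"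
    then obtain i j where ij: "i < m" "j < m" "ws ! i = ws ! nx j" "ws ! nx i = ws ! j" by auto
    then have *: "i = nx j" "j = nx i" using inj nx by simp_all
    have nxD: "(Suc l = m \<and> nx l = 0) \<or> nx l = Suc l" if "l < m" for l
      using that by (cases "Suc l = m") (simp_all add: nx_def)
    \<comment> \<open>A pair in both families would give \<open>i = nx (nx i)\<close>, impossible
      for \<open>m \<ge> 3\<close>.\<close>
    show False using nxD[OF ij(1)] nxD[OF ij(2)] m unfolding *[symmetric] by linarith
  qed
  ultimately have "2 * m = card (?A \<union> ?B)" by (subst card_Un_disjoint) auto
  also have "\<dots> \<le> card (edges_in E S)"
  proof (intro card_mono finite_edges_in fin)
    have "ws ! i \<in> S" if "i < m" for i using ws that by (auto simp: m_def)
    then show "?A \<union> ?B \<subseteq> edges_in E S" using E nx by (auto simp: edges_in_def nx_def m_def)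
  qed
  finally show ?thesis by (simp add: m_def)
qed

text \<open>\<open>f\<close> turns vertices into circles: the identity for positive angles, a common
  shift of the radii for tangency. A cycle of length \<open>m < g\<close> would have
  \<open>2 * m\<close> ordered edges on its own vertex set, where \<open>local_forest\<close> allows
  \<open>2 * m - 2\<close>.\<close>

lemma theta_graph_of_family:
  assumes \<theta>: "0 \<le> \<theta>" "\<theta> \<le> pi / 2"
    and fin: "finite V" and forest: "local_forest g E V" and unc: "uncolourable k E V"
    and inj: "inj_on f V" and rad: "\<And>v. v \<in> V \<Longrightarrow> 0 < rad (f v)"
    and E: "\<And>u v. u \<in> V \<Longrightarrow> v \<in> V \<Longrightarrow> E u v \<longleftrightarrow> u \<noteq> v \<and> angle_rel (cos \<theta>) (f u) (f v)"
  shows "\<exists>\<C> :: (real^2) set set. (\<forall>C\<in>\<C>. is_circle C) \<and>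
    girth (theta_graph \<theta> \<C>) \<ge> enat g \<and> chromatic_number (theta_graph \<theta> \<C>) \<ge> enat k"
proof -
  define h where "h v = circ (f v)" for v
  have h_inj: "u = v" if "u \<in> V" "v \<in> V" "h u = h v" for u v
    using circ_inj[of "f u" "f v"] rad that inj by (auto simp: h_def dest: inj_onD)
  have edge: "{h u, h v} \<in> snd (theta_graph \<theta> (h ` V)) \<longleftrightarrow> E u v" if uv: "u \<in> V" "v \<in> V" for u v
  proof
    assume "{h u, h v} \<in> snd (theta_graph \<theta> (h ` V))"
    then obtain C D where CD: "{h u, h v} = {C, D}" "C \<noteq> D" "intersect_at_angle \<theta> C D"
      by (auto simp: theta_graph_def)
    then have "C = h u \<and> D = h v \<or> C = h v \<and> D = h u" by (auto simp: doubleton_eq_iff)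
    then show "E u v"
      using CD(2,3) intersect_at_angle_circ[OF _ _ \<theta>] rad uv E angle_rel_sym unfolding h_def by metis
  next
    assume "E u v"
    then have *: "u \<noteq> v" "angle_rel (cos \<theta>) (f u) (f v)" using E uv by auto
    then have "intersect_at_angle \<theta> (h u) (h v)" using intersect_at_angle_circ[OF _ _ \<theta>] rad uv by (simp add: h_def)
    moreover have "h u \<noteq> h v" using h_inj uv *(1) by blast
    ultimately show "{h u, h v} \<in> snd (theta_graph \<theta> (h ` V))" using uv unfolding theta_graph_def by auto
  qed
  have "is_circle C" if "C \<in> h ` V" for C using that rad by (auto simp: h_def circ_def is_circle_def)
  moreover have "enat g \<le> girth (theta_graph \<theta> (h ` V))"
    unfolding girth_def
  proof (rule INF_greatest)
    fix vs assume "vs \<in> {vs. is_cycle (theta_graph \<theta> (h ` V)) vs}"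
    then have cyc: "3 \<le> length vs" "distinct vs" "set vs \<subseteq> h ` V"
      and edges: "\<And>i. i < length vs \<Longrightarrow> {vs ! i, vs ! (Suc i mod length vs)} \<in> snd (theta_graph \<theta> (h ` V))"
      by (auto simp: is_cycle_def theta_graph_def)
    define ws where "ws = map (inv_into V h) vs"
    have len: "length ws = length vs" by (simp add: ws_def)
    have wsV: "set ws \<subseteq> V" using cyc(3) by (auto simp: ws_def intro: inv_into_into)
    have hws: "h (ws ! i) = vs ! i" if "i < length vs" for i
    proof -
      have "vs ! i \<in> h ` V" using cyc(3) nth_mem[OF that] by blast
      then show ?thesis using that by (simp add: ws_def f_inv_into_f)
    qed
    have "map h ws = vs" by (rule nth_equalityI) (simp_all add: len hws)
    then have "distinct ws" using cyc(2) distinct_map by metis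
    have "\<not> length vs < g"
    proof
      assume "length vs < g"
      have "2 * length ws \<le> card (edges_in E (set ws))"
      proof (rule card_edges_in_cycle)
        fix i assume i: "i < length ws"
        let ?j = "Suc i mod length ws"
        have j: "?j < length ws" using i by (intro mod_less_divisor) linarith
        have "{h (ws ! i), h (ws ! ?j)} \<in> snd (theta_graph \<theta> (h ` V))" using edges[of i] hws i j len by simp
        moreover from this have "{h (ws ! ?j), h (ws ! i)} \<in> snd (theta_graph \<theta> (h ` V))" by (simp only: insert_commute)
        moreover have "ws ! i \<in> V" "ws ! ?j \<in> V" using wsV i j by auto
        ultimately show "E (ws ! i) (ws ! ?j) \<and> E (ws ! ?j) (ws ! i)"
          using edge by blast
      qed (use cyc len \<open>distinct ws\<close> in auto)
      moreover have "card (edges_in E (set ws)) + 2 \<le> 2 * card (set ws)"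
      proof -
        have "set ws \<noteq> {}" "card (set ws) < g"
          using cyc(1) len \<open>length vs < g\<close> distinct_card[OF \<open>distinct ws\<close>] by auto
        then show ?thesis using forest wsV unfolding local_forest_def by blast
      qed
      ultimately show False using distinct_card[OF \<open>distinct ws\<close>] by simp
    qed
    then show "enat g \<le> enat (length vs)" by simp
  qed
  moreover have "enat k \<le> chromatic_number (theta_graph \<theta> (h ` V))"
    unfolding chromatic_number_def
  proof (rule INF_greatest)
    fix n assume "n \<in> {n. \<exists>c. proper_colouring (theta_graph \<theta> (h ` V)) n c}"
    then obtain c where c: "c ` (h ` V) \<subseteq> {..<n}"
      and proper: "\<And>C D. {C, D} \<in> snd (theta_graph \<theta> (h ` V)) \<Longrightarrow> c C \<noteq> c D"
      by (auto simp: proper_colouring_def theta_graph_def)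
    have "\<not> n < k"
    proof
      assume "n < k"
      then have "\<forall>v\<in>V. c (h v) < k" using c by fastforce
      then obtain u v where "u \<in> V" "v \<in> V" "E u v" "c (h u) = c (h v)"
        using unc[unfolded uncolourable_def, rule_format, of "\<lambda>v. c (h v)"] by blast
      then show False using proper edge by blast
    qed
    then show "enat k \<le> enat n" by simp
  qed
  ultimately show ?thesis by blast
qed

text \<open>\<open>\<kappa> = 1\<close> means internal or external tangency; the first hypothesis
  excludes the latter.\<close>

lemma angle_rel_one_iff:
  assumes "sqdist u v \<noteq> (rad u + rad v)\<^sup>2" "0 < rad u" "0 < rad v"
  shows "angle_rel 1 u v \<longleftrightarrow> null_rel u v"
proof -
  have "0 < rad u * rad v" using assms by simp
  then show ?thesis
    using assms(1) unfolding angle_rel_def null_rel_def power2_sum power2_diff by (auto simp: abs_if)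
qed

theorem theorem2:
  fixes \<theta> :: real and g k :: nat
  assumes "0 \<le> \<theta>" and "\<theta> \<le> pi / 2" and "g > 0" and "k > 0"
  shows "\<exists>\<C> :: (real^2) set set. (\<forall>C\<in>\<C>. is_circle C) \<and>
    girth (theta_graph \<theta> \<C>) \<ge> enat g \<and>
    chromatic_number (theta_graph \<theta> \<C>) \<ge> enat k"
proof (cases "\<theta> = 0")
  case True
  have "\<exists>V. finite V \<and> local_forest g tangent_rel V \<and> uncolourable k tangent_rel V"
  proof (rule ex_local_forest_uncolourable)
    show "tangent_rel u v \<Longrightarrow> tangent_rel v u" for u v using null_rel_sym by (auto simp: tangent_rel_def)
    show "\<not> tangent_rel v v" for v by (simp add: tangent_rel_def)
    show "finite {(0, 0, 0) :: triple}" by simp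
  qed (assumption | rule tangent_family_extend)+
  then obtain V where V: "finite V" "local_forest g tangent_rel V" "uncolourable k tangent_rel V" by blast
  \<comment> \<open>The centres are at most \<open>2 * R\<close> apart, and adding
    \<open>2 * R + 1\<close> makes every radius larger than \<open>R\<close>.\<close>
  obtain R where R: "R \<ge> 0" "\<forall>v\<in>V. \<bar>xc v\<bar> + \<bar>yc v\<bar> + \<bar>rad v\<bar> \<le> R"
    using finite_upper_bound[OF V(1), of "\<lambda>v. \<bar>xc v\<bar> + \<bar>yc v\<bar> + \<bar>rad v\<bar>"] by blast
  \<comment> \<open>Large radii rule out external tangency.\<close>
  define f where "f v = (xc v, yc v, rad v + (2 * R + 1))" for v :: triple
  have rad_f: "R < rad (f v)" if "v \<in> V" for v
  proof -
    have "\<bar>xc v\<bar> + \<bar>yc v\<bar> + \<bar>rad v\<bar> \<le> R" using R(2) that by blast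
    then have "- R \<le> rad v" by linarith
    then show ?thesis by (simp add: f_def)
  qed
  show ?thesis
  proof (rule theta_graph_of_family[OF assms(1,2) V, of f])
    show "inj_on f V" by (rule inj_onI) (simp add: f_def prod_eq_iff)
    show "0 < rad (f v)" if "v \<in> V" for v using rad_f[OF that] R(1) by linarith
    fix u v assume uv: "u \<in> V" "v \<in> V"
    have "sqdist (f u) (f v) \<le> (\<bar>xc u - xc v\<bar> + \<bar>yc u - yc v\<bar>)\<^sup>2"
      by (simp add: f_def sqdist_def power2_sum)
    also have "\<dots> < (rad (f u) + rad (f v))\<^sup>2"
    proof (rule power_strict_mono)
      have "\<bar>xc u\<bar> + \<bar>yc u\<bar> + \<bar>rad u\<bar> \<le> R" "\<bar>xc v\<bar> + \<bar>yc v\<bar> + \<bar>rad v\<bar> \<le> R" using R(2) uv by blast+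
      then have "\<bar>xc u - xc v\<bar> + \<bar>yc u - yc v\<bar> \<le> R + R" by linarith
      then show "\<bar>xc u - xc v\<bar> + \<bar>yc u - yc v\<bar> < rad (f u) + rad (f v)"
        using rad_f[OF uv(1)] rad_f[OF uv(2)] by linarith
    qed auto
    finally have "angle_rel 1 (f u) (f v) \<longleftrightarrow> null_rel (f u) (f v)"
      using rad_f[OF uv(1)] rad_f[OF uv(2)] R(1) by (intro angle_rel_one_iff) auto
    \<comment> \<open>Only the difference of the radii enters, and a common shift preserves
      it.\<close>
    moreover have "null_rel (f u) (f v) \<longleftrightarrow> null_rel u v" by (simp add: null_rel_def sqdist_def f_def)
    ultimately show "tangent_rel u v \<longleftrightarrow> u \<noteq> v \<and> angle_rel (cos \<theta>) (f u) (f v)"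
      using True by (simp add: tangent_rel_def)
  qed
next
  case False
  have \<kappa>: "0 \<le> cos \<theta>" "cos \<theta> < 1"
    using assms(1,2) False cos_monotone_0_pi[of 0 \<theta>] by (auto intro: cos_ge_zero)
  have "\<exists>V. circle_family V \<and> local_forest g (circle_rel (cos \<theta>)) V \<and> uncolourable k (circle_rel (cos \<theta>)) V"
  proof (rule ex_local_forest_uncolourable)
    show "circle_rel (cos \<theta>) u v \<Longrightarrow> circle_rel (cos \<theta>) v u" for u v
      using angle_rel_sym by (auto simp: circle_rel_def)
    show "\<not> circle_rel (cos \<theta>) v v" for v by (simp add: circle_rel_def)
    show "circle_family {(0, 0, 1)}" by (simp add: circle_family_def)
    show "circle_family C \<Longrightarrow> finite C" for C by (simp add: circle_family_def)
  qed (rule circle_family_extend[OF \<kappa>])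
  then obtain V where V: "circle_family V" "local_forest g (circle_rel (cos \<theta>)) V" "uncolourable k (circle_rel (cos \<theta>)) V"
    by blast
  show ?thesis
  proof (rule theta_graph_of_family[OF assms(1,2) _ V(2,3), of "\<lambda>v. v"])
    show "finite V" using V(1) by (simp add: circle_family_def)
    show "0 < rad v" if "v \<in> V" for v using V(1) that by (simp add: circle_family_def)
  qed (simp_all add: circle_rel_def)
qed

end
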